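(* Assume $b_3=-1$. For $n\ge2$ let $T(2,n)$ denote the $(2,n)$ torus link, that is, the (blackboard framed) link obtained by taking the numerator closure of the tangle $D_n$. Then in the cubic skein module of $S^3$, $$T(2,n)=t\Big(aP_{n-1}+(b_1P_{n-2}+b_0P_{n-3})t+a^{-1}b_0P_{n-2}+U_{n,n-1}b_\infty\Big).$$
   Context: Ring: $R=\mathbb{Z}[b_0^{\pm1},b_1,b_2,b_\infty^{\pm1},a^{\pm1}]$ with $b_3=-1$. $P_{-2}=P_{-1}=0$, $P_0=1$, $P_k=b_2P_{k-1}+b_1P_{k-2}+b_0P_{k-3}$ for $k\ge1$; $U_{n,k}=\sum_{i=0}^{k-1}a^{3-n+i}P_i$. $2$-tangles: $D_0$ is two horizontal arcs (NW to NE, SW to SE), $D_\infty$ is two vertical arcs (NW to SW, NE to SE), and $D_n$ is two horizontal strands twisted by $n$ right-handed half-twists ($|n|$ left-handed ones if $n<0$), all with blackboard framing. The numerator closure of a $2$-tangle joins NW to NE and SW to SE by simple arcs; the numerator closure of $D_1$ is the unknot with framing $+1$. The cubic skein module $\mathcal{S}_{4,\infty}(S^3)$ is the quotient of the free $R$-module on ambient isotopy classes of unoriented framed links in $S^3$ by the submodule generated by $b_0D_0+b_1D_1+b_2D_2+b_3D_3+b_\infty D_\infty$ (framed links identical outside a $3$-ball and equal to the indicated tangles inside it) and $D^{(1)}-aD$, where $D^{(1)}$ is $D$ with its framing twisted by one positive full twist. It is an algebra under disjoint (split) union; $t$ denotes the class of the trivial ($0$-framed) knot, so $t^2$ is the class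 of the $2$-component trivial link and $D\sqcup\bigcirc=tD$. *)

theory Defs
  imports "HOL-Analysis.Analysis" "HOL-Library.Poly_Mapping"
begin

section \<open>The ground ring\<close>

text \<open>
  The ring of polynomials over the integers in \<open>b\<^sub>0\<^sup>\<plusminus>\<^sup>1, b\<^sub>1, b\<^sub>2, b\<^sub>\<infinity>\<^sup>\<plusminus>\<^sup>1, a\<^sup>\<plusminus>\<^sup>1\<close> is the monoid
  ring of the monoid of exponents; the key \<open>(i, j, k, l, m)\<close> stands for the monomial
  \<open>b\<^sub>0\<^sup>i b\<^sub>1\<^sup>j b\<^sub>2\<^sup>k b\<^sub>\<infinity>\<^sup>l a\<^sup>m\<close>, and multiplication is the convolution product of
  \<^theory>\<open>HOL-Library.Poly_Mapping\<close>.
\<close>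

type_synonym ground_ring = "(int \<times> nat \<times> nat \<times> int \<times> int) \<Rightarrow>\<^sub>0 int"

definition b0 :: ground_ring where "b0 = Poly_Mapping.single (1, 0, 0, 0, 0) 1"
definition b1 :: ground_ring where "b1 = Poly_Mapping.single (0, 1, 0, 0, 0) 1"
definition b2 :: ground_ring where "b2 = Poly_Mapping.single (0, 0, 1, 0, 0) 1"
definition b3 :: ground_ring where "b3 = -1"
definition b_inf :: ground_ring where "b_inf = Poly_Mapping.single (0, 0, 0, 1, 0) 1"
definition a_pow :: "int \<Rightarrow> ground_ring" where "a_pow m = Poly_Mapping.single (0, 0, 0, 0, m) 1"

text \<open>\<open>P_shift m\<close> is \<open>P\<^sub>m\<^sub>-\<^sub>2\<close>, so that the recursion starts at the index \<open>-2\<close>.\<close>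

fun P_shift :: "nat \<Rightarrow> ground_ring" where
  "P_shift 0 = 0"
| "P_shift (Suc 0) = 0"
| "P_shift (Suc (Suc 0)) = 1"
| "P_shift (Suc (Suc (Suc m))) =
     b2 * P_shift (Suc (Suc m)) + b1 * P_shift (Suc m) + b0 * P_shift m"

definition P :: "int \<Rightarrow> ground_ring" where
  "P k = P_shift (nat (k + 2))"

definition U :: "nat \<Rightarrow> nat \<Rightarrow> ground_ring" where
  "U n k = (\<Sum>i<k. a_pow (3 - int n + int i) * P (int i))"


section \<open>Framed links in the 3-sphere\<close>

type_synonym R3 = "real \<times> real \<times> real"
type_synonym R4 = "R3 \<times> real"

abbreviation S3 :: "R4 set" where "S3 \<equiv> sphere 0 1"

text \<open>
  Inverse stereographic projection. Pictures are drawn in the first two coordinates of \<open>R3\<close>,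
  seen from the positive third axis; this also fixes the orientation of the 3-sphere.
\<close>

definition to_S3 :: "R3 \<Rightarrow> R4" where
  "to_S3 p = ((2 / (1 + (norm p)\<^sup>2)) *\<^sub>R p, ((norm p)\<^sup>2 - 1) / (1 + (norm p)\<^sup>2))"

text \<open>
  Framed links and framed tangles are represented by bands: a pair consisting of the underlying
  curve (the core) and of the surface it spans with its framing. The core is determined by the
  surface up to isotopy, but it has to be part of the data: otherwise a band inside a ball could
  be a mere finger pushed out of an annulus, and twisting such a finger does not change
  the framed link.
\<close>

type_synonym 'a band = "'a set \<times> 'a set"

definition band_image :: "('a \<Rightarrow> 'b) \<Rightarrow> 'a band \<Rightarrow> 'b band" where
  "band_image f K = (f ` fst K, f ` snd K)"

definition band_union :: "'a band \<Rightarrow> 'a band \<Rightarrow> 'a band" where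
  "band_union K L = (fst K \<union> fst L, snd K \<union> snd L)"

definition band_minus :: "'a band \<Rightarrow> 'a set \<Rightarrow> 'a band" where
  "band_minus K X = (fst K - X, snd K - X)"

text \<open>
  A framed knot is an embedded annulus. It is required to extend to an embedded solid torus, which
  excludes wild annuli.
\<close>

definition framed_knot :: "R4 band \<Rightarrow> bool" where
  "framed_knot K \<longleftrightarrow> (\<exists>e :: complex \<times> real \<times> real \<Rightarrow> R4.
     continuous_on (sphere 0 1 \<times> {-1..1} \<times> {-1..1}) e \<and>
     inj_on e (sphere 0 1 \<times> {-1..1} \<times> {-1..1}) \<and>
     e ` (sphere 0 1 \<times> {-1..1} \<times> {-1..1}) \<subseteq> S3 \<and>
     fst K = e ` (sphere 0 1 \<times> {0} \<times> {0}) \<and>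
     snd K = e ` (sphere 0 1 \<times> {-1..1} \<times> {0}))"

definition framed_link :: "R4 band \<Rightarrow> bool" where
  "framed_link L \<longleftrightarrow> (\<exists>\<K>. finite \<K> \<and> (\<forall>K\<in>\<K>. framed_knot K) \<and>
     pairwise (\<lambda>K K'. disjnt (snd K) (snd K')) \<K> \<and>
     L = (\<Union>(fst ` \<K>), \<Union>(snd ` \<K>)))"

text \<open>\<open>g\<close> is the final stage of an ambient isotopy.\<close>

definition isotopic_to_id :: "(R4 \<Rightarrow> R4) \<Rightarrow> bool" where
  "isotopic_to_id g \<longleftrightarrow> (\<exists>H :: real \<Rightarrow> R4 \<Rightarrow> R4.
     continuous_on ({0..1} \<times> S3) (\<lambda>(s, x). H s x) \<and>
     (\<forall>s\<in>{0..1}. \<exists>h. homeomorphism S3 S3 (H s) h) \<and>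
     (\<forall>x\<in>S3. H 0 x = x \<and> H 1 x = g x))"

definition ambient_isotopic :: "R4 band \<Rightarrow> R4 band \<Rightarrow> bool" where
  "ambient_isotopic L L' \<longleftrightarrow>
     framed_link L \<and> framed_link L' \<and> (\<exists>g. isotopic_to_id g \<and> L' = band_image g L)"

lemma framed_link_subset:
  assumes "framed_link L"
  shows "fst L \<subseteq> S3" "snd L \<subseteq> S3"
proof -
  have "fst K \<subseteq> S3 \<and> snd K \<subseteq> S3" if K: "framed_knot K" for K
  proof -
    obtain e :: "complex \<times> real \<times> real \<Rightarrow> R4" where e:
      "e ` (sphere 0 1 \<times> {-1..1} \<times> {-1..1}) \<subseteq> S3"
      "fst K = e ` (sphere 0 1 \<times> {0} \<times> {0})"
      "snd K = e ` (sphere 0 1 \<times> {-1..1} \<times> {0})"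
      using K unfolding framed_knot_def by blast
    have "sphere (0::complex) 1 \<times> {0::real} \<times> {0::real} \<subseteq> sphere 0 1 \<times> {-1..1} \<times> {-1..1}"
      "sphere (0::complex) 1 \<times> {-1..1::real} \<times> {0::real} \<subseteq> sphere 0 1 \<times> {-1..1} \<times> {-1..1}"
      by auto
    then show ?thesis unfolding e(2,3) using e(1) by blast
  qed
  with assms show "fst L \<subseteq> S3" "snd L \<subseteq> S3"
    unfolding framed_link_def by fastforce+
qed

lemma isotopic_to_id_id: "isotopic_to_id (\<lambda>x. x)"
  unfolding isotopic_to_id_def
proof (intro exI conjI ballI)
  show "continuous_on ({0..1} \<times> S3) (\<lambda>(s::real, x). x)"
    by (auto simp: case_prod_unfold intro!: continuous_intros)
  show "homeomorphism S3 S3 (\<lambda>x. x) (\<lambda>x. x)"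
    by (auto simp: homeomorphism_def)
qed auto

lemma isotopic_to_id_comp:
  assumes "isotopic_to_id g" "isotopic_to_id g'"
  shows "isotopic_to_id (\<lambda>x. g' (g x))"
proof -
  obtain H where H: "continuous_on ({0..1} \<times> S3) (\<lambda>(s, x). H s x)"
    "\<forall>s\<in>{0..1::real}. \<exists>h. homeomorphism S3 S3 (H s) h" "\<forall>x\<in>S3. H 0 x = x \<and> H 1 x = g x"
    using assms(1) unfolding isotopic_to_id_def by blast
  obtain H' where H': "continuous_on ({0..1} \<times> S3) (\<lambda>(s, x). H' s x)"
    "\<forall>s\<in>{0..1::real}. \<exists>h. homeomorphism S3 S3 (H' s) h" "\<forall>x\<in>S3. H' 0 x = x \<and> H' 1 x = g' x"
    using assms(2) unfolding isotopic_to_id_def by blast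
  have mem: "H s x \<in> S3" if "s \<in> {0..1}" "x \<in> S3" for s x
    using H(2) that unfolding homeomorphism_def by blast
  have "continuous_on ({0..1} \<times> S3) (\<lambda>q. (case (fst q, case q of (s, x) \<Rightarrow> H s x) of (s, x) \<Rightarrow> H' s x))"
    by (rule continuous_on_compose2[OF H'(1)])
       (use mem in \<open>auto intro!: continuous_intros H(1)\<close>)
  then have c: "continuous_on ({0..1} \<times> S3) (\<lambda>(s, x). H' s (H s x))"
    by (simp add: case_prod_unfold)
  show ?thesis
    unfolding isotopic_to_id_def
  proof (rule exI[of _ "\<lambda>s x. H' s (H s x)"], intro conjI ballI)
    show "continuous_on ({0..1} \<times> S3) (\<lambda>(s, x). H' s (H s x))" by (fact c)
    fix s :: real assume s: "s \<in> {0..1}"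
    obtain h h' where "homeomorphism S3 S3 (H s) h" "homeomorphism S3 S3 (H' s) h'"
      using H(2) H'(2) s by blast
    from homeomorphism_compose[OF this]
    show "\<exists>h. homeomorphism S3 S3 (\<lambda>x. H' s (H s x)) h"
      by (auto simp: o_def)
  next
    fix x :: R4 assume x: "x \<in> S3"
    show "H' 0 (H 0 x) = x" using H(3) H'(3) x by simp
    have "g x \<in> S3" using mem[of 1 x] H(3) x by simp
    then show "H' 1 (H 1 x) = g' (g x)" using H(3) H'(3) x by simp
  qed
qed

lemma isotopic_to_id_inverse:
  assumes "isotopic_to_id g"
  shows "\<exists>g'. isotopic_to_id g' \<and> (\<forall>x\<in>S3. g' (g x) = x)"
proof -
  obtain H where H: "continuous_on ({0..1} \<times> S3) (\<lambda>(s, x). H s x)"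
    "\<forall>s\<in>{0..1::real}. \<exists>h. homeomorphism S3 S3 (H s) h" "\<forall>x\<in>S3. H 0 x = x \<and> H 1 x = g x"
    using assms unfolding isotopic_to_id_def by blast
  have "(1::real) \<in> {0..1}" by simp
  then obtain k where k: "homeomorphism S3 S3 (H 1) k" using H(2) by blast
  have k': "homeomorphism S3 S3 k (H 1)" using k by (rule homeomorphism_symD)
  have ck: "continuous_on S3 k" and kS: "k x \<in> S3" if "x \<in> S3" for x
    using k that unfolding homeomorphism_def by blast+
  have "continuous_on ({0..1} \<times> S3)
      (\<lambda>q. (case (1 - fst q, k (snd q)) of (s, x) \<Rightarrow> H s x))"
    by (rule continuous_on_compose2[OF H(1)])
       (use kS homeomorphism_cont1[OF k'] in
        \<open>auto intro!: continuous_intros intro: continuous_on_compose2\<close>)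
  then have c: "continuous_on ({0..1} \<times> S3) (\<lambda>(s, x). H (1 - s) (k x))"
    by (simp add: case_prod_unfold)
  have "isotopic_to_id k"
    unfolding isotopic_to_id_def
  proof (rule exI[of _ "\<lambda>s x. H (1 - s) (k x)"], intro conjI ballI)
    show "continuous_on ({0..1} \<times> S3) (\<lambda>(s, x). H (1 - s) (k x))" by (fact c)
    fix s :: real assume "s \<in> {0..1}"
    then have "1 - s \<in> {0..1}" by simp
    then obtain h where "homeomorphism S3 S3 (H (1 - s)) h" using H(2) by blast
    from homeomorphism_compose[OF k' this]
    show "\<exists>h. homeomorphism S3 S3 (\<lambda>x. H (1 - s) (k x)) h"
      by (auto simp: o_def)
  next
    fix x :: R4 assume x: "x \<in> S3"
    show "H (1 - 0) (k x) = x" using homeomorphism_apply2[OF k x] by simp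
    show "H (1 - 1) (k x) = k x" using H(3) kS[OF x] by simp
  qed
  moreover have "\<forall>x\<in>S3. k (g x) = x"
    using H(3) homeomorphism_apply1[OF k] by metis
  ultimately show ?thesis by blast
qed

lemma framed_link_empty: "framed_link ({}, {})"
  unfolding framed_link_def by (rule exI[of _ "{}"]) auto

quotient_type link_class = "R4 band" / partial: ambient_isotopic
proof (rule part_equivpI)
  have "ambient_isotopic ({}, {}) ({}, {})"
    using framed_link_empty isotopic_to_id_id
    unfolding ambient_isotopic_def band_image_def by auto
  then show "\<exists>L. ambient_isotopic L L" by blast
  show "symp ambient_isotopic"
  proof (rule sympI)
    fix L L' assume *: "ambient_isotopic L L'"
    then obtain g where g: "isotopic_to_id g" "L' = band_image g L" "framed_link L"
      unfolding ambient_isotopic_def by blast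
    obtain g' where g': "isotopic_to_id g'" "\<forall>x\<in>S3. g' (g x) = x"
      using isotopic_to_id_inverse[OF g(1)] by blast
    have "g' ` g ` X = X" if "X \<subseteq> S3" for X
      using g'(2) that by (force simp: image_iff)
    then have "L = band_image g' L'"
      using framed_link_subset[OF g(3)] g(2) by (simp add: band_image_def)
    then show "ambient_isotopic L' L"
      using * g'(1) unfolding ambient_isotopic_def by blast
  qed
  show "transp ambient_isotopic"
  proof (rule transpI)
    fix L L' L'' assume *: "ambient_isotopic L L'" "ambient_isotopic L' L''"
    then obtain g g' where g: "isotopic_to_id g" "L' = band_image g L"
      "isotopic_to_id g'" "L'' = band_image g' L'"
      unfolding ambient_isotopic_def by blast
    have "L'' = band_image (\<lambda>x. g' (g x)) L"
      using g(2,4) by (simp add: band_image_def image_image)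
    then show "ambient_isotopic L L''"
      using * isotopic_to_id_comp[OF g(1,3)] unfolding ambient_isotopic_def by blast
  qed
qed


section \<open>Tangles\<close>

text \<open>
  Tangles live in the cube \<open>tangle_box\<close>, with end points NW, NE, SW, SE equal to
  \<open>(-4, 2, 0)\<close>, \<open>(4, 2, 0)\<close>, \<open>(-4, -2, 0)\<close>, \<open>(4, -2, 0)\<close>. All bands are flat and horizontal
  near these points.
\<close>

definition tangle_box :: "R3 set" where
  "tangle_box = {-4..4} \<times> {-4..4} \<times> {-4..4}"

text \<open>Grows from \<open>0\<close> to \<open>1\<close> on \<open>{-3..3}\<close> and is constant elsewhere.\<close>

definition turn :: "real \<Rightarrow> real" where
  "turn x = max 0 (min 1 ((x + 3) / 6))"

text \<open>
  Two strands winding around the first axis with a total rotation by \<open>n * pi\<close>, counterclockwise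
  as the first coordinate grows (hence right-handed) for \<open>n > 0\<close>. The framing is
  blackboard: it is parallel to the second axis, so parallel to the plane of projection,
  and transverse to the projected strands.
\<close>

definition twist_points :: "int \<Rightarrow> real set \<Rightarrow> R3 set" where
  "twist_points n I =
     {(x, c * 2 * cos (of_int n * pi * turn x) + r, c * 2 * sin (of_int n * pi * turn x)) | x c r.
        \<bar>x\<bar> \<le> 4 \<and> c \<in> {-1, 1} \<and> r \<in> I}"

definition tangle_D :: "int \<Rightarrow> R3 band" where
  "tangle_D n = (twist_points n {0}, twist_points n {-1..1})"

definition vertical_points :: "real set \<Rightarrow> R3 set" where
  "vertical_points I = {(x, y, 0) | x y. \<bar>x\<bar> \<le> 4 \<and> max (4 - \<bar>x\<bar>) \<bar>y\<bar> \<in> I}"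

definition tangle_D_inf :: "R3 band" where
  "tangle_D_inf = (vertical_points {2}, vertical_points {1..3})"

text \<open>A single strand whose framing makes \<open>k\<close> full right-handed twists.\<close>

definition strip_points :: "nat \<Rightarrow> real set \<Rightarrow> R3 set" where
  "strip_points k I =
     {(x, r * cos (2 * pi * real k * turn x), r * sin (2 * pi * real k * turn x)) | x r.
        \<bar>x\<bar> \<le> 4 \<and> r \<in> I}"

definition strip :: "nat \<Rightarrow> R3 band" where
  "strip k = (strip_points k {0}, strip_points k {-1..1})"

text \<open>A planar annulus, bounded by two rectangles centred at \<open>(0, y\<^sub>0, 0)\<close>.\<close>

definition frame_points :: "real \<Rightarrow> real set \<Rightarrow> R3 set" where
  "frame_points y0 I = {(x, y, 0) | x y. max (\<bar>x\<bar> - 3) \<bar>y - y0\<bar> \<in> I}"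

definition frame :: "real \<Rightarrow> R3 band" where
  "frame y0 = (frame_points y0 {3}, frame_points y0 {2..4})"

text \<open>
  The frames centred at \<open>(0, 5, 0)\<close> and \<open>(0, -5, 0)\<close> meet the cube in the bands of \<open>tangle_D 0\<close>; outside
  the cube they are planar arcs that join NW to NE and SW to SE.
\<close>

definition numerator_closure :: "R3 band \<Rightarrow> R4 band" where
  "numerator_closure T = band_image to_S3
     (band_union T (band_minus (band_union (frame 5) (frame (-5))) tangle_box))"

definition torus_link :: "nat \<Rightarrow> R4 band" where
  "torus_link n = numerator_closure (tangle_D (int n))"

definition trivial_link :: "nat \<Rightarrow> R4 band" where
  "trivial_link k = band_image to_S3
     (\<Union>j<k. fst (frame (10 * real j)), \<Union>j<k. snd (frame (10 * real j)))"


section \<open>The cubic skein module\<close>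

type_synonym free_module = "link_class \<Rightarrow>\<^sub>0 ground_ring"

definition free_scale :: "ground_ring \<Rightarrow> free_module \<Rightarrow> free_module" where
  "free_scale c f = Poly_Mapping.map ((*) c) f"

lemma lookup_free_scale [simp]:
  "Poly_Mapping.lookup (free_scale c f) k = c * Poly_Mapping.lookup f k"
  unfolding free_scale_def by (simp add: Poly_Mapping.map.rep_eq when_def)

interpretation free: module free_scale
  by standard (auto intro!: poly_mapping_eqI simp: lookup_add algebra_simps)

definition link_gen :: "R4 band \<Rightarrow> free_module" where
  "link_gen L = Poly_Mapping.single (abs_link_class L) 1"

text \<open>
  \<open>insert_tangle g X T\<close> agrees with \<open>X\<close> outside the ball \<open>g ` to_S3 ` tangle_box\<close> and
  is the image of the tangle \<open>T\<close> inside it.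
\<close>

definition insert_tangle :: "(R4 \<Rightarrow> R4) \<Rightarrow> R4 band \<Rightarrow> R3 band \<Rightarrow> R4 band" where
  "insert_tangle g X T = band_union X (band_image (\<lambda>p. g (to_S3 p)) T)"

definition outside_ball :: "(R4 \<Rightarrow> R4) \<Rightarrow> R4 band \<Rightarrow> bool" where
  "outside_ball g X \<longleftrightarrow> fst X \<inter> g ` to_S3 ` tangle_box = {} \<and> snd X \<inter> g ` to_S3 ` tangle_box = {}"

definition cubic_relators :: "free_module set" where
  "cubic_relators =
     {free_scale b0 (link_gen (insert_tangle g X (tangle_D 0)))
      + free_scale b1 (link_gen (insert_tangle g X (tangle_D 1)))
      + free_scale b2 (link_gen (insert_tangle g X (tangle_D 2)))
      + free_scale b3 (link_gen (insert_tangle g X (tangle_D 3)))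
      + free_scale b_inf (link_gen (insert_tangle g X tangle_D_inf)) | g X.
      isotopic_to_id g \<and> outside_ball g X \<and>
      (\<forall>T\<in>{tangle_D 0, tangle_D 1, tangle_D 2, tangle_D 3, tangle_D_inf}. framed_link (insert_tangle g X T))}"

definition framing_relators :: "free_module set" where
  "framing_relators =
     {link_gen (insert_tangle g X (strip 1))
      - free_scale (a_pow 1) (link_gen (insert_tangle g X (strip 0))) | g X.
      isotopic_to_id g \<and> outside_ball g X \<and>
      (\<forall>T\<in>{strip 0, strip 1}. framed_link (insert_tangle g X T))}"

definition skein_submodule :: "free_module set" where
  "skein_submodule = free.span (cubic_relators \<union> framing_relators)"

definition skein_equiv :: "free_module \<Rightarrow> free_module \<Rightarrow> bool" where
  "skein_equiv x y \<longleftrightarrow> x - y \<in> skein_submodule"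

quotient_type skein_module = free_module / skein_equiv
proof (rule equivpI)
  show "reflp skein_equiv"
    by (rule reflpI) (simp add: skein_equiv_def skein_submodule_def free.span_zero)
  show "symp skein_equiv"
    by (rule sympI)
       (use free.span_neg in \<open>fastforce simp: skein_equiv_def skein_submodule_def\<close>)
  show "transp skein_equiv"
  proof (rule transpI)
    fix x y z assume "skein_equiv x y" "skein_equiv y z"
    then have "(x - y) + (y - z) \<in> skein_submodule"
      unfolding skein_equiv_def skein_submodule_def by (rule free.span_add)
    then show "skein_equiv x z" by (simp add: skein_equiv_def)
  qed
qed

instantiation skein_module :: ab_group_add
begin

lift_definition zero_skein_module :: skein_module is 0 .

lift_definition plus_skein_module :: "skein_module \<Rightarrow> skein_module \<Rightarrow> skein_module" is "(+)"
proof -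
  fix x x' y y' assume "skein_equiv x x'" "skein_equiv y y'"
  then have "(x - x') + (y - y') \<in> skein_submodule"
    unfolding skein_equiv_def skein_submodule_def by (rule free.span_add)
  then show "skein_equiv (x + y) (x' + y')" by (simp add: skein_equiv_def add_diff_add)
qed

lift_definition uminus_skein_module :: "skein_module \<Rightarrow> skein_module" is uminus
proof -
  fix x x' assume "skein_equiv x x'"
  then have "- (x - x') \<in> skein_submodule"
    unfolding skein_equiv_def skein_submodule_def by (rule free.span_neg)
  then show "skein_equiv (- x) (- x')" by (simp add: skein_equiv_def)
qed

definition minus_skein_module :: "skein_module \<Rightarrow> skein_module \<Rightarrow> skein_module" where
  "minus_skein_module x y = x + - y"

instance
proof
  have refl: "skein_equiv x x" for x
    by (simp add: skein_equiv_def skein_submodule_def free.span_zero)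
  fix x y z :: skein_module
  show "x + y + z = x + (y + z)" by transfer (simp add: refl add.assoc)
  show "x + y = y + x" by transfer (simp add: refl add.commute)
  show "0 + x = x" by transfer (simp add: refl)
  show "- x + x = 0" by transfer (simp add: refl)
  show "x - y = x + - y" by (fact minus_skein_module_def)
qed

end

lift_definition skein_scale :: "ground_ring \<Rightarrow> skein_module \<Rightarrow> skein_module"  (infixr \<open>\<odot>\<close> 75)
  is free_scale
proof -
  fix c x x' assume "skein_equiv x x'"
  then have "free_scale c (x - x') \<in> skein_submodule"
    unfolding skein_equiv_def skein_submodule_def by (rule free.span_scale)
  then show "skein_equiv (free_scale c x) (free_scale c x')"
    by (simp add: skein_equiv_def free.scale_right_diff_distrib)
qed

definition skein_of :: "R4 band \<Rightarrow> skein_module" where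
  "skein_of L = abs_skein_module (link_gen L)"

text \<open>
  Powers of the class \<open>t\<close> of the trivial knot, where the product of the skein module is split
  union: \<open>t\<^sup>k\<close> is the class of the 0-framed trivial link with \<open>k\<close> components.
\<close>

definition t_power :: "nat \<Rightarrow> skein_module" where
  "t_power k = skein_of (trivial_link k)"

end

theory Submission
  imports Defs
begin

text \<open>
  If a homeomorphism \<open>h\<close> of 3-space moves all points by a bounded distance, then \<open>s h(x/s)\<close> is an ambient
  isotopy from the identity to \<open>h\<close> that extends over infinity. So all isotopies below can be given by
  explicit bounded homeomorphisms, without any deformation.

  The cubic relation, applied to the end of a long twist region, gives
  \<open>T(m+3) = b\<^sub>2 T(m+2) + b\<^sub>1 T(m+1) + b\<^sub>0 T(m) + b\<^sub>\<infinity> K(m)\<close>, where in \<open>K(m)\<close> the \<open>m\<close> half twists are closed by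
  a cap. Turning the cap undoes the crossings and leaves \<open>- m\<close> half twists in the ribbon of each of the two
  legs; slid around the cap they add up to \<open>- m\<close> full twists of an unknotted annulus, so
  \<open>K(m) = a\<^sup>-\<^sup>m t\<close>. The crossing in \<open>T(\<plusminus>1)\<close> is removed in the same way by turning about the other axis,
  which gives \<open>T(\<plusminus>1) = a\<^sup>\<plusminus>\<^sup>1 t\<close>. With \<open>T(0) = t\<^sup>2\<close> the recursion is solved by the stated formula.
\<close>

section \<open>Ambient isotopies from bounded homeomorphisms\<close>

text \<open>Every link in a relator must itself be a framed link, so embedded solid tori are
  required for all numbers of twists and for all tangles involved. They are written down only for
  planar rectangular frames; all other bands inherit them along isotopies, or through twist maps
  that are discontinuous in space but continuous near the band.

  The planar pieces are level sets of expressions in \<open>max\<close>, \<open>min\<close> and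
  absolute values, and the planar deformations are piecewise linear, so that equations between
  images reduce to linear arithmetic with case distinctions.

  The recursion holds for all integers, which allows the starting indices -1, 0 and 1. By
  superposition, T(1) = a t contributes a P(n-1) t, T(0) = t^2 contributes (b1 P(n-2) + b0 P(n-3))
  t^2, T(-1) = a^-1 t contributes a^-1 b0 P(n-2) t, and the inhomogeneous terms b_inf a^-m t
  accumulate to the sum \<open>U\<close>.\<close>

definition from_S3 :: "R4 \<Rightarrow> R3" where
  "from_S3 q = (1 / (1 - snd q)) *\<^sub>R fst q"

section \<open>Stereographic projection and chordal distances\<close>

lemma one_plus_norm_sq_pos: "0 < 1 + (norm (p::R3))\<^sup>2"
  by (simp add: add_pos_nonneg)

lemma from_to_S3 [simp]: "from_S3 (to_S3 p) = p"
proof -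
  have "1 - ((norm p)\<^sup>2 - 1) / (1 + (norm p)\<^sup>2) = 2 / (1 + (norm p)\<^sup>2)"
    using one_plus_norm_sq_pos[of p] by (simp add: field_simps)
  moreover have "1 / (2 / (1 + (norm p)\<^sup>2)) * (2 / (1 + (norm p)\<^sup>2)) = 1"
    using one_plus_norm_sq_pos[of p] by simp
  ultimately show ?thesis
    by (simp only: from_S3_def to_S3_def fst_conv snd_conv scaleR_scaleR scaleR_one)
qed

lemma inj_to_S3: "inj to_S3"
  by (metis from_to_S3 injI)

lemma to_S3_neq_pole: "to_S3 p \<noteq> (0, 1)"
  using one_plus_norm_sq_pos[of p] by (auto simp: to_S3_def field_simps)

text \<open>The chordal metric. Its two denominators are what turns a displacement bounded in space
  into one that vanishes at the pole.\<close>

lemma dist_to_S3_sq: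
  "(dist (to_S3 p) (to_S3 p'))\<^sup>2 = 4 * (dist p p')\<^sup>2 / ((1 + (norm p)\<^sup>2) * (1 + (norm p')\<^sup>2))"
proof -
  define a b where "a = (norm p)\<^sup>2" and "b = (norm p')\<^sup>2"
  have pos: "1 + a > 0" "1 + b > 0"
    unfolding a_def b_def by (rule one_plus_norm_sq_pos)+
  have d: "(dist p p')\<^sup>2 = a + b - 2 * inner p p'"
    unfolding a_def b_def dist_norm
    by (simp add: power2_norm_eq_inner inner_diff_left inner_diff_right inner_commute)
  have e: "to_S3 p = ((2 / (1 + a)) *\<^sub>R p, (a - 1) / (1 + a))"
    "to_S3 p' = ((2 / (1 + b)) *\<^sub>R p', (b - 1) / (1 + b))"
    by (simp_all add: to_S3_def a_def b_def)
  have ip: "inner p p = a" "inner p' p' = b"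
    by (simp_all add: a_def b_def power2_norm_eq_inner)
  have "(dist (to_S3 p) (to_S3 p'))\<^sup>2 =
      inner (to_S3 p) (to_S3 p) + inner (to_S3 p') (to_S3 p') - 2 * inner (to_S3 p) (to_S3 p')"
    unfolding dist_norm by (simp add: power2_norm_eq_inner inner_diff_left inner_diff_right inner_commute)
  also have "\<dots> = (2 / (1 + a))\<^sup>2 * a + ((a - 1) / (1 + a))\<^sup>2
      + ((2 / (1 + b))\<^sup>2 * b + ((b - 1) / (1 + b))\<^sup>2)
      - 2 * (2 / (1 + a) * (2 / (1 + b)) * inner p p' + (a - 1) / (1 + a) * ((b - 1) / (1 + b)))"
    unfolding e inner_Pair inner_scaleR_left inner_scaleR_right ip
    by (simp add: power2_eq_square)
  also have "(2 / (1 + a))\<^sup>2 * a + ((a - 1) / (1 + a))\<^sup>2 = 1"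
    using pos by (simp add: power_divide flip: add_divide_distrib) (simp add: power2_eq_square algebra_simps)
  also have "(2 / (1 + b))\<^sup>2 * b + ((b - 1) / (1 + b))\<^sup>2 = 1"
    using pos by (simp add: power_divide flip: add_divide_distrib) (simp add: power2_eq_square algebra_simps)
  also have "1 + 1 - 2 * (2 / (1 + a) * (2 / (1 + b)) * inner p p' + (a - 1) / (1 + a) * ((b - 1) / (1 + b)))
     = 4 * (a + b - 2 * inner p p') / ((1 + a) * (1 + b))"
    using pos by (simp add: divide_simps) (simp add: algebra_simps)
  finally show ?thesis by (simp add: d a_def b_def)
qed

lemma dist_to_S3_pole_sq: "(dist (to_S3 p) (0, 1))\<^sup>2 = 4 / (1 + (norm p)\<^sup>2)"
proof -
  define a where "a = (norm p)\<^sup>2"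
  have pos: "1 + a > 0" unfolding a_def by (rule one_plus_norm_sq_pos)
  have e: "to_S3 p - (0, 1) = ((2 / (1 + a)) *\<^sub>R p, (a - 1) / (1 + a) - 1)"
    by (simp add: to_S3_def a_def)
  have "(dist (to_S3 p) (0, 1))\<^sup>2 = (2 / (1 + a))\<^sup>2 * a + ((a - 1) / (1 + a) - 1)\<^sup>2"
    unfolding dist_norm e power2_norm_eq_inner inner_Pair inner_scaleR_left inner_scaleR_right
    by (simp add: power2_eq_square a_def flip: power2_norm_eq_inner)
  also have "(a - 1) / (1 + a) - 1 = - 2 / (1 + a)"
    using pos by (simp add: field_simps)
  also have "(2 / (1 + a))\<^sup>2 * a + (- 2 / (1 + a))\<^sup>2 = 4 * (1 + a) / ((1 + a) * (1 + a))"
    by (simp add: power2_eq_square add_divide_distrib distrib_left)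
  also have "\<dots> = 4 / (1 + a)" by (rule mult_divide_mult_cancel_right) (use pos in simp)
  finally show ?thesis by (simp add: a_def)
qed

lemma to_S3_in_S3: "to_S3 p \<in> S3"
proof -
  define a where "a = (norm p)\<^sup>2"
  have pos: "1 + a > 0" unfolding a_def by (rule one_plus_norm_sq_pos)
  have "inner (to_S3 p) (to_S3 p) = (2 / (1 + a))\<^sup>2 * a + ((a - 1) / (1 + a))\<^sup>2"
    unfolding to_S3_def inner_Pair inner_scaleR_left inner_scaleR_right
    by (simp add: power2_eq_square a_def flip: power2_norm_eq_inner)
  also have "\<dots> = 1"
    using pos by (simp add: power_divide flip: add_divide_distrib) (simp add: power2_eq_square algebra_simps)
  finally show ?thesis by (simp add: norm_eq_sqrt_inner)
qed

lemma to_from_S3: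
  assumes "q \<in> S3" "q \<noteq> (0, 1)"
  shows "to_S3 (from_S3 q) = q"
proof -
  obtain p t where q: "q = (p, t)" by (cases q)
  have 1: "(norm p)\<^sup>2 + t\<^sup>2 = 1"
    using assms(1) unfolding q by (simp add: norm_Pair)
  have "t \<noteq> 1" using 1 assms(2) unfolding q by auto
  moreover have "t \<le> 1"
  proof -
    have "t\<^sup>2 \<le> 1\<^sup>2" using 1 zero_le_power2[of "norm p"] unfolding one_power2 by linarith
    then show ?thesis by (rule power2_le_imp_le) simp
  qed
  ultimately have t: "1 - t > 0" by simp
  have n: "(norm (from_S3 q))\<^sup>2 = (1 + t) / (1 - t)"
  proof -
    have "(norm (from_S3 q))\<^sup>2 = (norm p)\<^sup>2 / (1 - t)\<^sup>2"
      using t by (simp add: from_S3_def q power_mult_distrib power_divide)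
    also have "(norm p)\<^sup>2 = (1 - t) * (1 + t)"
      using 1 by (simp add: power2_eq_square algebra_simps)
    finally show ?thesis using t by (simp add: power2_eq_square)
  qed
  have s: "1 + (1 + t) / (1 - t) = 2 / (1 - t)" using t by (simp add: field_simps)
  have s': "(1 + t) / (1 - t) - 1 = 2 * t / (1 - t)" using t by (simp add: field_simps)
  show ?thesis
    unfolding to_S3_def n s s' using t by (simp add: from_S3_def q)
qed

text \<open>One of the two denominators of the chordal formula is at least 1 and is dropped; the
  square root of the other gives the distance from \<open>to_S3 p\<close> to the pole. The estimate
  provides continuity at infinity for maps of bounded displacement.\<close>

lemma dist_to_S3_le:
  assumes "dist p p' \<le> B"
  shows "dist (to_S3 p') (to_S3 p) \<le> B * dist (to_S3 p) (0, 1)"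
proof -
  have B: "0 \<le> B" using assms zero_le_dist[of p p'] by linarith
  have "(dist (to_S3 p') (to_S3 p))\<^sup>2 \<le> 4 * (dist p p')\<^sup>2 / (1 + (norm p)\<^sup>2)"
  proof -
    have "4 * (dist p p')\<^sup>2 / ((1 + (norm p)\<^sup>2) * (1 + (norm p')\<^sup>2)) \<le> 4 * (dist p p')\<^sup>2 / ((1 + (norm p)\<^sup>2) * 1)"
      by (intro divide_left_mono mult_left_mono mult_pos_pos)
        (auto intro: one_plus_norm_sq_pos less_imp_le simp: add_pos_nonneg)
    then show ?thesis by (simp add: dist_to_S3_sq dist_commute)
  qed
  also have "\<dots> \<le> 4 * B\<^sup>2 / (1 + (norm p)\<^sup>2)"
    by (intro divide_right_mono mult_left_mono power_mono assms) (auto simp: add_nonneg_nonneg)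
  also have "\<dots> = (B * dist (to_S3 p) (0, 1))\<^sup>2"
    by (simp add: power_mult_distrib dist_to_S3_pole_sq)
  finally show ?thesis
    by (rule power2_le_imp_le) (use B in simp)
qed

lemma continuous_on_to_S3: "continuous_on A to_S3"
proof -
  have "1 + (norm p)\<^sup>2 \<noteq> 0" for p :: R3 using one_plus_norm_sq_pos[of p] by simp
  then show ?thesis unfolding to_S3_def by (intro continuous_intros) blast+
qed

text \<open>Surjectivity and continuity of the inverse are consequences
  (\<open>bounded_homeo_surj\<close>, \<open>bounded_homeo_inverse\<close>), so a concrete map has
  to be checked only for continuity, injectivity and bounded displacement.\<close>

definition bounded_homeo :: "(R3 \<Rightarrow> R3) \<Rightarrow> bool" where
  "bounded_homeo h \<longleftrightarrow> continuous_on UNIV h \<and> inj h \<and> (\<exists>B. \<forall>p. dist (h p) p \<le> B)"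

lemma bounded_homeoI:
  assumes "continuous_on UNIV h" "\<And>p q. h p = h q \<Longrightarrow> p = q" "\<And>p. dist (h p) p \<le> B"
  shows "bounded_homeo h"
  using assms unfolding bounded_homeo_def inj_def by blast

lemma bounded_homeo_compose:
  assumes "bounded_homeo f" "bounded_homeo g"
  shows "bounded_homeo (\<lambda>p. g (f p))"
proof -
  obtain B C where B: "\<And>p. dist (f p) p \<le> B" and C: "\<And>p. dist (g p) p \<le> C"
    using assms unfolding bounded_homeo_def by blast
  show ?thesis
  proof (rule bounded_homeoI)
    show "continuous_on UNIV (\<lambda>p. g (f p))"
      using assms unfolding bounded_homeo_def by (auto intro: continuous_on_compose2)
    show "p = q" if "g (f p) = g (f q)" for p q
      using assms that unfolding bounded_homeo_def inj_def by blast
    show "dist (g (f p)) p \<le> C + B" for p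
      using B[of p] C[of "f p"] dist_triangle[of "g (f p)" p "f p"] by linarith
  qed
qed

text \<open>Openness is invariance of domain; closedness of the image comes from properness.\<close>

lemma bounded_homeo_surj:
  assumes "bounded_homeo h"
  shows "surj h"
proof -
  have c: "continuous_on UNIV h" and i: "inj h" using assms unfolding bounded_homeo_def by auto
  obtain B where B: "\<And>p. dist (h p) p \<le> B" using assms unfolding bounded_homeo_def by blast
  have op: "open (range h)"
    using invariance_of_domain[OF c _ i] by simp
  have cl: "closed (range h)"
    unfolding closed_sequential_limits
  proof (intro allI impI, elim conjE)
    fix x l assume x: "\<forall>n. x n \<in> range h" and l: "x \<longlonglongrightarrow> l"
    from x have "\<forall>n. \<exists>v. x n = h v" by blast
    then obtain u where u: "\<And>n. x n = h (u n)" by (auto dest!: choice)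
    have "bounded (range x)" using l by (rule convergent_imp_bounded)
    then obtain C where C: "\<forall>v\<in>range x. norm v \<le> C" unfolding bounded_iff by blast
    have "norm (u n) \<le> C + B" for n
    proof -
      have "norm (h (u n)) \<le> C" using C u[of n] by (metis rangeI)
      then show ?thesis
        using B[of "u n"] norm_triangle_ineq2[of "u n" "h (u n)"]
        by (simp add: dist_norm norm_minus_commute)
    qed
    then have bu: "bounded (range u)" by (auto simp: bounded_iff)
    then obtain l' r where r: "strict_mono r" "(u \<circ> r) \<longlonglongrightarrow> l'"
      using bounded_imp_convergent_subsequence by blast
    have "(\<lambda>n. h ((u \<circ> r) n)) \<longlonglongrightarrow> h l'"
      by (rule continuous_on_tendsto_compose[OF c r(2)]) auto
    moreover have "(\<lambda>n. h ((u \<circ> r) n)) \<longlonglongrightarrow> l"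
      using LIMSEQ_subseq_LIMSEQ[OF l r(1)] by (simp add: u o_def)
    ultimately show "l \<in> range h" using LIMSEQ_unique by blast
  qed
  have "range h = {} \<or> range h = UNIV"
    using clopen[of "range h"] op cl by simp
  then show ?thesis by auto
qed

lemma isotopic_to_id_bounded_homeo:
  assumes "bounded_homeo h"
  shows "isotopic_to_id (\<lambda>q. if q = (0, 1) then q else to_S3 (h (from_S3 q)))"
proof -
  have c: "continuous_on UNIV h" and i: "inj h" using assms unfolding bounded_homeo_def by auto
  have s: "surj h" using assms by (rule bounded_homeo_surj)
  obtain B where B: "\<And>p. dist (h p) p \<le> B" using assms unfolding bounded_homeo_def by blast
  have B0: "0 \<le> B" using B[of 0] zero_le_dist[of "h 0" 0] by linarith
  define F where "F s p = (if s = 0 then p else s *\<^sub>R h ((1 / s) *\<^sub>R p))" for s :: real and p :: R3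
  \<comment> \<open>\<open>F s\<close> is \<open>h\<close> conjugated by the homothety with ratio
    \<open>s\<close>, so displacements shrink by the factor \<open>s\<close>. Hence
    \<open>F s\<close> tends to the identity uniformly as \<open>s\<close> tends to 0, which gives
    joint continuity at \<open>s = 0\<close>.\<close>
  have FB: "dist p (F s p) \<le> B * s" if "0 \<le> s" for s p
  proof (cases "s = 0")
    case False
    have "p - F s p = s *\<^sub>R ((1 / s) *\<^sub>R p - h ((1 / s) *\<^sub>R p))"
      using False by (simp add: F_def algebra_simps)
    then have "dist p (F s p) = s * dist (h ((1 / s) *\<^sub>R p)) ((1 / s) *\<^sub>R p)"
      using that by (simp add: dist_norm norm_minus_commute)
    also have "\<dots> \<le> s * B" by (intro mult_left_mono B that)
    finally show ?thesis by (simp add: mult.commute)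
  qed (simp add: F_def)
  have FB1: "dist p (F s p) \<le> B" if "s \<in> {0..1}" for s p
  proof -
    have "B * s \<le> B * 1" using that B0 by (intro mult_left_mono) auto
    then show ?thesis using FB[of s p] that by simp
  qed
  have Fc: "continuous_on ({0..} \<times> UNIV) (\<lambda>(s, p). F s p)"
    unfolding continuous_on_eq_continuous_within
  proof
    fix q :: "real \<times> R3" assume q: "q \<in> {0..} \<times> UNIV"
    obtain s0 p0 where q0: "q = (s0, p0)" by (cases q)
    show "continuous (at q within {0..} \<times> UNIV) (\<lambda>(s, p). F s p)"
    proof (cases "s0 = 0")
      case False
      have "continuous_on ({0<..} \<times> UNIV) (\<lambda>q. fst q *\<^sub>R h ((1 / fst q) *\<^sub>R snd q))"
        by (intro continuous_intros continuous_on_compose2[OF c]) auto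
      then have "continuous_on ({0<..} \<times> UNIV) (\<lambda>(s, p). F s p)"
        by (rule continuous_on_eq) (auto simp: F_def)
      moreover have "open ({0<..} \<times> UNIV :: (real \<times> R3) set)" by (intro open_Times) auto
      moreover have "q \<in> {0<..} \<times> UNIV" using q False q0 by auto
      ultimately have "isCont (\<lambda>(s, p). F s p) q" using continuous_on_eq_continuous_at by blast
      then show ?thesis by (rule continuous_at_imp_continuous_at_within)
    next
      case True
      have "((\<lambda>q'. dist (snd q') p0 + B * fst q') \<longlongrightarrow> dist (snd q) p0 + B * fst q) (at q within {0..} \<times> UNIV)"
        by (intro tendsto_intros)
      then have lim: "((\<lambda>q'. dist (snd q') p0 + B * fst q') \<longlongrightarrow> 0) (at q within {0..} \<times> UNIV)"
        using True q0 by simp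
      have "((\<lambda>q'. dist (case q' of (s, p) \<Rightarrow> F s p) p0) \<longlongrightarrow> 0) (at q within {0..} \<times> UNIV)"
      proof (rule tendsto_sandwich[OF _ _ tendsto_const lim])
        show "\<forall>\<^sub>F q' in at q within {0..} \<times> UNIV. dist (case q' of (s, p) \<Rightarrow> F s p) p0 \<le> dist (snd q') p0 + B * fst q'"
          unfolding eventually_at_filter
        proof (rule always_eventually, intro allI impI)
          fix q' :: "real \<times> R3" assume "q' \<noteq> q" "q' \<in> {0..} \<times> UNIV"
          then have "0 \<le> fst q'" by auto
          from FB[OF this, of "snd q'"] dist_triangle[of "F (fst q') (snd q')" p0 "snd q'"]
          show "dist (case q' of (s, p) \<Rightarrow> F s p) p0 \<le> dist (snd q') p0 + B * fst q'"
            by (simp add: case_prod_unfold dist_commute)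
        qed
      qed (auto intro: always_eventually)
      then have "((\<lambda>(s, p). F s p) \<longlongrightarrow> p0) (at q within {0..} \<times> UNIV)"
        by (rule iffD2[OF tendsto_dist_iff])
      moreover have "F 0 p0 = p0" by (simp add: F_def)
      ultimately show ?thesis
        unfolding continuous_within by (simp add: q0 True)
    qed
  qed
  have Fi: "F s p = F s p' \<Longrightarrow> p = p'" for s p p'
    using inj_eq[OF i] by (cases "s = 0") (simp_all add: F_def)
  have Fs: "\<exists>p'. F s p' = p" for s p
  proof (cases "s = 0")
    case False
    obtain r where "h r = (1 / s) *\<^sub>R p" using s by (metis surjD)
    then have "F s (s *\<^sub>R r) = p" using False by (simp add: F_def)
    then show ?thesis by blast
  qed (auto simp: F_def)
  define H where "H s q = (if q = (0, 1) then q else to_S3 (F s (from_S3 q)))" for s :: real and q :: R4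
  \<comment> \<open>The bound does not depend on \<open>s\<close>, so it gives continuity at the
    pole jointly in both variables.\<close>
  have HB: "dist (H s q) (0, 1) \<le> (B + 1) * dist q (0, 1)" if "s \<in> {0..1}" "q \<in> S3" for s q
  proof (cases "q = (0, 1)")
    case False
    have "dist (H s q) q \<le> B * dist q (0, 1)"
      using dist_to_S3_le[OF FB1[OF that(1), of "from_S3 q"]] to_from_S3[OF that(2) False] False
      by (simp add: H_def)
    then show ?thesis using dist_triangle[of "H s q" "(0, 1)" q] by (simp add: algebra_simps)
  qed (simp add: H_def)
  have Hc: "continuous_on ({0..1} \<times> S3) (\<lambda>(s, q). H s q)"
    unfolding continuous_on_eq_continuous_within
  proof
    fix z :: "real \<times> R4" assume z: "z \<in> {0..1} \<times> S3"
    obtain s0 q0 where z0: "z = (s0, q0)" by (cases z)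
    show "continuous (at z within {0..1} \<times> S3) (\<lambda>(s, q). H s q)"
    proof (cases "q0 = (0, 1)")
      case False
      let ?U = "{0..1::real} \<times> (S3 - {(0, 1)})"
      have cf: "continuous_on ?U (\<lambda>z. from_S3 (snd z))"
      proof -
        have "snd q \<noteq> 1" if "q \<in> S3" "q \<noteq> (0, 1)" for q :: R4
        proof
          assume 1: "snd q = 1"
          obtain p t where q: "q = (p, t)" by (cases q)
          have "(norm p)\<^sup>2 + t\<^sup>2 = 1" using that(1) by (simp add: q norm_Pair)
          then show False using 1 that(2) by (simp add: q)
        qed
        then show ?thesis unfolding from_S3_def by (intro continuous_intros) auto
      qed
      have "continuous_on ?U (\<lambda>z. case (fst z, from_S3 (snd z)) of (s, p) \<Rightarrow> F s p)"
        by (rule continuous_on_compose2[OF Fc]) (auto intro!: continuous_intros cf)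
      then have "continuous_on ?U (\<lambda>z. to_S3 (F (fst z) (from_S3 (snd z))))"
        by (intro continuous_on_compose2[OF continuous_on_to_S3[of UNIV]]) auto
      then have "continuous_on ?U (\<lambda>(s, q). H s q)"
      proof (rule continuous_on_eq)
        fix z' assume "z' \<in> ?U"
        then have "snd z' \<noteq> (0, 1)" by (metis DiffD2 mem_Times_iff singletonI)
        then show "to_S3 (F (fst z') (from_S3 (snd z'))) = (case z' of (s, q) \<Rightarrow> H s q)"
          by (simp add: H_def case_prod_unfold)
      qed
      moreover have zU: "z \<in> ?U" using z z0 False by auto
      ultimately have "continuous (at z within ?U) (\<lambda>(s, q). H s q)"
        using continuous_on_eq_continuous_within by blast
      moreover have "at z within ?U = at z within ({0..1} \<times> S3)"
      proof (rule at_within_nhd[where S = "UNIV \<times> (UNIV - {(0, 1)})"])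
        show "z \<in> UNIV \<times> (UNIV - {(0, 1)})" using zU by auto
        show "open (UNIV \<times> (UNIV - {(0, 1)}) :: (real \<times> R4) set)" by (intro open_Times open_delete) auto
      qed auto
      ultimately show ?thesis by simp
    next
      case True
      have "((\<lambda>z'. (B + 1) * dist (snd z') (0, 1)) \<longlongrightarrow> (B + 1) * dist (snd z) (0, 1)) (at z within {0..1} \<times> S3)"
        by (intro tendsto_intros)
      then have lim: "((\<lambda>z'. (B + 1) * dist (snd z') (0, 1)) \<longlongrightarrow> 0) (at z within {0..1} \<times> S3)"
        using True z0 by simp
      have "((\<lambda>z'. dist (case z' of (s, q) \<Rightarrow> H s q) (0, 1)) \<longlongrightarrow> 0) (at z within {0..1} \<times> S3)"
      proof (rule tendsto_sandwich[OF _ _ tendsto_const lim])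
        show "\<forall>\<^sub>F z' in at z within {0..1} \<times> S3. dist (case z' of (s, q) \<Rightarrow> H s q) (0, 1) \<le> (B + 1) * dist (snd z') (0, 1)"
          unfolding eventually_at_filter
          by (rule always_eventually) (auto intro!: HB)
      qed (auto intro: always_eventually)
      then have "((\<lambda>(s, q). H s q) \<longlongrightarrow> (0, 1)) (at z within {0..1} \<times> S3)"
        by (rule iffD2[OF tendsto_dist_iff])
      moreover have "H s0 (0, 1) = (0, 1)" by (simp add: H_def)
      ultimately show ?thesis
        unfolding continuous_within by (simp add: z0 True)
    qed
  qed
  have HS: "H s q \<in> S3" if "q \<in> S3" for s q
    using that to_S3_in_S3 by (simp add: H_def)
  have Hhom: "\<exists>k. homeomorphism S3 S3 (H s) k" if s: "s \<in> {0..1}" for s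
  proof (rule homeomorphism_compact)
    show "compact S3" by simp
    show "continuous_on S3 (H s)"
    proof -
      have "continuous_on S3 (\<lambda>q. case (s, q) of (s, q) \<Rightarrow> H s q)"
        by (rule continuous_on_compose2[OF Hc]) (use s in \<open>auto intro!: continuous_intros\<close>)
      then show ?thesis by simp
    qed
    show "H s ` S3 = S3"
    proof (intro equalityI subsetI)
      fix q assume q: "q \<in> S3"
      show "q \<in> H s ` S3"
      proof (cases "q = (0, 1)")
        case True
        then show ?thesis using q by (force simp: H_def)
      next
        case False
        obtain p where "F s p = from_S3 q" using Fs by blast
        then have "H s (to_S3 p) = q"
          using to_from_S3[OF q False] to_S3_neq_pole[of p] by (simp add: H_def)
        then show ?thesis using to_S3_in_S3[of p] by blast
      qed
    qed (use HS in auto)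
    show "inj_on (H s) S3"
    proof (rule inj_onI)
      fix q q' assume q: "q \<in> S3" "q' \<in> S3" "H s q = H s q'"
      show "q = q'"
      proof (cases "q = (0, 1) \<or> q' = (0, 1)")
        case True
        then show ?thesis using q(3) to_S3_neq_pole to_S3_neq_pole[symmetric] by (auto simp: H_def split: if_splits)
      next
        case False
        then have "from_S3 q = from_S3 q'"
          using q(3) Fi[of s] inj_to_S3 by (simp add: H_def inj_eq)
        then show ?thesis using to_from_S3 q False by metis
      qed
    qed
  qed
  show ?thesis
    unfolding isotopic_to_id_def
  proof (rule exI[of _ H], intro conjI ballI)
    show "continuous_on ({0..1} \<times> S3) (\<lambda>(s, x). H s x)" by (fact Hc)
    show "\<exists>k. homeomorphism S3 S3 (H s) k" if "s \<in> {0..1}" for s by (fact Hhom[OF that])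
    show "H 0 q = q" if "q \<in> S3" for q using to_from_S3[OF that] by (simp add: H_def F_def)
    show "H 1 q = (if q = (0, 1) then q else to_S3 (h (from_S3 q)))" for q by (simp add: H_def F_def)
  qed
qed

section \<open>Tame bands and their skein classes\<close>

abbreviation solid_torus :: "(complex \<times> real \<times> real) set" where
  "solid_torus \<equiv> sphere 0 1 \<times> {-1..1} \<times> {-1..1}"

text \<open>\<open>framed_knot\<close> with an arbitrary ambient set instead of the 3-sphere: bands
  are handled in space, where the formulas live, and reach the sphere through
  \<open>framed_link_to_S3\<close>.\<close>

definition tame_knot :: "'a::topological_space set \<Rightarrow> 'a band \<Rightarrow> bool" where
  "tame_knot S K \<longleftrightarrow> (\<exists>e :: complex \<times> real \<times> real \<Rightarrow> 'a.
     continuous_on solid_torus e \<and> inj_on e solid_torus \<and> e ` solid_torus \<subseteq> S \<and>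
     fst K = e ` (sphere 0 1 \<times> {0} \<times> {0}) \<and> snd K = e ` (sphere 0 1 \<times> {-1..1} \<times> {0}))"

definition tame_link :: "'a::topological_space set \<Rightarrow> 'a band \<Rightarrow> bool" where
  "tame_link S L \<longleftrightarrow> (\<exists>\<K>. finite \<K> \<and> (\<forall>K\<in>\<K>. tame_knot S K) \<and>
     pairwise (\<lambda>K K'. disjnt (snd K) (snd K')) \<K> \<and>
     L = (\<Union>(fst ` \<K>), \<Union>(snd ` \<K>)))"

lemma framed_link_iff_tame_link: "framed_link L \<longleftrightarrow> tame_link S3 L"
  unfolding framed_link_def tame_link_def framed_knot_def tame_knot_def by (rule refl)

text \<open>A tame band keeps only the germ of its solid torus: shrinking the torus in the direction
  normal to the band moves it into any neighbourhood of the band.\<close>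

lemma tame_knot_image:
  fixes f :: "'a::t2_space \<Rightarrow> 'b::topological_space"
  assumes K: "tame_knot S K" and V: "open V" "snd K \<subseteq> V"
    and f: "continuous_on V f" "inj_on f V" "f ` V \<subseteq> S'"
  shows "tame_knot S' (band_image f K)"
proof -
  obtain e where e: "continuous_on solid_torus e" "inj_on e solid_torus"
    "fst K = e ` (sphere 0 1 \<times> {0} \<times> {0})" "snd K = e ` (sphere 0 1 \<times> {-1..1} \<times> {0})"
    using K unfolding tame_knot_def by blast
  \<comment> \<open>The part of the solid torus that leaves \<open>V\<close>. It is compact and
    misses the band, so the normal coordinate is bounded away from 0 on it.\<close>
  define Z where "Z = solid_torus \<inter> e -` (- V)"
  have cst: "compact solid_torus" by (intro compact_Times) auto
  have "closed Z" unfolding Z_def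
    by (rule continuous_closed_preimage[OF e(1) compact_imp_closed[OF cst]]) (use V(1) in auto)
  then have "compact (solid_torus \<inter> Z)" by (rule compact_Int_closed[OF cst])
  moreover have "solid_torus \<inter> Z = Z" by (auto simp: Z_def)
  ultimately have cZ: "compact Z" by simp
  obtain d where d: "0 < d" "d \<le> 1" "\<And>z. z \<in> Z \<Longrightarrow> d \<le> \<bar>snd (snd z)\<bar>"
  proof (cases "Z = {}")
    case True
    then show ?thesis using that[of 1] by auto
  next
    case False
    have "continuous_on Z (\<lambda>z. \<bar>snd (snd z)\<bar>)" by (intro continuous_intros)
    then obtain z0 where z0: "z0 \<in> Z" "\<And>z. z \<in> Z \<Longrightarrow> \<bar>snd (snd z0)\<bar> \<le> \<bar>snd (snd z)\<bar>"
      using continuous_attains_inf[OF cZ False] by blast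
    have "snd (snd z0) \<noteq> 0"
    proof
      assume "snd (snd z0) = 0"
      then have "z0 \<in> sphere 0 1 \<times> {-1..1} \<times> {0}" using z0(1) by (auto simp: Z_def)
      then have "e z0 \<in> V" using V(2) e(4) by blast
      then show False using z0(1) by (simp add: Z_def)
    qed
    moreover have "\<bar>snd (snd z0)\<bar> \<le> 1" using z0(1) by (auto simp: Z_def)
    ultimately show ?thesis using that[of "\<bar>snd (snd z0)\<bar>"] z0(2) by simp
  qed
  \<comment> \<open>The factor \<open>d / 2\<close> rather than \<open>d\<close> keeps the normal
    coordinate strictly below the bound that holds on \<open>Z\<close>.\<close>
  define g where "g z = (fst z, fst (snd z), d / 2 * snd (snd z))" for z :: "complex \<times> real \<times> real"
  have gs: "g z \<in> solid_torus" "e (g z) \<in> V" if z: "z \<in> solid_torus" for z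
  proof -
    have "\<bar>d / 2 * snd (snd z)\<bar> \<le> d / 2 * 1"
      unfolding abs_mult using d z by (intro mult_mono) auto
    then have b: "\<bar>d / 2 * snd (snd z)\<bar> \<le> d / 2" by simp
    then have "d / 2 * snd (snd z) \<in> {-1..1}" using d(2) unfolding abs_le_iff by auto
    then show *: "g z \<in> solid_torus" using z by (auto simp: g_def mem_Times_iff)
    show "e (g z) \<in> V"
    proof (rule ccontr)
      assume "e (g z) \<notin> V"
      then have "d \<le> \<bar>snd (snd (g z))\<bar>" using * d(3) by (simp add: Z_def)
      then show False using b d(1) by (simp add: g_def)
    qed
  qed
  have cg: "continuous_on solid_torus g" unfolding g_def by (intro continuous_intros)
  have g0: "g ` (sphere 0 1 \<times> A \<times> {0}) = sphere 0 1 \<times> A \<times> {0}" for A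
    by (force simp: g_def image_iff)
  show ?thesis unfolding tame_knot_def
  proof (rule exI[of _ "\<lambda>z. f (e (g z))"], intro conjI)
    show "continuous_on solid_torus (\<lambda>z. f (e (g z)))"
    proof (rule continuous_on_compose2[OF f(1) continuous_on_compose2[OF e(1) cg]])
      show "g ` solid_torus \<subseteq> solid_torus" using gs(1) by blast
      show "(\<lambda>z. e (g z)) ` solid_torus \<subseteq> V" using gs(2) by blast
    qed
    show "inj_on (\<lambda>z. f (e (g z))) solid_torus"
    proof (rule inj_onI)
      fix z z' assume z: "z \<in> solid_torus" "z' \<in> solid_torus" "f (e (g z)) = f (e (g z'))"
      then have "g z = g z'" using f(2) e(2) gs by (metis inj_on_eq_iff)
      then show "z = z'" using d(1) by (auto simp: g_def prod_eq_iff)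
    qed
    show "(\<lambda>z. f (e (g z))) ` solid_torus \<subseteq> S'" using gs f(3) by blast
    have im: "(\<lambda>z. f (e (g z))) ` (sphere 0 1 \<times> A \<times> {0}) = f ` e ` (sphere 0 1 \<times> A \<times> {0})" for A
      using arg_cong[OF g0[of A], of "\<lambda>B. f ` e ` B"] by (simp add: image_image)
    show "fst (band_image f K) = (\<lambda>z. f (e (g z))) ` (sphere 0 1 \<times> {0} \<times> {0})"
      unfolding im by (simp add: band_image_def e(3))
    show "snd (band_image f K) = (\<lambda>z. f (e (g z))) ` (sphere 0 1 \<times> {-1..1} \<times> {0})"
      unfolding im by (simp add: band_image_def e(4))
  qed
qed

lemma tame_link_image:
  fixes f :: "'a::t2_space \<Rightarrow> 'b::topological_space"
  assumes L: "tame_link S L" and V: "open V" "snd L \<subseteq> V"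
    and f: "continuous_on V f" "inj_on f V" "f ` V \<subseteq> S'"
  shows "tame_link S' (band_image f L)"
proof -
  obtain \<K> where K: "finite \<K>" "\<forall>K\<in>\<K>. tame_knot S K"
    "pairwise (\<lambda>K K'. disjnt (snd K) (snd K')) \<K>" "L = (\<Union>(fst ` \<K>), \<Union>(snd ` \<K>))"
    using L unfolding tame_link_def by blast
  have sub: "snd K \<subseteq> V" if "K \<in> \<K>" for K using that V(2) K(4) by auto
  show ?thesis unfolding tame_link_def
  proof (rule exI[of _ "band_image f ` \<K>"], intro conjI)
    show "finite (band_image f ` \<K>)" using K(1) by simp
    show "\<forall>K\<in>band_image f ` \<K>. tame_knot S' K"
      using tame_knot_image[OF _ V(1) sub f] K(2) by blast
    show "pairwise (\<lambda>K K'. disjnt (snd K) (snd K')) (band_image f ` \<K>)"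
    proof (rule pairwiseI)
      fix B B' assume B: "B \<in> band_image f ` \<K>" "B' \<in> band_image f ` \<K>" "B \<noteq> B'"
      then obtain K K' where KK: "K \<in> \<K>" "K' \<in> \<K>" "B = band_image f K" "B' = band_image f K'" "K \<noteq> K'"
        by blast
      then have "disjnt (snd K) (snd K')" using K(3) by (auto simp: pairwise_def)
      then have "f ` snd K \<inter> f ` snd K' = {}"
        using inj_on_image_Int[OF f(2) sub[OF KK(1)] sub[OF KK(2)]] by (simp add: disjnt_def)
      then show "disjnt (snd B) (snd B')" using KK by (simp add: band_image_def disjnt_def)
    qed
    show "band_image f L = (\<Union>(fst ` band_image f ` \<K>), \<Union>(snd ` band_image f ` \<K>))"
      unfolding K(4) by (auto simp: band_image_def)
  qed
qed

abbreviation tame :: "R3 band \<Rightarrow> bool" where "tame \<equiv> tame_link UNIV"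

lemma tame_bounded_homeo:
  assumes "tame L" "bounded_homeo h"
  shows "tame (band_image h L)"
  using assms unfolding bounded_homeo_def by (intro tame_link_image[of UNIV L UNIV]) auto

lemma framed_link_to_S3:
  assumes "tame L"
  shows "framed_link (band_image to_S3 L)"
  unfolding framed_link_iff_tame_link
  by (rule tame_link_image[OF assms open_UNIV])
    (use inj_to_S3 to_S3_in_S3 continuous_on_to_S3 in auto)

definition skein_class :: "R3 band \<Rightarrow> skein_module" where
  "skein_class K = skein_of (band_image to_S3 K)"

lemma band_image_comp: "band_image f (band_image g K) = band_image (\<lambda>x. f (g x)) K"
  by (simp add: band_image_def image_image)

lemma skein_class_bounded_homeo:
  assumes "tame K" "bounded_homeo h"
  shows "skein_class (band_image h K) = skein_class K"
proof -
  let ?g = "\<lambda>q. if q = (0, 1) then q else to_S3 (h (from_S3 q))"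
  have "band_image to_S3 (band_image h K) = band_image ?g (band_image to_S3 K)"
    unfolding band_image_comp by (simp add: to_S3_neq_pole)
  then have "ambient_isotopic (band_image to_S3 K) (band_image to_S3 (band_image h K))"
    unfolding ambient_isotopic_def
    using framed_link_to_S3[OF assms(1)] framed_link_to_S3[OF tame_bounded_homeo[OF assms]]
      isotopic_to_id_bounded_homeo[OF assms(2)] by blast
  then show ?thesis
    unfolding skein_class_def skein_of_def link_gen_def
    using Quotient_rel_abs[OF Quotient_link_class] by metis
qed

text \<open>Tameness is kept out of the relation and transported along it in either direction, so
  that in a chain of isotopies it has to be known for one band only.\<close>

definition isotopic_bands :: "R3 band \<Rightarrow> R3 band \<Rightarrow> bool" (infix "\<simeq>" 50) where
  "K \<simeq> L \<longleftrightarrow> (\<exists>h. bounded_homeo h \<and> band_image h K = L)"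

lemma isotopic_bands_trans [trans]: "K \<simeq> L \<Longrightarrow> L \<simeq> M \<Longrightarrow> K \<simeq> M"
  unfolding isotopic_bands_def using bounded_homeo_compose band_image_comp by metis

lemma isotopic_bands_tame: "K \<simeq> L \<Longrightarrow> tame K \<Longrightarrow> tame L"
  unfolding isotopic_bands_def using tame_bounded_homeo by blast

lemma isotopic_bands_skein_class: "K \<simeq> L \<Longrightarrow> tame K \<Longrightarrow> skein_class K = skein_class L"
  unfolding isotopic_bands_def using skein_class_bounded_homeo by metis

text \<open>By invariance of domain a continuous injection of space is a homeomorphism onto its
  image, and the image is everything. The inverse has the same displacement bound.\<close>

lemma bounded_homeo_inverse:
  assumes "bounded_homeo h"
  shows "bounded_homeo (inv h)" "inv h (h p) = p"
proof -
  have c: "continuous_on UNIV h" and i: "inj h" and s: "surj h"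
    using assms bounded_homeo_surj unfolding bounded_homeo_def by auto
  obtain B where B: "\<And>p. dist (h p) p \<le> B" using assms unfolding bounded_homeo_def by blast
  show *: "inv h (h p) = p" for p using i by simp
  obtain k where k: "homeomorphism UNIV (h ` UNIV) h k"
    using invariance_of_domain_homeomorphism[OF open_UNIV c _ i] by auto
  have "k = inv h"
    using k s unfolding homeomorphism_def by (metis UNIV_I ext surj_f_inv_f)
  then have "continuous_on UNIV (inv h)" using k s by (simp add: homeomorphism_def)
  moreover have "dist (inv h p) p \<le> B" for p
    using B[of "inv h p"] s by (simp add: surj_f_inv_f dist_commute)
  moreover have "inj (inv h)" using s by (rule surj_imp_inj_inv)
  ultimately show "bounded_homeo (inv h)"
    unfolding bounded_homeo_def by blast
qed

lemma isotopic_bands_sym: "K \<simeq> L \<Longrightarrow> L \<simeq> K"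
proof -
  assume "K \<simeq> L"
  then obtain h where h: "bounded_homeo h" "L = band_image h K"
    unfolding isotopic_bands_def by blast
  have "band_image (inv h) L = K"
    unfolding h(2) band_image_comp by (simp add: bounded_homeo_inverse(2)[OF h(1)] band_image_def)
  then show "L \<simeq> K" unfolding isotopic_bands_def using bounded_homeo_inverse(1)[OF h(1)] by blast
qed

section \<open>Relators and scalars in the skein module\<close>

lemma abs_skein_relator:
  assumes "r \<in> cubic_relators \<union> framing_relators"
  shows "abs_skein_module r = 0"
proof -
  have "skein_equiv r 0"
    unfolding skein_equiv_def skein_submodule_def using free.span_base[OF assms] by simp
  then show ?thesis unfolding zero_skein_module_def
    using Quotient_rel_abs[OF Quotient_skein_module] by metis
qed

lemma skein_scale_add: "c \<odot> (x + y) = c \<odot> x + c \<odot> y"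
  by (induct x rule: skein_module.abs_induct, induct y rule: skein_module.abs_induct)
    (simp only: skein_scale.abs_eq plus_skein_module.abs_eq free.scale_right_distrib)

lemma skein_scale_plus: "(c + d) \<odot> x = c \<odot> x + d \<odot> x"
  by (induct x rule: skein_module.abs_induct)
    (simp only: skein_scale.abs_eq plus_skein_module.abs_eq free.scale_left_distrib)

lemma skein_scale_scale: "c \<odot> (d \<odot> x) = (c * d) \<odot> x"
  by (induct x rule: skein_module.abs_induct) (simp only: skein_scale.abs_eq free.scale_scale)

lemma skein_scale_one: "1 \<odot> x = x"
  by (induct x rule: skein_module.abs_induct) (simp only: skein_scale.abs_eq free.scale_one)

lemma skein_scale_zero: "0 \<odot> x = 0"
  using skein_scale_plus[of 0 0 x] by simp

lemma skein_scale_minus: "(- c) \<odot> x = - (c \<odot> x)"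
  using skein_scale_plus[of c "- c" x] by (simp add: skein_scale_zero eq_neg_iff_add_eq_0 add.commute)

definition outside_box :: "R3 band \<Rightarrow> bool" where
  "outside_box X \<longleftrightarrow> fst X \<inter> tangle_box = {} \<and> snd X \<inter> tangle_box = {}"

lemma insert_tangle_to_S3:
  "insert_tangle (\<lambda>x. x) (band_image to_S3 X) T = band_image to_S3 (band_union X T)"
  by (simp add: insert_tangle_def band_image_def band_union_def image_Un)

lemma outside_box_to_S3:
  assumes "outside_box X"
  shows "outside_ball (\<lambda>x. x) (band_image to_S3 X)"
proof -
  have "to_S3 ` A \<inter> to_S3 ` B = {}" if "A \<inter> B = {}" for A B
    using image_Int[OF inj_to_S3, of A B] that by simp
  then show ?thesis using assms by (simp add: outside_ball_def outside_box_def band_image_def)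
qed

text \<open>With \<open>b3 = -1\<close> the relator can be solved for the class containing
  \<open>tangle_D 3\<close>. The ball is always the standard cube, that is, \<open>g\<close> is the
  identity: links are brought into position around the cube instead of parametrising balls that meet
  them.\<close>

lemma skein_class_cubic:
  assumes X: "outside_box X" and D: "\<And>k. k \<in> {0..3} \<Longrightarrow> tame (band_union X (tangle_D k))"
    "tame (band_union X tangle_D_inf)"
  shows "skein_class (band_union X (tangle_D 3)) =
      b2 \<odot> skein_class (band_union X (tangle_D 2)) + b1 \<odot> skein_class (band_union X (tangle_D 1))
      + b0 \<odot> skein_class (band_union X (tangle_D 0)) + b_inf \<odot> skein_class (band_union X tangle_D_inf)"
proof -
  let ?i = "\<lambda>T. link_gen (insert_tangle (\<lambda>x. x) (band_image to_S3 X) T)"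
  have c: "abs_skein_module (?i T) = skein_class (band_union X T)" for T
    by (simp add: skein_class_def skein_of_def insert_tangle_to_S3)
  have "free_scale b0 (?i (tangle_D 0)) + free_scale b1 (?i (tangle_D 1)) + free_scale b2 (?i (tangle_D 2))
      + free_scale b3 (?i (tangle_D 3)) + free_scale b_inf (?i tangle_D_inf) \<in> cubic_relators"
    unfolding cubic_relators_def
  proof (rule CollectI, intro exI conjI)
    show "\<forall>T\<in>{tangle_D 0, tangle_D 1, tangle_D 2, tangle_D 3, tangle_D_inf}.
        framed_link (insert_tangle (\<lambda>x. x) (band_image to_S3 X) T)"
      using framed_link_to_S3[OF D(1)] framed_link_to_S3[OF D(2)] by (auto simp: insert_tangle_to_S3)
  qed (rule refl isotopic_to_id_id outside_box_to_S3[OF X])+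
  from abs_skein_relator[OF UnI1[OF this]]
  have "b0 \<odot> skein_class (band_union X (tangle_D 0)) + b1 \<odot> skein_class (band_union X (tangle_D 1))
      + b2 \<odot> skein_class (band_union X (tangle_D 2)) + b3 \<odot> skein_class (band_union X (tangle_D 3))
      + b_inf \<odot> skein_class (band_union X tangle_D_inf) = 0"
    by (simp only: plus_skein_module.abs_eq[symmetric] skein_scale.abs_eq[symmetric] c)
  then show ?thesis
    by (simp add: b3_def skein_scale_minus skein_scale_one algebra_simps eq_neg_iff_add_eq_0)
qed

lemma skein_class_framing:
  assumes X: "outside_box X" and D: "tame (band_union X (strip 0))" "tame (band_union X (strip 1))"
  shows "skein_class (band_union X (strip 1)) = a_pow 1 \<odot> skein_class (band_union X (strip 0))"
proof -
  let ?i = "\<lambda>T. link_gen (insert_tangle (\<lambda>x. x) (band_image to_S3 X) T)"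
  have c: "abs_skein_module (?i T) = skein_class (band_union X T)" for T
    by (simp add: skein_class_def skein_of_def insert_tangle_to_S3)
  have "?i (strip 1) - free_scale (a_pow 1) (?i (strip 0)) \<in> framing_relators"
    unfolding framing_relators_def
  proof (rule CollectI, intro exI conjI)
    show "\<forall>T\<in>{strip 0, strip 1}. framed_link (insert_tangle (\<lambda>x. x) (band_image to_S3 X) T)"
      using framed_link_to_S3[OF D(1)] framed_link_to_S3[OF D(2)] by (auto simp: insert_tangle_to_S3)
  qed (rule refl isotopic_to_id_id outside_box_to_S3[OF X])+
  moreover have "?i (strip 1) - free_scale (a_pow 1) (?i (strip 0)) =
      ?i (strip 1) + free_scale (- a_pow 1) (?i (strip 0))"
    by simp
  ultimately have "abs_skein_module (?i (strip 1) + free_scale (- a_pow 1) (?i (strip 0))) = 0"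
    using abs_skein_relator by (metis UnI2)
  then have "skein_class (band_union X (strip 1)) + (- a_pow 1) \<odot> skein_class (band_union X (strip 0)) = 0"
    by (simp only: plus_skein_module.abs_eq[symmetric] skein_scale.abs_eq[symmetric] c)
  then show ?thesis by (simp add: skein_scale_minus)
qed

section \<open>Elementary bounded homeomorphisms\<close>

text \<open>A band is described by the level sets of its half-width: half-width \<open>0\<close> gives the core and
  half-width \<open>1\<close> the surface.\<close>

definition band_of :: "(real \<Rightarrow> R3 set) \<Rightarrow> R3 band" where
  "band_of S = (S 0, S 1)"

lemma isotopic_band_ofI:
  assumes "bounded_homeo h" "\<And>e. 0 \<le> e \<Longrightarrow> e \<le> 1 \<Longrightarrow> h ` S e = T e"
  shows "band_of S \<simeq> band_of T"
  using assms unfolding isotopic_bands_def band_of_def band_image_def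
  by (intro exI[of _ h]) simp

text \<open>Surjectivity replaces the construction of preimages: an equation between images becomes
  a pointwise equivalence in coordinates, which arithmetic can settle.\<close>

lemma bounded_homeo_image_eqI:
  assumes "bounded_homeo h" "\<And>p. h p \<in> B \<longleftrightarrow> p \<in> A"
  shows "h ` A = B"
  using bounded_homeo_surj[OF assms(1)] assms(2) by (metis image_vimage_eq inf_top.right_neutral set_eqI vimage_eq)

text \<open>A full twist of a strand does not extend to a homeomorphism of space, but glued to the identity
  along the planes \<open>x = \<plusminus>4\<close> it is continuous near the band. This produces the solid tori for all
  numbers of twists from those for small numbers.\<close>

lemma tame_cut:
  assumes L: "tame L" and h: "bounded_homeo h" "\<And>p. fst (h p) = fst p"
    and W: "open W" "\<And>p. p \<in> W \<Longrightarrow> 3 < \<bar>fst p\<bar> \<Longrightarrow> h p = p"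
    and LW: "snd L \<subseteq> {p. \<bar>fst p\<bar> < 4} \<union> {p. 4 < \<bar>fst p\<bar>} \<union> {p \<in> W. 3 < \<bar>fst p\<bar>}"
  shows "tame (band_image (\<lambda>p. if \<bar>fst p\<bar> \<le> 4 then h p else p) L)"
proof -
  let ?t = "\<lambda>p. if \<bar>fst p\<bar> \<le> 4 then h p else p"
  let ?A = "{p :: R3. \<bar>fst p\<bar> < 4}"
  let ?B = "{p :: R3. 4 < \<bar>fst p\<bar>} \<union> ({p. 3 < \<bar>fst p\<bar>} \<inter> W)"
  have oA: "open ?A" and o4: "open {p :: R3. 4 < \<bar>fst p\<bar>}" and o3: "open {p :: R3. 3 < \<bar>fst p\<bar>}"
    by (intro open_Collect_less continuous_intros)+
  have oB: "open ?B" by (intro open_Un open_Int o4 o3 W(1))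
  have "continuous_on ?A h" using h(1) unfolding bounded_homeo_def by (auto intro: continuous_on_subset)
  then have cA: "continuous_on ?A ?t" by (rule continuous_on_eq) auto
  have cB: "continuous_on ?B ?t" by (rule continuous_on_eq[OF continuous_on_id]) (auto simp: W(2))
  \<comment> \<open>Both branches preserve the first coordinate, which alone selects the branch; so
    points of different branches cannot collide.\<close>
  have inj: "inj_on ?t V" for V
  proof (rule inj_onI)
    fix p q assume *: "?t p = ?t q"
    have "fst (?t p) = fst p" "fst (?t q) = fst q" by (simp_all add: h(2))
    then have "fst p = fst q" using * by metis
    moreover have "inj h" using h(1) by (simp add: bounded_homeo_def)
    ultimately show "p = q" using * by (auto simp: inj_eq split: if_splits)
  qed
  show ?thesis
  proof (rule tame_link_image[OF L open_Un[OF oA oB]])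
    show "snd L \<subseteq> ?A \<union> ?B" using LW by auto
    show "continuous_on (?A \<union> ?B) ?t" by (rule continuous_on_open_Un[OF oA oB cA cB])
    show "inj_on ?t (?A \<union> ?B)" by (rule inj)
  qed simp
qed

section \<open>Conjugation by symmetries, and maps along a single coordinate\<close>

lemma bounded_homeo_conj:
  assumes h: "bounded_homeo h" and t: "continuous_on UNIV t" "\<And>p. t (t p) = p" "\<And>p q. dist (t p) (t q) = dist p q"
  shows "bounded_homeo (\<lambda>p. t (h (t p)))"
proof -
  obtain B where B: "\<And>p. dist (h p) p \<le> B" using h unfolding bounded_homeo_def by blast
  show ?thesis
  proof (rule bounded_homeoI)
    have "continuous_on UNIV (\<lambda>p. h (t p))"
      using h t(1) unfolding bounded_homeo_def by (auto intro: continuous_on_compose2)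
    then show "continuous_on UNIV (\<lambda>p. t (h (t p)))"
      using t(1) by (auto intro: continuous_on_compose2)
    show "p = q" if "t (h (t p)) = t (h (t q))" for p q
      using that h t(2) unfolding bounded_homeo_def inj_def by metis
    show "dist (t (h (t p))) p \<le> B" for p
      using B[of "t p"] t(2,3) by metis
  qed
qed

definition swap_xy :: "R3 \<Rightarrow> R3" where "swap_xy p = (fst (snd p), fst p, snd (snd p))"
definition swap_xz :: "R3 \<Rightarrow> R3" where "swap_xz p = (snd (snd p), fst (snd p), fst p)"
definition mirror_z :: "R3 \<Rightarrow> R3" where "mirror_z p = (fst p, fst (snd p), - snd (snd p))"

lemma bounded_homeo_swap_xy: "bounded_homeo h \<Longrightarrow> bounded_homeo (\<lambda>p. swap_xy (h (swap_xy p)))"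
  by (rule bounded_homeo_conj[where t = swap_xy])
    (auto simp: swap_xy_def dist_Pair_Pair dist_prod_def add_ac intro!: continuous_intros)

lemma bounded_homeo_swap_xz: "bounded_homeo h \<Longrightarrow> bounded_homeo (\<lambda>p. swap_xz (h (swap_xz p)))"
  by (rule bounded_homeo_conj[where t = swap_xz])
    (auto simp: swap_xz_def dist_Pair_Pair dist_prod_def add_ac intro!: continuous_intros)

lemma bounded_homeo_mirror_z: "bounded_homeo h \<Longrightarrow> bounded_homeo (\<lambda>p. mirror_z (h (mirror_z p)))"
  by (rule bounded_homeo_conj[where t = mirror_z])
    (auto simp: mirror_z_def dist_Pair_Pair dist_prod_def dist_real_def power2_commute intro!: continuous_intros)

lemma dist_triple_le:
  "dist (x, y, z) (x', y', z' :: real) \<le> dist (x::real) x' + dist (y::real) y' + dist z z'"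
proof -
  have *: "sqrt (a\<^sup>2 + b\<^sup>2) \<le> a + b" if "0 \<le> a" "0 \<le> b" for a b :: real
    using that by (rule sqrt_sum_squares_le_sum)
  have "dist (x, y, z) (x', y', z') \<le> dist x x' + dist (y, z) (y', z')"
    unfolding dist_Pair_Pair[of x "(y, z)"] by (rule *) auto
  also have "dist (y, z) (y', z') \<le> dist y y' + dist z z'"
    unfolding dist_Pair_Pair[of y z] by (rule *) auto
  finally show ?thesis by simp
qed

text \<open>A map that moves points along one coordinate is injective as soon as it is so on each
  line, and its displacement is that of a real function. The planar deformations of frames and legs
  are composed of such maps.\<close>

lemma bounded_homeo_fiber_x:
  assumes c: "continuous_on UNIV (\<lambda>p. f (fst p) (fst (snd p)) (snd (snd p)))"
    and i: "\<And>x x' y z. f x y z = f x' y z \<Longrightarrow> x = x'"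
    and b: "\<And>x y z. \<bar>f x y z - x\<bar> \<le> B"
  shows "bounded_homeo (\<lambda>p. (f (fst p) (fst (snd p)) (snd (snd p)), snd p))"
proof (rule bounded_homeoI)
  show "continuous_on UNIV (\<lambda>p. (f (fst p) (fst (snd p)) (snd (snd p)), snd p))"
    by (intro continuous_intros c)
  show "p = q" if "(f (fst p) (fst (snd p)) (snd (snd p)), snd p) = (f (fst q) (fst (snd q)) (snd (snd q)), snd q)" for p q
    using that i by (cases p, cases q) auto
  show "dist (f (fst p) (fst (snd p)) (snd (snd p)), snd p) p \<le> B" for p
    using b[of "fst p" "fst (snd p)" "snd (snd p)"]
      dist_triple_le[of "f (fst p) (fst (snd p)) (snd (snd p))" "fst (snd p)" "snd (snd p)" "fst p" "fst (snd p)" "snd (snd p)"]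
    by (simp add: dist_real_def)
qed

lemma bounded_homeo_fiber_y:
  assumes c: "continuous_on UNIV (\<lambda>p. f (fst p) (fst (snd p)) (snd (snd p)))"
    and i: "\<And>x y y' z. f x y z = f x y' z \<Longrightarrow> y = y'"
    and b: "\<And>x y z. \<bar>f x y z - y\<bar> \<le> B"
  shows "bounded_homeo (\<lambda>p. (fst p, f (fst p) (fst (snd p)) (snd (snd p)), snd (snd p)))"
proof (rule bounded_homeoI)
  show "continuous_on UNIV (\<lambda>p. (fst p, f (fst p) (fst (snd p)) (snd (snd p)), snd (snd p)))"
    by (intro continuous_intros c)
  show "p = q" if "(fst p, f (fst p) (fst (snd p)) (snd (snd p)), snd (snd p)) = (fst q, f (fst q) (fst (snd q)) (snd (snd q)), snd (snd q))" for p q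
    using that i by (cases p, cases q) auto
  show "dist (fst p, f (fst p) (fst (snd p)) (snd (snd p)), snd (snd p)) p \<le> B" for p
    using b[of "fst p" "fst (snd p)" "snd (snd p)"]
      dist_triple_le[of "fst p" "f (fst p) (fst (snd p)) (snd (snd p))" "snd (snd p)" "fst p" "fst (snd p)" "snd (snd p)"]
    by (simp add: dist_real_def)
qed

lemma bounded_homeo_fiber_z:
  assumes c: "continuous_on UNIV (\<lambda>p. f (fst p) (fst (snd p)) (snd (snd p)))"
    and i: "\<And>x y z z'. f x y z = f x y z' \<Longrightarrow> z = z'"
    and b: "\<And>x y z. \<bar>f x y z - z\<bar> \<le> B"
  shows "bounded_homeo (\<lambda>p. (fst p, fst (snd p), f (fst p) (fst (snd p)) (snd (snd p))))"
proof (rule bounded_homeoI)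
  show "continuous_on UNIV (\<lambda>p. (fst p, fst (snd p), f (fst p) (fst (snd p)) (snd (snd p))))"
    by (intro continuous_intros c)
  show "p = q" if "(fst p, fst (snd p), f (fst p) (fst (snd p)) (snd (snd p))) = (fst q, fst (snd q), f (fst q) (fst (snd q)) (snd (snd q)))" for p q
    using that i by (cases p, cases q) auto
  show "dist (fst p, fst (snd p), f (fst p) (fst (snd p)) (snd (snd p))) p \<le> B" for p
    using b[of "fst p" "fst (snd p)" "snd (snd p)"]
      dist_triple_le[of "fst p" "fst (snd p)" "f (fst p) (fst (snd p)) (snd (snd p))" "fst p" "fst (snd p)" "snd (snd p)"]
    by (simp add: dist_real_def)
qed

section \<open>Rotations tapering off outside a disc\<close>

definition cutoff :: "real \<Rightarrow> real \<Rightarrow> real \<Rightarrow> real" where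
  "cutoff r1 r2 d = max 0 (min 1 ((r2 - d) / (r2 - r1)))"

text \<open>For \<open>r1 < r2\<close>: rigid rotation by \<open>a\<close> on the disc of radius
  \<open>r1\<close>, the identity outside radius \<open>r2\<close>, and in between each circle
  turned by its own angle.\<close>

definition swirl :: "real \<Rightarrow> real \<Rightarrow> real \<Rightarrow> complex \<Rightarrow> complex" where
  "swirl r1 r2 a w = w * cis (a * cutoff r1 r2 (cmod w))"

lemma cmod_swirl [simp]: "cmod (swirl r1 r2 a w) = cmod w"
  by (simp add: swirl_def norm_mult)

text \<open>The modulus is preserved and it alone determines the angle, so equal images come from
  the same rotation.\<close>

lemma swirl_inj: "swirl r1 r2 a w = swirl r1 r2 a w' \<Longrightarrow> w = w'"
proof -
  assume *: "swirl r1 r2 a w = swirl r1 r2 a w'"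
  then have "cmod w = cmod w'" by (metis cmod_swirl)
  then show "w = w'" using * by (simp add: swirl_def)
qed

lemma swirl_inner: "r1 < r2 \<Longrightarrow> cmod w \<le> r1 \<Longrightarrow> swirl r1 r2 a w = w * cis a"
  by (simp add: swirl_def cutoff_def min_def max_def field_simps)

lemma swirl_outer: "r1 < r2 \<Longrightarrow> r2 \<le> cmod w \<Longrightarrow> swirl r1 r2 a w = w"
proof -
  assume "r1 < r2" "r2 \<le> cmod w"
  then have "(r2 - cmod w) / (r2 - r1) \<le> 0" by (simp add: divide_nonpos_pos)
  then show ?thesis by (simp add: swirl_def cutoff_def)
qed

lemma swirl_zero [simp]: "swirl r1 r2 0 w = w"
  by (simp add: swirl_def)

lemma swirl_bound: "r1 < r2 \<Longrightarrow> 0 < r2 \<Longrightarrow> dist (swirl r1 r2 a w) w \<le> 2 * r2"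
proof (cases "r2 \<le> cmod w")
  case False
  then show ?thesis
    using norm_triangle_ineq4[of "swirl r1 r2 a w" w] by (simp add: dist_norm)
qed (simp add: swirl_outer)

lemma continuous_on_cis [continuous_intros]: "continuous_on A f \<Longrightarrow> continuous_on A (\<lambda>x. cis (f x))"
  unfolding cis_conv_exp by (intro continuous_intros)

lemma continuous_on_swirl [continuous_intros]:
  assumes "continuous_on A f" "continuous_on A g"
  shows "continuous_on A (\<lambda>x. swirl r1 r2 (f x) (g x))"
  unfolding swirl_def cutoff_def divide_inverse by (intro continuous_intros assms)

text \<open>The planes orthogonal to the first axis are identified with the complex plane by
  \<open>y + i z\<close>; letting the planar map vary with \<open>x\<close> produces twisting about
  that axis.\<close>

definition slice :: "(real \<Rightarrow> complex \<Rightarrow> complex) \<Rightarrow> R3 \<Rightarrow> R3" where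
  "slice f p = (let w = f (fst p) (Complex (fst (snd p)) (snd (snd p))) in (fst p, Re w, Im w))"

lemma slice_eq: "slice f (x, y, z) = (x, Re (f x (Complex y z)), Im (f x (Complex y z)))"
  by (simp add: slice_def Let_def)

lemma fst_slice [simp]: "fst (slice f p) = fst p"
  by (simp add: slice_def Let_def)

lemma bounded_homeo_slice:
  assumes c: "continuous_on UNIV (\<lambda>q. f (fst q) (snd q))"
    and i: "\<And>x w w'. f x w = f x w' \<Longrightarrow> w = w'" and b: "\<And>x w. dist (f x w) w \<le> B"
  shows "bounded_homeo (slice f)"
proof (rule bounded_homeoI)
  have C: "continuous_on UNIV (\<lambda>p :: R3. Complex (fst (snd p)) (snd (snd p)))"
    unfolding Complex_eq by (intro continuous_intros)
  have "continuous_on UNIV (\<lambda>p :: R3. (fst p, Complex (fst (snd p)) (snd (snd p))))"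
    by (intro continuous_on_Pair C continuous_intros)
  from continuous_on_compose2[OF c this]
  have "continuous_on UNIV (\<lambda>p :: R3. f (fst p) (Complex (fst (snd p)) (snd (snd p))))"
    by simp
  then show "continuous_on UNIV (slice f)"
    unfolding slice_def Let_def by (intro continuous_intros)
  show "p = q" if "slice f p = slice f q" for p q
  proof -
    obtain x y z x' y' z' where [simp]: "p = (x, y, z)" "q = (x', y', z')" by (metis prod.collapse)
    have "x = x'" "f x (Complex y z) = f x' (Complex y' z')"
      using that by (auto simp: slice_eq complex_eq_iff)
    then show ?thesis using i[of x "Complex y z" "Complex y' z'"] by simp
  qed
  show "dist (slice f p) p \<le> 2 * B" for p
  proof -
    obtain x y z where [simp]: "p = (x, y, z)" by (metis prod.collapse)
    let ?w = "Complex y z"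
    have "dist (slice f p) p \<le> \<bar>Re (f x ?w - ?w)\<bar> + \<bar>Im (f x ?w - ?w)\<bar>"
      using dist_triple_le[of x "Re (f x ?w)" "Im (f x ?w)" x y z] by (simp add: slice_eq dist_real_def)
    also have "\<dots> \<le> cmod (f x ?w - ?w) + cmod (f x ?w - ?w)"
      by (intro add_mono abs_Re_le_cmod abs_Im_le_cmod)
    finally show ?thesis using b[of x ?w] by (simp add: dist_norm)
  qed
qed

lemma bounded_homeo_slice_swirl:
  assumes "continuous_on UNIV \<alpha>" "r1 < r2" "0 < r2"
  shows "bounded_homeo (slice (\<lambda>x w. swirl r1 r2 (\<alpha> x) w))"
  by (rule bounded_homeo_slice[where B = "2 * r2"])
    (use assms swirl_inj swirl_bound in \<open>auto intro!: continuous_intros intro: continuous_on_compose2[OF assms(1)]\<close>)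

text \<open>The discs of radius \<open>5/4\<close> around \<open>\<plusminus>2 cis b\<close> are rotated together about the origin and each one back
  about its own centre. So they are translated to \<open>\<plusminus>2 cis b'\<close>, which preserves a blackboard framing.\<close>

definition move_discs :: "real \<Rightarrow> real \<Rightarrow> complex \<Rightarrow> complex" where
  "move_discs b b' w = swirl (7/2) 4 b' (swirl (5/4) (3/2) (b - b')
     (swirl (5/4) (3/2) (b - b') (swirl (7/2) 4 (- b) w - 2) + 4) - 2)"

lemma move_discs_inj: "move_discs b b' w = move_discs b b' w' \<Longrightarrow> w = w'"
  unfolding move_discs_def by (auto dest!: swirl_inj)

lemma move_discs_same [simp]: "move_discs b b w = w"
proof -
  have "swirl (7/2) 4 b (swirl (7/2) 4 (- b) w) = w"
    unfolding swirl_def[of _ _ b] cmod_swirl by (simp add: swirl_def mult.assoc cis_mult)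
  then show ?thesis by (simp add: move_discs_def)
qed

text \<open>The sum \<open>8 + 3 + 3 + 8\<close> of the bounds \<open>2 * r2\<close> for the four
  swirls.\<close>

lemma move_discs_bound: "dist (move_discs b b' w) w \<le> 22"
proof -
  define u where "u = swirl (7/2) 4 (- b) w"
  define v where "v = swirl (5/4) (3/2) (b - b') (u - 2)"
  define s where "s = swirl (5/4) (3/2) (b - b') (v + 4)"
  have 1: "dist u w \<le> 8" using swirl_bound[of "7/2" 4 "- b" w] by (simp add: u_def)
  have 2: "dist v (u - 2) \<le> 3" using swirl_bound[of "5/4" "3/2" "b - b'" "u - 2"] by (simp add: v_def)
  have 3: "dist s (v + 4) \<le> 3" using swirl_bound[of "5/4" "3/2" "b - b'" "v + 4"] by (simp add: s_def)
  have 4: "dist (swirl (7/2) 4 b' (s - 2)) (s - 2) \<le> 8" using swirl_bound[of "7/2" 4 b' "s - 2"] by simp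
  have eq: "move_discs b b' w - w = (swirl (7/2) 4 b' (s - 2) - (s - 2)) + (s - (v + 4)) + (v - (u - 2)) + (u - w)"
    by (simp add: move_discs_def u_def v_def s_def)
  have tri: "cmod (a + b + c + d) \<le> cmod a + cmod b + cmod c + cmod d" for a b c d
    by (intro norm_triangle_le add_right_mono order_refl) 
  show ?thesis
    using tri[of "swirl (7/2) 4 b' (s - 2) - (s - 2)" "s - (v + 4)" "v - (u - 2)" "u - w"] 1 2 3 4
    unfolding dist_norm eq by linarith
qed

text \<open>The radii fit together: \<open>5/4\<close> exceeds the half-width 1 of a band, and
  \<open>2 + 5/4 < 7/2\<close> puts both discs into the rigid part of the large swirls. The discs of
  radius \<open>3/2\<close> about \<open>2\<close> and \<open>-2\<close> are disjoint, so each small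
  swirl corrects one disc and fixes the other.\<close>

lemma move_discs_disc:
  assumes c: "c \<in> {-1, 1 :: real}" and u: "cmod u \<le> 5/4"
  shows "move_discs b b' (2 * complex_of_real c * cis b + u) = 2 * complex_of_real c * cis b' + u"
proof -
  have cc: "cmod (of_real c) = 1" using c by auto
  define v where "v = u * cis (- b)"
  have v: "cmod v \<le> 5/4" using u by (simp add: v_def norm_mult)
  have "cmod (2 * complex_of_real c * cis b + u) \<le> 7/2"
    using norm_triangle_ineq[of "2 * complex_of_real c * cis b" u] u cc by (simp add: norm_mult)
  then have 1: "swirl (7/2) 4 (- b) (2 * complex_of_real c * cis b + u) = 2 * complex_of_real c + v"
    by (simp add: swirl_inner v_def distrib_right mult.assoc cis_mult)
  define v' where "v' = v * cis (b - b')"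
  have v': "cmod v' \<le> 5/4" using v by (simp add: v'_def norm_mult)
  have far: "3/2 \<le> cmod (x + 4)" "3/2 \<le> cmod (x - 4)" if "cmod x \<le> 5/4" for x
    using that norm_triangle_ineq2[of 4 "- x"] norm_triangle_ineq2[of 4 x]
    by (simp_all add: norm_minus_commute add.commute)
  have 2: "swirl (5/4) (3/2) (b - b') (swirl (5/4) (3/2) (b - b') (2 * complex_of_real c + v - 2) + 4) - 2 = 2 * complex_of_real c + v'"
  proof (cases "c = 1")
    case True
    then show ?thesis using v v' far[of v']
      by (simp add: swirl_inner v'_def[symmetric] swirl_outer)
  next
    case False
    then have "c = -1" using c by auto
    then show ?thesis using v v' far[of v]
      by (simp add: swirl_outer swirl_inner v'_def[symmetric])
  qed
  have "cmod (2 * complex_of_real c + v') \<le> 7/2"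
    using norm_triangle_ineq[of "2 * of_real c" v'] v' cc by (simp add: norm_mult)
  then have "swirl (7/2) 4 b' (2 * complex_of_real c + v') = 2 * complex_of_real c * cis b' + v' * cis b'"
    by (simp add: swirl_inner distrib_right)
  also have "v' * cis b' = u" by (simp add: v'_def v_def mult.assoc cis_mult)
  finally show ?thesis unfolding move_discs_def 1 2 .
qed

lemma move_discs_outer:
  assumes "4 \<le> cmod w"
  shows "move_discs b b' w = w"
proof -
  have "3/2 \<le> cmod (w - 2)" "3/2 \<le> cmod (w + 2)"
    using assms norm_triangle_ineq2[of w 2] norm_triangle_ineq2[of w "-2"] by simp_all
  then have "swirl (5/4) (3/2) (b - b') (w - 2) = w - 2" "swirl (5/4) (3/2) (b - b') (w + 2) = w + 2"
    by (simp_all add: swirl_outer)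
  then show ?thesis using assms by (simp add: move_discs_def swirl_outer add.commute)
qed

lemma continuous_on_move_discs:
  assumes "continuous_on A f" "continuous_on A g" "continuous_on A k"
  shows "continuous_on A (\<lambda>x. move_discs (f x) (g x) (k x))"
  unfolding move_discs_def by (intro continuous_intros assms)

lemma bounded_homeo_move_discs:
  assumes "continuous_on UNIV \<beta>" "continuous_on UNIV \<beta>'"
  shows "bounded_homeo (slice (\<lambda>x w. move_discs (\<beta> x) (\<beta>' x) w))"
  by (rule bounded_homeo_slice[where B = 22])
    (use move_discs_inj move_discs_bound in
      \<open>auto intro!: continuous_on_move_discs continuous_on_compose2[OF assms(1)] continuous_on_compose2[OF assms(2)] continuous_intros\<close>)

section \<open>Closures of twisted tangles\<close>

definition clamp_to :: "real \<Rightarrow> real \<Rightarrow> real" where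
  "clamp_to b x = max (- b) (min b x)"

lemma continuous_on_clamp_to [continuous_intros]:
  "continuous_on A f \<Longrightarrow> continuous_on A (\<lambda>x. clamp_to b (f x))"
  unfolding clamp_to_def by (intro continuous_intros)

lemma continuous_on_turn [continuous_intros]:
  "continuous_on A f \<Longrightarrow> continuous_on A (\<lambda>x. turn (f x))"
  unfolding turn_def by (intro continuous_intros) auto

lemma turn_left: "x \<le> -3 \<Longrightarrow> turn x = 0" and turn_right: "3 \<le> x \<Longrightarrow> turn x = 1"
  by (auto simp: turn_def max_def min_def)

text \<open>Allows any angle function in place of a multiple of \<open>turn\<close>. As
  \<open>c\<close> runs over both signs, the set depends on \<open>\<beta>\<close> modulo
  \<open>pi\<close> only; \<open>twist_cong\<close> exploits this.\<close>

definition twist :: "(real \<Rightarrow> real) \<Rightarrow> real set \<Rightarrow> real \<Rightarrow> R3 set" where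
  "twist \<beta> I e = {(x, 2 * c * cos (\<beta> x) + r, 2 * c * sin (\<beta> x)) | x c r.
     x \<in> I \<and> c \<in> {-1, 1} \<and> \<bar>r\<bar> \<le> e}"

lemma image_Collect3:
  assumes "\<And>x c r. Q x c r \<Longrightarrow> h (F x c r) = G x c r"
  shows "h ` {F x c r | x c r. Q x c r} = {G x c r | x c r. Q x c r}"
proof (intro equalityI subsetI)
  fix p assume "p \<in> h ` {F x c r | x c r. Q x c r}"
  then obtain x c r where "p = h (F x c r)" "Q x c r" by blast
  then show "p \<in> {G x c r | x c r. Q x c r}" using assms by blast
next
  fix p assume "p \<in> {G x c r | x c r. Q x c r}"
  then obtain x c r where "p = h (F x c r)" "Q x c r" using assms by force
  then show "p \<in> h ` {F x c r | x c r. Q x c r}" by blast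
qed

lemma twist_Un: "twist \<beta> (I \<union> J) e = twist \<beta> I e \<union> twist \<beta> J e"
  unfolding twist_def by blast

text \<open>For \<open>a = 4\<close> these are the closing arcs of the numerator closure.\<close>

definition outer :: "real \<Rightarrow> real \<Rightarrow> R3 set" where
  "outer a e = {(x, y, 0) | x y. (a < \<bar>x\<bar> \<or> 4 < \<bar>y\<bar>) \<and>
     (\<bar>max (\<bar>x\<bar> - (a - 1)) \<bar>y - 5\<bar> - 3\<bar> \<le> e \<or> \<bar>max (\<bar>x\<bar> - (a - 1)) \<bar>y + 5\<bar> - 3\<bar> \<le> e)}"

definition closed_twist :: "real \<Rightarrow> (real \<Rightarrow> real) \<Rightarrow> real \<Rightarrow> R3 set" where
  "closed_twist a \<beta> e = twist \<beta> {-a..a} e \<union> outer a e"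

abbreviation half_turns :: "int \<Rightarrow> real \<Rightarrow> real" where
  "half_turns n x \<equiv> of_int n * pi * turn x"

lemma twist_points_eq: "twist_points n {-e..e} = twist (half_turns n) {-4..4} e"
proof -
  have 1: "\<bar>x\<bar> \<le> b \<longleftrightarrow> x \<in> {-b..b}" for x b :: real by auto
  have 2: "c * 2 * d = 2 * c * d" for c d :: real by simp
  show ?thesis unfolding twist_points_def twist_def 1 2 by (rule refl)
qed

lemma tangle_D_eq: "tangle_D n = band_of (twist (half_turns n) {-4..4})"
  using twist_points_eq[of n 0] twist_points_eq[of n 1] by (simp add: tangle_D_def band_of_def)

lemma mem_frame_points: "(x, y, z) \<in> frame_points y0 I \<longleftrightarrow> z = 0 \<and> max (\<bar>x\<bar> - 3) \<bar>y - y0\<bar> \<in> I"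
  unfolding frame_points_def by blast

lemma mem_outer: "(x, y, z) \<in> outer a e \<longleftrightarrow> z = 0 \<and> (a < \<bar>x\<bar> \<or> 4 < \<bar>y\<bar>) \<and>
     (\<bar>max (\<bar>x\<bar> - (a - 1)) \<bar>y - 5\<bar> - 3\<bar> \<le> e \<or> \<bar>max (\<bar>x\<bar> - (a - 1)) \<bar>y + 5\<bar> - 3\<bar> \<le> e)"
  unfolding outer_def by blast

lemma closing_arcs_eq:
  "frame_points 5 {3-e..3+e} \<union> frame_points (-5) {3-e..3+e} - tangle_box = outer 4 e"
proof (rule set_eqI)
  fix p :: R3
  obtain x y z where p: "p = (x, y, z)" by (metis prod.collapse)
  have 1: "a \<in> {3 - e..3 + e} \<longleftrightarrow> \<bar>a - 3\<bar> \<le> e" for a by auto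
  have "x \<in> {-4..4} \<longleftrightarrow> \<bar>x\<bar> \<le> 4" "y \<in> {-4..4} \<longleftrightarrow> \<bar>y\<bar> \<le> 4" by auto
  then have 2: "z = 0 \<Longrightarrow> p \<notin> tangle_box \<longleftrightarrow> 4 < \<bar>x\<bar> \<or> 4 < \<bar>y\<bar>"
    by (auto simp: p tangle_box_def)
  show "p \<in> frame_points 5 {3-e..3+e} \<union> frame_points (-5) {3-e..3+e} - tangle_box \<longleftrightarrow> p \<in> outer 4 e"
    unfolding Diff_iff Un_iff mem_frame_points p mem_outer 1 using 2 unfolding p by auto
qed

lemma numerator_closure_tangle_D:
  "numerator_closure (tangle_D n) = band_image to_S3 (band_of (closed_twist 4 (half_turns n)))"
  using closing_arcs_eq[of 0] closing_arcs_eq[of 1]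
  by (simp add: numerator_closure_def tangle_D_eq band_union_def band_minus_def band_of_def frame_def closed_twist_def)

lemma slice_move_discs_twist:
  assumes "e \<le> 1"
  shows "slice (\<lambda>x w. move_discs (\<beta> x) (\<beta>' x) w) ` twist \<beta> I e = twist \<beta>' I e"
proof -
  let ?h = "slice (\<lambda>x w. move_discs (\<beta> x) (\<beta>' x) w)"
  have *: "?h (x, 2 * c * cos (\<beta> x) + r, 2 * c * sin (\<beta> x)) = (x, 2 * c * cos (\<beta>' x) + r, 2 * c * sin (\<beta>' x))"
    if "c \<in> {-1, 1}" "\<bar>r\<bar> \<le> e" for x c r
  proof -
    have e: "Complex (2 * c * cos b + r) (2 * c * sin b) = 2 * complex_of_real c * cis b + of_real r" for b
      by (simp add: complex_eq_iff)
    have "move_discs (\<beta> x) (\<beta>' x) (2 * complex_of_real c * cis (\<beta> x) + of_real r)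
        = 2 * complex_of_real c * cis (\<beta>' x) + of_real r"
      by (rule move_discs_disc) (use that assms in auto)
    then show ?thesis unfolding slice_eq e by simp
  qed
  show ?thesis unfolding twist_def by (rule image_Collect3) (use * in blast)
qed

text \<open>Only the values of the angle at the ends count. On the closing arcs the slicewise motion
  is the identity, either because the two angles agree there or because \<open>|y| > 4\<close> is
  out of reach of \<open>move_discs\<close>.\<close>

lemma closed_twist_isotopic:
  assumes "continuous_on UNIV \<beta>" "continuous_on UNIV \<beta>'" "\<And>x. a \<le> \<bar>x\<bar> \<Longrightarrow> \<beta> x = \<beta>' x"
  shows "band_of (closed_twist a \<beta>) \<simeq> band_of (closed_twist a \<beta>')"
proof (rule isotopic_band_ofI[OF bounded_homeo_move_discs[OF assms(1,2)]])
  fix e :: real assume e: "0 \<le> e" "e \<le> 1"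
  let ?h = "slice (\<lambda>x w. move_discs (\<beta> x) (\<beta>' x) w)"
  have "?h p = p" if "p \<in> outer a e" for p
  proof -
    from that obtain x y where p: "p = (x, y, 0)" "a < \<bar>x\<bar> \<or> 4 < \<bar>y\<bar>" unfolding outer_def by blast
    have "4 < \<bar>y\<bar> \<Longrightarrow> 4 \<le> cmod (Complex y 0)" by (simp add: complex_norm)
    then show ?thesis
      using p(2) assms(3)[of x] by (auto simp: p(1) slice_eq move_discs_outer)
  qed
  then have "?h ` outer a e = outer a e" by simp
  then show "?h ` closed_twist a \<beta> e = closed_twist a \<beta>' e"
    unfolding closed_twist_def image_Un slice_move_discs_twist[OF e(2)] by simp
qed

lemma twist_cong:
  assumes "\<And>x. x \<in> I \<Longrightarrow> \<exists>s\<in>{-1, 1}. cos (\<beta> x) = s * cos (\<beta>' x) \<and> sin (\<beta> x) = s * sin (\<beta>' x)"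
  shows "twist \<beta> I e = twist \<beta>' I e"
proof -
  have *: "twist \<beta> I e \<subseteq> twist \<beta>' I e"
    if *: "\<And>x. x \<in> I \<Longrightarrow> \<exists>s\<in>{-1, 1}. cos (\<beta> x) = s * cos (\<beta>' x) \<and> sin (\<beta> x) = s * sin (\<beta>' x)" for \<beta> \<beta>'
  proof
    fix p assume "p \<in> twist \<beta> I e"
    then obtain x c r where p: "p = (x, 2 * c * cos (\<beta> x) + r, 2 * c * sin (\<beta> x))" "x \<in> I" "c \<in> {-1, 1}" "\<bar>r\<bar> \<le> e"
      unfolding twist_def by blast
    obtain s where s: "s \<in> {-1, 1}" "cos (\<beta> x) = s * cos (\<beta>' x)" "sin (\<beta> x) = s * sin (\<beta>' x)"
      using *[OF p(2)] by blast
    have "p = (x, 2 * (c * s) * cos (\<beta>' x) + r, 2 * (c * s) * sin (\<beta>' x))" "c * s \<in> {-1, 1}"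
      using p s by auto
    then show "p \<in> twist \<beta>' I e" using p(2,4) unfolding twist_def by blast
  qed
  have "\<exists>s\<in>{-1, 1}. cos (\<beta>' x) = s * cos (\<beta> x) \<and> sin (\<beta>' x) = s * sin (\<beta> x)" if "x \<in> I" for x
    using assms[OF that] by force
  from *[OF assms] *[OF this] show ?thesis by (rule equalityI)
qed

lemma cos_sin_add_int_pi:
  "\<exists>s\<in>{-1, 1}. cos (x + of_int n * pi) = s * cos x \<and> sin (x + of_int n * pi) = s * sin (x :: real)"
proof -
  have 0: "sin (of_int n * pi) = (0::real)" using sin_npi_int[of n] by (simp add: mult.commute)
  then have "(cos (of_int n * pi))\<^sup>2 = (1::real)" using sin_cos_squared_add[of "of_int n * pi"] by simp
  then have "cos (of_int n * pi) \<in> {-1, 1::real}" by (auto simp: power2_eq_1_iff)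
  moreover have "cos (x + of_int n * pi) = cos (of_int n * pi) * cos x"
    "sin (x + of_int n * pi) = cos (of_int n * pi) * sin x"
    unfolding cos_add sin_add 0 by simp_all
  ultimately show ?thesis by blast
qed

text \<open>The step is by full twists because these bring each strand back to its own place: for
  \<open>|x| \<ge> 3\<close> the two angles differ by a multiple of \<open>2 * pi\<close> and
  \<open>move_discs\<close> is the identity on the discs around the strands, so
  \<open>tame_cut\<close> applies. An odd number of half twists would interchange the discs.\<close>

lemma tame_closed_twist_step:
  assumes "tame (band_of (closed_twist 4 (half_turns n)))"
  shows "tame (band_of (closed_twist 4 (half_turns (n + 2 * j))))"
proof -
  let ?b = "half_turns n" and ?b' = "half_turns (n + 2 * j)"
  let ?h = "slice (\<lambda>x w. move_discs (?b x) (?b' x) w)"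
  let ?t = "\<lambda>p. if \<bar>fst p\<bar> \<le> 4 then ?h p else p"
  have bh: "bounded_homeo ?h" by (intro bounded_homeo_move_discs continuous_intros)
  \<comment> \<open>The two diamonds lie in the discs that \<open>move_discs\<close> translates
    rigidly, and they contain the cross sections of the strands at \<open>|x| = 4\<close>, which are
    segments of half-width 1 in the plane of projection.\<close>
  let ?W = "{p :: R3. \<bar>fst (snd p) - 2\<bar> + \<bar>snd (snd p)\<bar> < 5/4} \<union> {p. \<bar>fst (snd p) + 2\<bar> + \<bar>snd (snd p)\<bar> < 5/4}
     \<union> {p. 4 < \<bar>fst (snd p)\<bar>}"
  have W: "open ?W" by (intro open_Un open_Collect_less continuous_intros)
  have cisn: "cis (?b x) \<in> {-1, 1}" "cis (?b' x) = cis (?b x)" if x: "3 \<le> \<bar>x\<bar>" for x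
  proof -
    have "x \<le> -3 \<or> 3 \<le> x" using x by linarith
    then have t: "turn x = 0 \<or> turn x = 1" using turn_left turn_right by blast
    then show "cis (?b x) \<in> {-1, 1}"
      using cos_sin_add_int_pi[of 0 n] by (auto simp: complex_eq_iff)
    define k where "k = (if turn x = 0 then 0 else j)"
    have "?b' x = ?b x + 2 * pi * of_int k"
      using t by (auto simp: k_def algebra_simps)
    then show "cis (?b' x) = cis (?b x)"
      by (simp only: complex_eq_iff cis.sel cos_add sin_add cos_int_2pin sin_int_2pin) simp
  qed
  have disc: "move_discs (?b x) (?b' x) w = w"
    if x: "3 \<le> \<bar>x\<bar>" and w: "cmod (w - 2) \<le> 5/4 \<or> cmod (w + 2) \<le> 5/4" for x w
  proof -
    obtain s :: real where s: "s \<in> {-1, 1}" "cis (?b x) = of_real s"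
      using cisn(1)[OF x] by (metis insert_iff of_real_1 of_real_minus singletonD)
    define c :: real where "c = (if cmod (w - 2) \<le> 5/4 then s else - s)"
    have cs: "c \<in> {-1, 1}" using s(1) by (auto simp: c_def)
    have ew: "2 * complex_of_real c * cis (?b x) + (w - 2 * complex_of_real (c * s)) = w"
      using s(2) by simp
    have "cmod (w - 2 * complex_of_real (c * s)) \<le> 5/4"
      using w s(1) by (auto simp: c_def)
    from move_discs_disc[OF cs this, of "?b x" "?b' x"]
    show ?thesis unfolding cisn(2)[OF x] ew .
  qed
  have far: "?h (x, y, z) = (x, y, z)" if "4 < \<bar>y\<bar>" for x y z
  proof -
    have "4 \<le> cmod (Complex y z)" using that abs_Re_le_cmod[of "Complex y z"] by simp
    then show ?thesis by (simp add: slice_eq move_discs_outer)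
  qed
  have hW: "?h p = p" if "p \<in> ?W" "3 < \<bar>fst p\<bar>" for p
  proof -
    obtain x y z where p: "p = (x, y, z)" by (metis prod.collapse)
    have near: "cmod (Complex y z - c) \<le> 5/4" if "\<bar>y - Re c\<bar> + \<bar>z\<bar> < 5/4" "Im c = 0" for c
      using that cmod_le[of "Complex y z - c"] by simp
    have "\<bar>y - 2\<bar> + \<bar>z\<bar> < 5/4 \<or> \<bar>y + 2\<bar> + \<bar>z\<bar> < 5/4 \<or> 4 < \<bar>y\<bar>"
      using \<open>p \<in> ?W\<close> unfolding p by simp
    then consider "\<bar>y - 2\<bar> + \<bar>z\<bar> < 5/4" | "\<bar>y + 2\<bar> + \<bar>z\<bar> < 5/4" | "4 < \<bar>y\<bar>" by blast
    then show ?thesis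
    proof cases
      case 1
      then show ?thesis using near[of 2] disc[of x "Complex y z"] that(2) by (simp add: p slice_eq)
    next
      case 2
      then show ?thesis using near[of "-2"] disc[of x "Complex y z"] that(2) by (simp add: p slice_eq)
    next
      case 3
      then show ?thesis unfolding p by (rule far)
    qed
  qed
  have sub: "closed_twist 4 ?b 1 \<subseteq> {p. \<bar>fst p\<bar> < 4} \<union> {p. 4 < \<bar>fst p\<bar>} \<union> {p \<in> ?W. 3 < \<bar>fst p\<bar>}"
  proof
    fix p assume p: "p \<in> closed_twist 4 ?b 1"
    show "p \<in> {p. \<bar>fst p\<bar> < 4} \<union> {p. 4 < \<bar>fst p\<bar>} \<union> {p \<in> ?W. 3 < \<bar>fst p\<bar>}"
    proof (cases "\<bar>fst p\<bar> = 4")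
      case True
      from p consider x c r where "p = (x, 2 * c * cos (?b x) + r, 2 * c * sin (?b x))" "c \<in> {-1, 1}" "\<bar>r\<bar> \<le> 1"
        | "p \<in> outer 4 1" unfolding closed_twist_def twist_def by blast
      then have "p \<in> ?W"
      proof cases
        case 1
        have "cis (?b x) \<in> {-1, 1}" using cisn(1)[of x] True 1(1) by simp
        then have "cos (?b x) \<in> {-1, 1}" "sin (?b x) = 0" by (auto simp: complex_eq_iff)
        then show ?thesis using 1(2,3) unfolding 1(1) by auto
      next
        case 2
        then show ?thesis using True by (auto simp: outer_def)
      qed
      then show ?thesis using True by auto
    qed auto
  qed
  have im: "?t ` closed_twist 4 ?b e = closed_twist 4 ?b' e" if "e \<le> 1" for e
  proof -
    have "?t ` twist ?b {-4..4} e = ?h ` twist ?b {-4..4} e"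
      by (rule image_cong) (auto simp: twist_def)
    then have 1: "?t ` twist ?b {-4..4} e = twist ?b' {-4..4} e"
      using slice_move_discs_twist[OF that, of ?b ?b' "{-4..4}"] by simp
    have 2: "?t ` outer 4 e = outer 4 e"
    proof -
      have "?t p = p" if "p \<in> outer 4 e" for p using that far by (auto simp: outer_def)
      then show ?thesis by simp
    qed
    show ?thesis unfolding closed_twist_def image_Un 1 2 ..
  qed
  have "tame (band_image ?t (band_of (closed_twist 4 ?b)))"
    by (rule tame_cut[OF assms bh _ W hW]) (use sub in \<open>auto simp: band_of_def\<close>)
  then show ?thesis
    unfolding band_of_def band_image_def fst_conv snd_conv im[OF zero_le_one] im[OF order_refl] .
qed

text \<open>Slope 3 on \<open>{-4..4}\<close>, translations by 8 beyond. A twist region of length 8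
  becomes three regions of that length, with the cube around the middle one.\<close>

definition stretch :: "R3 \<Rightarrow> R3" where
  "stretch p = (fst p + clamp_to 8 (2 * fst p), snd p)"

lemma bounded_homeo_stretch: "bounded_homeo stretch"
  unfolding stretch_def
proof (rule bounded_homeo_fiber_x[where f = "\<lambda>x y z. x + clamp_to 8 (2 * x)" and B = 8])
  show "continuous_on UNIV (\<lambda>p :: R3. fst p + clamp_to 8 (2 * fst p))" by (intro continuous_intros)
qed (auto simp: clamp_to_def max_def min_def split: if_splits)

lemma closed_twist_stretch:
  "band_of (closed_twist 4 \<beta>) \<simeq> band_of (closed_twist 12 (\<lambda>x. \<beta> (x / 3)))"
proof -
  let ?h = "\<lambda>p :: R3. (fst p + clamp_to 8 (2 * fst p), snd p)"
  have bh: "bounded_homeo ?h"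
    using bounded_homeo_stretch unfolding stretch_def[abs_def] .
  show ?thesis
  proof (rule isotopic_band_ofI[OF bh])
    fix e :: real assume e: "0 \<le> e" "e \<le> 1"
    have "?h ` twist \<beta> {-4..4} e = twist (\<lambda>x. \<beta> (x / 3)) {-12..12} e"
    proof (intro equalityI subsetI)
      fix p assume "p \<in> ?h ` twist \<beta> {-4..4} e"
      then obtain x c r where p: "p = ?h (x, 2 * c * cos (\<beta> x) + r, 2 * c * sin (\<beta> x))" "x \<in> {-4..4}" "c \<in> {-1, 1}" "\<bar>r\<bar> \<le> e"
        unfolding twist_def by blast
      then have "p = (3 * x, 2 * c * cos (\<beta> (3 * x / 3)) + r, 2 * c * sin (\<beta> (3 * x / 3)))" "3 * x \<in> {-12..12}"
        by (auto simp: clamp_to_def)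
      then show "p \<in> twist (\<lambda>x. \<beta> (x / 3)) {-12..12} e" using p(3,4) unfolding twist_def by blast
    next
      fix p assume "p \<in> twist (\<lambda>x. \<beta> (x / 3)) {-12..12} e"
      then obtain x c r where p: "p = (x, 2 * c * cos (\<beta> (x / 3)) + r, 2 * c * sin (\<beta> (x / 3)))" "x \<in> {-12..12}" "c \<in> {-1, 1}" "\<bar>r\<bar> \<le> e"
        unfolding twist_def by blast
      then have "p = ?h (x / 3, 2 * c * cos (\<beta> (x / 3)) + r, 2 * c * sin (\<beta> (x / 3)))" "x / 3 \<in> {-4..4}"
        by (auto simp: clamp_to_def)
      then show "p \<in> ?h ` twist \<beta> {-4..4} e" using p(3,4) unfolding twist_def by blast
    qed
    moreover have "?h ` outer 4 e = outer 12 e"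
    proof (rule bounded_homeo_image_eqI[OF bh])
      fix p :: R3
      obtain x y z where p: "p = (x, y, z)" by (metis prod.collapse)
      define x' where "x' = x + clamp_to 8 (2 * x)"
      have 1: "\<bar>x'\<bar> = \<bar>x\<bar> + 8" if "4 < \<bar>x\<bar>"
        using that by (cases "x < 0") (simp_all add: x'_def clamp_to_def)
      have 2: "\<bar>x'\<bar> \<le> 12" if "\<bar>x\<bar> \<le> 4"
      proof -
        have "clamp_to 8 (2 * x) = 2 * x" using that by (auto simp: clamp_to_def abs_le_iff)
        then show ?thesis using that by (simp add: x'_def)
      qed
      have "(x', y, z) \<in> outer 12 e \<longleftrightarrow> (x, y, z) \<in> outer 4 e"
      proof (cases "\<bar>x\<bar> \<le> 4")
        case True
        then have s: "\<bar>max (\<bar>x\<bar> - 3) d - 3\<bar> \<le> e \<longleftrightarrow> \<bar>d - 3\<bar> \<le> e"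
          "\<bar>max (\<bar>x'\<bar> - 11) d - 3\<bar> \<le> e \<longleftrightarrow> \<bar>d - 3\<bar> \<le> e" for d
          using 2 e by (auto simp: max_def abs_if)
        show ?thesis using True 2[OF True] by (simp add: outer_def s)
      next
        case False
        then show ?thesis using 1 by (simp add: outer_def)
      qed
      then show "?h p \<in> outer 12 e \<longleftrightarrow> p \<in> outer 4 e" by (simp add: p x'_def)
    qed
    ultimately show "?h ` closed_twist 4 \<beta> e = closed_twist 12 (\<lambda>x. \<beta> (x / 3)) e"
      unfolding closed_twist_def image_Un by simp
  qed
qed

text \<open>With \<open>turn\<close> shifted by 8 the \<open>m\<close> half turns take place on
  \<open>{-11..-5}\<close>, left of the cube; the gap over \<open>{-4..4}\<close> is where the
  tangles of the cubic relation go.\<close>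

definition cubic_outside :: "int \<Rightarrow> real \<Rightarrow> R3 set" where
  "cubic_outside m e = twist (\<lambda>x. half_turns m (x + 8)) ({-12..12} - {-4..4}) e \<union> outer 12 e"

lemma outside_box_cubic_outside: "outside_box (band_of (cubic_outside m))"
  unfolding outside_box_def band_of_def cubic_outside_def twist_def outer_def tangle_box_def
  by auto

text \<open>Angles count modulo \<open>pi\<close>: inside the cube the contribution
  \<open>m * pi\<close> of the left region is invisible, outside it that of
  \<open>half_turns k\<close> is. So a single angle function, the sum, describes the whole twist
  region.\<close>

lemma cubic_outside_tangle_D:
  "band_union (band_of (cubic_outside m)) (tangle_D k) =
     band_of (closed_twist 12 (\<lambda>x. half_turns m (x + 8) + half_turns k x))"
proof -
  let ?\<beta> = "\<lambda>x. half_turns m (x + 8) + half_turns k x"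
  have 1: "twist (\<lambda>x. half_turns m (x + 8)) ({-12..12} - {-4..4}) e = twist ?\<beta> ({-12..12} - {-4..4}) e" for e
  proof (rule sym, rule twist_cong)
    fix x :: real assume "x \<in> {-12..12} - {-4..4}"
    then have "turn x = 0 \<or> turn x = 1" using turn_left[of x] turn_right[of x] by auto
    then show "\<exists>s\<in>{-1, 1}. cos (?\<beta> x) = s * cos (half_turns m (x + 8)) \<and> sin (?\<beta> x) = s * sin (half_turns m (x + 8))"
      using cos_sin_add_int_pi[of "half_turns m (x + 8)" k] by auto
  qed
  have 2: "twist (half_turns k) {-4..4} e = twist ?\<beta> {-4..4} e" for e
  proof (rule sym, rule twist_cong)
    fix x :: real assume "x \<in> {-4..4}"
    then have "turn (x + 8) = 1" using turn_right[of "x + 8"] by auto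
    then show "\<exists>s\<in>{-1, 1}. cos (?\<beta> x) = s * cos (half_turns k x) \<and> sin (?\<beta> x) = s * sin (half_turns k x)"
      using cos_sin_add_int_pi[of "half_turns k x" m] by (simp add: add.commute)
  qed
  have 3: "twist ?\<beta> ({-12..12} - {-4..4}) e \<union> twist ?\<beta> {-4..4} e = twist ?\<beta> {-12..12} e" for e
  proof -
    have "({-12..12} - {-4..4}) \<union> {-4..4} = {-12..12 :: real}" by auto
    then show ?thesis using twist_Un[of ?\<beta> "{-12..12} - {-4..4}" "{-4..4}" e] by simp
  qed
  have 4: "cubic_outside m e \<union> twist (half_turns k) {-4..4} e = closed_twist 12 ?\<beta> e" for e
    unfolding cubic_outside_def closed_twist_def 1 2 3[symmetric] by blast
  show ?thesis
    by (simp add: tangle_D_eq band_union_def band_of_def 4)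
qed

text \<open>Both angle functions grow from 0 to \<open>(m + k) * pi\<close>; how the turning is
  distributed in between does not matter.\<close>

lemma cubic_outside_tangle_D_isotopic:
  "band_of (closed_twist 4 (half_turns (m + k))) \<simeq> band_union (band_of (cubic_outside m)) (tangle_D k)"
proof -
  have "band_of (closed_twist 4 (half_turns (m + k))) \<simeq> band_of (closed_twist 12 (\<lambda>x. half_turns (m + k) (x / 3)))"
    by (rule closed_twist_stretch)
  also have "\<dots> \<simeq> band_of (closed_twist 12 (\<lambda>x. half_turns m (x + 8) + half_turns k x))"
  proof (rule closed_twist_isotopic)
    fix x :: real assume "12 \<le> \<bar>x\<bar>"
    then consider "x \<le> -12" | "12 \<le> x" by linarith
    then show "half_turns (m + k) (x / 3) = half_turns m (x + 8) + half_turns k x"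
      by cases (simp_all add: turn_left turn_right algebra_simps)
  qed (intro continuous_intros; simp)+
  finally show ?thesis unfolding cubic_outside_tangle_D .
qed

section \<open>Twisted strips\<close>

definition strip_set :: "(real \<Rightarrow> real) \<Rightarrow> real set \<Rightarrow> real \<Rightarrow> R3 set" where
  "strip_set \<phi> I e = {(x, r * cos (\<phi> x), r * sin (\<phi> x)) | x r. x \<in> I \<and> \<bar>r\<bar> \<le> e}"

definition strip_link :: "(real \<Rightarrow> R3 set) \<Rightarrow> (real \<Rightarrow> real) \<Rightarrow> real \<Rightarrow> R3 set" where
  "strip_link Y \<phi> e = strip_set \<phi> {-4..4} e \<union> Y e"

abbreviation full_turns :: "int \<Rightarrow> real \<Rightarrow> real" where
  "full_turns k x \<equiv> 2 * pi * of_int k * turn x"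

lemma image_Collect2:
  assumes "\<And>x r. Q x r \<Longrightarrow> h (F x r) = G x r"
  shows "h ` {F x r | x r. Q x r} = {G x r | x r. Q x r}"
proof (intro equalityI subsetI)
  fix p assume "p \<in> h ` {F x r | x r. Q x r}"
  then obtain x r where "p = h (F x r)" "Q x r" by blast
  then show "p \<in> {G x r | x r. Q x r}" using assms by blast
next
  fix p assume "p \<in> {G x r | x r. Q x r}"
  then obtain x r where "p = h (F x r)" "Q x r" using assms by force
  then show "p \<in> h ` {F x r | x r. Q x r}" by blast
qed

lemma mem_twist: "(x, y, z) \<in> twist \<beta> I e \<longleftrightarrow>
    x \<in> I \<and> (\<exists>c\<in>{-1, 1}. z = 2 * c * sin (\<beta> x) \<and> \<bar>y - 2 * c * cos (\<beta> x)\<bar> \<le> e)"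
proof
  assume "(x, y, z) \<in> twist \<beta> I e"
  then show "x \<in> I \<and> (\<exists>c\<in>{-1, 1}. z = 2 * c * sin (\<beta> x) \<and> \<bar>y - 2 * c * cos (\<beta> x)\<bar> \<le> e)"
    unfolding twist_def by auto
next
  assume "x \<in> I \<and> (\<exists>c\<in>{-1, 1}. z = 2 * c * sin (\<beta> x) \<and> \<bar>y - 2 * c * cos (\<beta> x)\<bar> \<le> e)"
  then obtain c where "x \<in> I" "c \<in> {-1, 1}" "z = 2 * c * sin (\<beta> x)" "\<bar>y - 2 * c * cos (\<beta> x)\<bar> \<le> e" by blast
  then show "(x, y, z) \<in> twist \<beta> I e"
    unfolding twist_def mem_Collect_eq
    by (intro exI[of _ x] exI[of _ c] exI[of _ "y - 2 * c * cos (\<beta> x)"]) simp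
qed

lemma image_eq_self: "(\<And>p. p \<in> A \<Longrightarrow> h p = p) \<Longrightarrow> h ` A = A"
  by force

lemma strip_set_Un: "strip_set \<phi> (I \<union> J) e = strip_set \<phi> I e \<union> strip_set \<phi> J e"
  unfolding strip_set_def by blast

lemma strip_set_cong:
  assumes "\<And>x. x \<in> I \<Longrightarrow> cos (\<phi> x) = cos (\<phi>' x) \<and> sin (\<phi> x) = sin (\<phi>' x)"
  shows "strip_set \<phi> I e = strip_set \<phi>' I e"
  unfolding strip_set_def using assms by (intro Collect_cong ex_cong1) (auto simp only:)

lemma strip_eq: "strip k = band_of (strip_set (full_turns (int k)) {-4..4})"
proof -
  have 1: "\<bar>x\<bar> \<le> b \<longleftrightarrow> x \<in> {-b..b}" for x b :: real by auto
  have "strip_points k {-e..e} = strip_set (full_turns (int k)) {-4..4} e" for e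
    unfolding strip_points_def strip_set_def 1 by simp
  from this[of 0] this[of 1] show ?thesis by (simp add: strip_def band_of_def)
qed

lemma slice_swirl_strip_set:
  assumes "e \<le> 1"
  shows "slice (\<lambda>x w. swirl (5/4) 2 (\<alpha> x) w) ` strip_set \<phi> I e = strip_set (\<lambda>x. \<phi> x + \<alpha> x) I e"
  unfolding strip_set_def
proof (rule image_Collect2)
  fix x r assume r: "x \<in> I \<and> \<bar>r\<bar> \<le> e"
  have e: "Complex (r * cos b) (r * sin b) = r * cis b" for b by (simp add: complex_eq_iff)
  have "cmod (r * cis (\<phi> x)) \<le> 5/4" using r assms by (simp add: norm_mult)
  then have "swirl (5/4) 2 (\<alpha> x) (r * cis (\<phi> x)) = r * cis (\<phi> x + \<alpha> x)"
    by (simp add: swirl_inner mult.assoc cis_mult)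
  then show "slice (\<lambda>x w. swirl (5/4) 2 (\<alpha> x) w) (x, r * cos (\<phi> x), r * sin (\<phi> x)) =
      (x, r * cos (\<phi> x + \<alpha> x), r * sin (\<phi> x + \<alpha> x))"
    unfolding slice_eq e by simp
qed

lemma slice_swirl_far: "4 < \<bar>y\<bar> \<or> 4 < \<bar>z\<bar> \<Longrightarrow> slice (\<lambda>x w. swirl (5/4) 2 (\<alpha> x) w) (x, y, z) = (x, y, z)"
  using abs_Re_le_cmod[of "Complex y z"] abs_Im_le_cmod[of "Complex y z"]
  by (auto simp: slice_eq swirl_outer)

text \<open>A swirl about the axis of the strand adds \<open>\<phi>' - \<phi>\<close> to the angle
  of the ribbon. A point outside the cube is either beyond its radius 2 or in a plane where the two
  angles agree, so \<open>Y\<close> is fixed.\<close>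

lemma strip_link_isotopic:
  assumes "continuous_on UNIV \<phi>" "continuous_on UNIV \<phi>'" "\<And>x. 4 \<le> \<bar>x\<bar> \<Longrightarrow> \<phi> x = \<phi>' x"
    and Y: "\<And>e. e \<le> 1 \<Longrightarrow> Y e \<inter> tangle_box = {}"
  shows "band_of (strip_link Y \<phi>) \<simeq> band_of (strip_link Y \<phi>')"
proof -
  let ?\<alpha> = "\<lambda>x. \<phi>' x - \<phi> x"
  let ?h = "slice (\<lambda>x w. swirl (5/4) 2 (?\<alpha> x) w)"
  have bh: "bounded_homeo ?h" by (rule bounded_homeo_slice_swirl) (auto intro!: continuous_intros assms(1,2))
  show ?thesis
  proof (rule isotopic_band_ofI[OF bh])
    fix e :: real assume e: "0 \<le> e" "e \<le> 1"
    have "?h p = p" if "p \<in> Y e" for p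
    proof -
      obtain x y z where p: "p = (x, y, z)" by (metis prod.collapse)
      have "p \<notin> tangle_box" using that Y[OF e(2)] by blast
      then have "4 < \<bar>x\<bar> \<or> 4 < \<bar>y\<bar> \<or> 4 < \<bar>z\<bar>" unfolding p tangle_box_def by auto
      then show ?thesis
        using slice_swirl_far[of y z ?\<alpha> x] assms(3)[of x] by (auto simp: p slice_eq)
    qed
    then have "?h ` Y e = Y e" by (rule image_eq_self)
    then show "?h ` strip_link Y \<phi> e = strip_link Y \<phi>' e"
      unfolding strip_link_def image_Un slice_swirl_strip_set[OF e(2)] by simp
  qed
qed

text \<open>For \<open>|x| \<ge> 3\<close> whole turns of the ribbon are rotations by multiples of
  \<open>2 * pi\<close>, hence the identity near the strand, and \<open>tame_cut\<close>
  applies.\<close>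

lemma tame_strip_link_step:
  assumes L: "tame (band_of (strip_link Y (full_turns k)))"
    and Y: "\<And>e. e \<le> 1 \<Longrightarrow> Y e \<inter> tangle_box = {}"
  shows "tame (band_of (strip_link Y (full_turns (k + j))))"
proof -
  let ?h = "slice (\<lambda>x w. swirl (5/4) 2 (full_turns j x) w)"
  let ?t = "\<lambda>p. if \<bar>fst p\<bar> \<le> 4 then ?h p else p"
  have bh: "bounded_homeo ?h" by (rule bounded_homeo_slice_swirl) (auto intro!: continuous_intros)
  let ?W = "{p :: R3. \<bar>fst (snd p)\<bar> + \<bar>snd (snd p)\<bar> < 5/4} \<union> {p. 4 < \<bar>fst (snd p)\<bar>} \<union> {p. 4 < \<bar>snd (snd p)\<bar>}"
  have W: "open ?W" by (intro open_Un open_Collect_less continuous_intros)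
  have t01: "turn x = 0 \<or> turn x = 1" if "3 \<le> \<bar>x\<bar>" for x
    using that turn_left[of x] turn_right[of x] by linarith
  have int: "cos (full_turns i x) = 1" "sin (full_turns i x) = 0" if "3 \<le> \<bar>x\<bar>" for i x
    using t01[OF that] cos_int_2pin[of i] sin_int_2pin[of i] by (auto simp: mult.assoc)
  have hW: "?h p = p" if "p \<in> ?W" "3 < \<bar>fst p\<bar>" for p
  proof -
    obtain x y z where p: "p = (x, y, z)" by (metis prod.collapse)
    have x: "3 \<le> \<bar>x\<bar>" using that(2) by (simp add: p)
    have "\<bar>y\<bar> + \<bar>z\<bar> < 5/4 \<or> 4 < \<bar>y\<bar> \<or> 4 < \<bar>z\<bar>" using \<open>p \<in> ?W\<close> unfolding p by simp
    then show ?thesis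
    proof
      assume "\<bar>y\<bar> + \<bar>z\<bar> < 5/4"
      then have "cmod (Complex y z) \<le> 5/4" using cmod_le[of "Complex y z"] by simp
      then have "swirl (5/4) 2 (full_turns j x) (Complex y z) = Complex y z * cis (full_turns j x)"
        by (simp add: swirl_inner)
      also have "cis (full_turns j x) = 1" using int[OF x, of j] by (simp add: complex_eq_iff)
      finally show ?thesis by (simp add: p slice_eq)
    next
      assume "4 < \<bar>y\<bar> \<or> 4 < \<bar>z\<bar>"
      then show ?thesis unfolding p by (rule slice_swirl_far)
    qed
  qed
  have sub: "strip_link Y (full_turns k) 1 \<subseteq> {p. \<bar>fst p\<bar> < 4} \<union> {p. 4 < \<bar>fst p\<bar>} \<union> {p \<in> ?W. 3 < \<bar>fst p\<bar>}"
  proof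
    fix p assume p: "p \<in> strip_link Y (full_turns k) 1"
    show "p \<in> {p. \<bar>fst p\<bar> < 4} \<union> {p. 4 < \<bar>fst p\<bar>} \<union> {p \<in> ?W. 3 < \<bar>fst p\<bar>}"
    proof (cases "\<bar>fst p\<bar> = 4")
      case True
      from p consider x r where "p = (x, r * cos (full_turns k x), r * sin (full_turns k x))" "\<bar>r\<bar> \<le> 1"
        | "p \<in> Y 1" unfolding strip_link_def strip_set_def by blast
      then have "p \<in> ?W"
      proof cases
        case 1
        then have "3 \<le> \<bar>x\<bar>" using True by simp
        from int[OF this, of k] show ?thesis using 1 by simp
      next
        case 2
        then have "p \<notin> tangle_box" using Y[of 1] by auto
        then show ?thesis using True by (cases p) (auto simp: tangle_box_def)
      qed
      then show ?thesis using True by auto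
    qed auto
  qed
  have im: "?t ` strip_link Y (full_turns k) e = strip_link Y (full_turns (k + j)) e" if "e \<le> 1" for e
  proof -
    have "?t ` strip_set (full_turns k) {-4..4} e = ?h ` strip_set (full_turns k) {-4..4} e"
      by (rule image_cong) (auto simp: strip_set_def)
    also have "\<dots> = strip_set (full_turns (k + j)) {-4..4} e"
      unfolding slice_swirl_strip_set[OF that] by (simp add: algebra_simps)
    finally have 1: "?t ` strip_set (full_turns k) {-4..4} e = strip_set (full_turns (k + j)) {-4..4} e" .
    have 2: "?t ` Y e = Y e"
    proof (rule image_eq_self)
      fix p assume "p \<in> Y e"
      then have "p \<notin> tangle_box" using Y[OF that] by blast
      then have "4 < \<bar>fst p\<bar> \<or> ?h p = p"
        using slice_swirl_far[of "fst (snd p)" "snd (snd p)"] by (cases p) (auto simp: tangle_box_def)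
      then show "?t p = p" by auto
    qed
    show ?thesis unfolding strip_link_def image_Un 1 2 ..
  qed
  have "tame (band_image ?t (band_of (strip_link Y (full_turns k))))"
    by (rule tame_cut[OF L bh _ W hW]) (use sub in \<open>auto simp: band_of_def\<close>)
  then show ?thesis
    unfolding band_of_def band_image_def fst_conv snd_conv im[OF zero_le_one] im[OF order_refl] .
qed

lemma stretch_strip_link:
  "stretch ` strip_link Y \<phi> e = strip_set (\<lambda>x. \<phi> (x / 3)) {-12..12} e \<union> stretch ` Y e"
proof -
  have "stretch ` strip_set \<phi> {-4..4} e = {(3 * x, r * cos (\<phi> x), r * sin (\<phi> x)) | x r. x \<in> {-4..4} \<and> \<bar>r\<bar> \<le> e}"
    unfolding strip_set_def
  proof (rule image_Collect2)
    fix x r :: real assume "x \<in> {-4..4} \<and> \<bar>r\<bar> \<le> e"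
    then have "clamp_to 8 (2 * x) = 2 * x" by (auto simp: clamp_to_def)
    then show "stretch (x, r * cos (\<phi> x), r * sin (\<phi> x)) = (3 * x, r * cos (\<phi> x), r * sin (\<phi> x))"
      by (simp add: stretch_def)
  qed
  also have "\<dots> = strip_set (\<lambda>x. \<phi> (x / 3)) {-12..12} e"
  proof -
    have "(\<exists>x r. p = (3 * x, r * cos (\<phi> x), r * sin (\<phi> x)) \<and> x \<in> {-4..4} \<and> \<bar>r\<bar> \<le> e) \<longleftrightarrow>
        (\<exists>x r. p = (x, r * cos (\<phi> (x / 3)), r * sin (\<phi> (x / 3))) \<and> x \<in> {-12..12} \<and> \<bar>r\<bar> \<le> e)" for p
    proof
      assume "\<exists>x r. p = (3 * x, r * cos (\<phi> x), r * sin (\<phi> x)) \<and> x \<in> {-4..4} \<and> \<bar>r\<bar> \<le> e"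
      then obtain x r where "p = (3 * x, r * cos (\<phi> x), r * sin (\<phi> x))" "x \<in> {-4..4}" "\<bar>r\<bar> \<le> e" by blast
      then show "\<exists>x r. p = (x, r * cos (\<phi> (x / 3)), r * sin (\<phi> (x / 3))) \<and> x \<in> {-12..12} \<and> \<bar>r\<bar> \<le> e"
        by (intro exI[of _ "3 * x"] exI[of _ r]) auto
    next
      assume "\<exists>x r. p = (x, r * cos (\<phi> (x / 3)), r * sin (\<phi> (x / 3))) \<and> x \<in> {-12..12} \<and> \<bar>r\<bar> \<le> e"
      then obtain x r where "p = (x, r * cos (\<phi> (x / 3)), r * sin (\<phi> (x / 3)))" "x \<in> {-12..12}" "\<bar>r\<bar> \<le> e" by blast
      then show "\<exists>x r. p = (3 * x, r * cos (\<phi> x), r * sin (\<phi> x)) \<and> x \<in> {-4..4} \<and> \<bar>r\<bar> \<le> e"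
        by (intro exI[of _ "x / 3"] exI[of _ r]) auto
    qed
    then show ?thesis unfolding strip_set_def by blast
  qed
  finally show ?thesis by (simp add: strip_link_def image_Un)
qed

text \<open>The framing relator compares only 0 and 1 turns inside the cube. The strand is therefore
  stretched threefold, its \<open>k\<close> turns are pushed into the left third, where they belong
  to the outside \<open>X\<close>, and the additional turn is made in the cube.\<close>

lemma strip_link_framing:
  assumes Y: "\<And>e. e \<le> 1 \<Longrightarrow> Y e \<inter> tangle_box = {}"
    and L: "tame (band_of (strip_link Y (full_turns k)))"
  shows "skein_class (band_of (strip_link Y (full_turns (k + 1)))) =
    a_pow 1 \<odot> skein_class (band_of (strip_link Y (full_turns k)))"
proof -
  define X where "X e = strip_set (\<lambda>x. full_turns k (x + 8)) ({-12..12} - {-4..4}) e \<union> stretch ` Y e" for e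
  have int: "cos (a + full_turns i x) = cos a" "sin (a + full_turns i x) = sin a" if "3 \<le> \<bar>x\<bar>" for i x a
  proof -
    have "turn x = 0 \<or> turn x = 1" using that turn_left[of x] turn_right[of x] by linarith
    then have "cos (full_turns i x) = 1" "sin (full_turns i x) = 0"
      using cos_int_2pin[of i] sin_int_2pin[of i] by (auto simp: mult.assoc)
    then show "cos (a + full_turns i x) = cos a" "sin (a + full_turns i x) = sin a"
      by (simp_all add: cos_add sin_add)
  qed
  have out: "outside_box (band_of X)"
  proof -
    have "stretch p \<notin> tangle_box" if "p \<notin> tangle_box" for p
    proof -
      obtain x y z where p: "p = (x, y, z)" by (metis prod.collapse)
      have "4 < \<bar>x\<bar> \<Longrightarrow> 4 < \<bar>x + clamp_to 8 (2 * x)\<bar>"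
        by (cases "x < 0") (auto simp: clamp_to_def)
      then show ?thesis using that by (auto simp: p stretch_def tangle_box_def)
    qed
    then have "stretch ` Y e \<inter> tangle_box = {}" if "e \<le> 1" for e using Y[OF that] by blast
    moreover have "strip_set \<phi> ({-12..12} - {-4..4}) e \<inter> tangle_box = {}" for \<phi> e
      unfolding strip_set_def tangle_box_def by auto
    ultimately show ?thesis unfolding outside_box_def band_of_def X_def by (simp add: Int_Un_distrib2)
  qed
  have main: "band_of (strip_link Y (full_turns (k + int j))) \<simeq> band_union (band_of X) (strip j)" for j
  proof -
    let ?\<phi> = "\<lambda>x. full_turns k (x + 8) + full_turns (int j) x"
    have "strip_set (\<lambda>x. full_turns k (x + 8)) ({-12..12} - {-4..4}) e = strip_set ?\<phi> ({-12..12} - {-4..4}) e" for e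
    proof (rule strip_set_cong)
      fix x :: real assume "x \<in> {-12..12} - {-4..4}"
      then have "3 \<le> \<bar>x\<bar>" by auto
      then show "cos (full_turns k (x + 8)) = cos (?\<phi> x) \<and> sin (full_turns k (x + 8)) = sin (?\<phi> x)"
        using int[of x "full_turns k (x + 8)" "int j"] by simp
    qed
    moreover have "strip_set (full_turns (int j)) {-4..4} e = strip_set ?\<phi> {-4..4} e" for e
    proof (rule strip_set_cong)
      fix x :: real assume "x \<in> {-4..4}"
      then show "cos (full_turns (int j) x) = cos (?\<phi> x) \<and> sin (full_turns (int j) x) = sin (?\<phi> x)"
        using int[of "x + 8" "full_turns (int j) x" k] by (simp add: add.commute)
    qed
    moreover have "strip_set ?\<phi> ({-12..12} - {-4..4}) e \<union> strip_set ?\<phi> {-4..4} e = strip_set ?\<phi> {-12..12} e" for e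
    proof -
      have "({-12..12} - {-4..4}) \<union> {-4..4} = {-12..12 :: real}" by auto
      then show ?thesis using strip_set_Un[of ?\<phi> "{-12..12} - {-4..4}" "{-4..4}" e] by simp
    qed
    ultimately have u: "X e \<union> strip_set (full_turns (int j)) {-4..4} e = strip_set ?\<phi> {-12..12} e \<union> stretch ` Y e" for e
      unfolding X_def by blast
    have "stretch ` strip_link Y (\<lambda>x. ?\<phi> (3 * x)) e = strip_set ?\<phi> {-12..12} e \<union> stretch ` Y e" for e
      unfolding stretch_strip_link by simp
    then have "band_of (strip_link Y (\<lambda>x. ?\<phi> (3 * x))) \<simeq> band_union (band_of X) (strip j)"
      unfolding isotopic_bands_def strip_eq
      by (intro exI[of _ stretch] conjI bounded_homeo_stretch)
        (simp only: band_image_def band_union_def band_of_def fst_conv snd_conv u)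
    moreover have "band_of (strip_link Y (full_turns (k + int j))) \<simeq> band_of (strip_link Y (\<lambda>x. ?\<phi> (3 * x)))"
    proof (rule strip_link_isotopic[OF _ _ _ Y])
      fix x :: real assume "4 \<le> \<bar>x\<bar>"
      then consider "x \<le> -4" | "4 \<le> x" by linarith
      then show "full_turns (k + int j) x = full_turns k (3 * x + 8) + full_turns (int j) (3 * x)"
        by cases (simp_all add: turn_left turn_right algebra_simps)
    qed (intro continuous_intros; simp)+
    ultimately show ?thesis by (blast intro: isotopic_bands_trans)
  qed
  have L': "tame (band_of (strip_link Y (full_turns (k + 1))))" by (rule tame_strip_link_step[OF L Y])
  have m0: "band_of (strip_link Y (full_turns k)) \<simeq> band_union (band_of X) (strip 0)" using main[of 0] by simp
  have m1: "band_of (strip_link Y (full_turns (k + 1))) \<simeq> band_union (band_of X) (strip 1)" using main[of 1] by simp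
  show ?thesis
    using skein_class_framing[OF out isotopic_bands_tame[OF m0 L] isotopic_bands_tame[OF m1 L']]
    by (simp only: isotopic_bands_skein_class[OF m0 L] isotopic_bands_skein_class[OF m1 L'])
qed

lemma a_pow_add: "a_pow (i + j) = a_pow i * a_pow j"
  by (simp add: a_pow_def mult_single)

lemma a_pow_0: "a_pow 0 = 1"
  by (simp add: a_pow_def flip: single_one zero_prod_def)

text \<open>Induction over the integers in both directions; going down divides by \<open>a\<close>,
  which is a unit of the ground ring.\<close>

lemma strip_link_full_turns:
  assumes Y: "\<And>e. e \<le> 1 \<Longrightarrow> Y e \<inter> tangle_box = {}"
    and L: "tame (band_of (strip_link Y (\<lambda>x. 0)))"
  shows "tame (band_of (strip_link Y (full_turns k)))"
    "skein_class (band_of (strip_link Y (full_turns k))) = a_pow k \<odot> skein_class (band_of (strip_link Y (\<lambda>x. 0)))"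
proof -
  have L0: "tame (band_of (strip_link Y (full_turns 0)))" using L by simp
  show t: "tame (band_of (strip_link Y (full_turns k)))" for k
    using tame_strip_link_step[OF L0 Y, of k] by simp
  show "skein_class (band_of (strip_link Y (full_turns k))) = a_pow k \<odot> skein_class (band_of (strip_link Y (\<lambda>x. 0)))"
  proof (induction k rule: int_induct[of _ 0])
    case base
    then show ?case by (simp add: a_pow_0 skein_scale_one)
  next
    case (step1 i)
    then show ?case using strip_link_framing[OF Y t[of i]]
      by (simp add: skein_scale_scale add.commute a_pow_add)
  next
    case (step2 i)
    have "a_pow (- 1) * a_pow 1 = 1" using a_pow_add[of "- 1" 1] by (simp add: a_pow_0)
    then have "a_pow (- 1) \<odot> (a_pow 1 \<odot> x) = x" for x
      by (simp add: skein_scale_scale skein_scale_one)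
    then have "skein_class (band_of (strip_link Y (full_turns (i - 1)))) =
        a_pow (- 1) \<odot> skein_class (band_of (strip_link Y (full_turns (i - 1 + 1))))"
      using strip_link_framing[OF Y t[of "i - 1"]] by simp
    then show ?case using step2 a_pow_add[of "- 1" i] by (simp add: skein_scale_scale)
  qed
qed

section \<open>Planar frames\<close>

definition frame_set :: "real \<Rightarrow> real \<Rightarrow> R3 set" where
  "frame_set y0 e = frame_points y0 {3-e..3+e}"

lemma mem_frame_set: "(x, y, z) \<in> frame_set y0 e \<longleftrightarrow> z = 0 \<and> \<bar>max (\<bar>x\<bar> - 3) \<bar>y - y0\<bar> - 3\<bar> \<le> e"
  unfolding frame_set_def mem_frame_points by auto

lemma frame_eq: "frame y0 = band_of (frame_set y0)"
  by (simp add: frame_def frame_set_def band_of_def)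

text \<open>The solid torus on which all others rest. A ray from the origin meets each square
  \<open>max |u| |v| = 3 + r\<close> once, which parametrises a square annulus by the unit circle
  and \<open>r\<close>; \<open>F\<close> pulls the square apart into a rectangle, and the third
  coordinate is the thickness.\<close>

lemma tame_knot_frame: "tame_knot UNIV (band_of (frame_set y0))"
proof -
  \<comment> \<open>Slope \<open>5/2\<close> on \<open>{-2..2}\<close> and translations by 3 beyond,
    so that the vertical sides, at \<open>2 \<le> |u| \<le> 4\<close>, keep their width.
    \<open>G\<close> is the inverse.\<close>
  define F :: "real \<Rightarrow> real" where "F u = u + clamp_to 3 (3 * u / 2)" for u
  define G :: "real \<Rightarrow> real" where "G x = x - clamp_to 3 (3 * x / 5)" for x
  have GF: "G (F u) = u" for u
    by (auto simp: F_def G_def clamp_to_def max_def min_def)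
  have FG: "F (G x) = x" for x
    by (auto simp: F_def G_def clamp_to_def max_def min_def)
  have Fb: "2 \<le> \<bar>u\<bar> \<Longrightarrow> \<bar>F u\<bar> - 3 = \<bar>u\<bar>" "\<bar>u\<bar> < 2 \<Longrightarrow> \<bar>F u\<bar> - 3 < 2" for u
    by (auto simp: F_def clamp_to_def max_def min_def abs_if split: if_splits)
  have lev: "\<bar>max (\<bar>F u\<bar> - 3) \<bar>v\<bar> - 3\<bar> \<le> e \<longleftrightarrow> \<bar>max \<bar>u\<bar> \<bar>v\<bar> - 3\<bar> \<le> e" if "e \<le> 1" for u v e
  proof (cases "2 \<le> \<bar>u\<bar>")
    case False
    then have "\<bar>F u\<bar> - 3 < 2" "\<bar>u\<bar> < 2" using Fb(2)[of u] by auto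
    show ?thesis
    proof (cases "2 \<le> \<bar>v\<bar>")
      case True
      then show ?thesis using \<open>\<bar>F u\<bar> - 3 < 2\<close> \<open>\<bar>u\<bar> < 2\<close> by (simp add: max_absorb2)
    next
      case False
      then have "max (\<bar>F u\<bar> - 3) \<bar>v\<bar> < 2" "max \<bar>u\<bar> \<bar>v\<bar> < 2"
        using \<open>\<bar>F u\<bar> - 3 < 2\<close> \<open>\<bar>u\<bar> < 2\<close> by auto
      then have "\<not> \<bar>max (\<bar>F u\<bar> - 3) \<bar>v\<bar> - 3\<bar> \<le> e" "\<not> \<bar>max \<bar>u\<bar> \<bar>v\<bar> - 3\<bar> \<le> e"
        using that unfolding abs_le_iff by linarith+
      then show ?thesis by blast
    qed
  qed (simp add: Fb(1))
  define m where "m z = max \<bar>Re z\<bar> \<bar>Im z\<bar>" for z :: complex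
  have m0: "0 < m z" if "z \<in> sphere 0 1" for z
  proof (rule ccontr)
    assume "\<not> 0 < m z"
    then have "z = 0" by (auto simp: m_def complex_eq_iff max_def split: if_splits)
    then show False using that by simp
  qed
  define f where "f q = (F ((3 + fst (snd q)) / m (fst q) * Re (fst q)),
      y0 + (3 + fst (snd q)) / m (fst q) * Im (fst q), snd (snd q))" for q :: "complex \<times> real \<times> real"
  have mscale: "max \<bar>t * Re z\<bar> \<bar>t * Im z\<bar> = t * m z" if "0 \<le> t" for t z
    using that by (simp add: m_def abs_mult max_mult_distrib_left)
  have c: "continuous_on solid_torus f"
  proof -
    have cm: "continuous_on solid_torus (\<lambda>q. m (fst q))" unfolding m_def by (intro continuous_intros)
    have "\<forall>q\<in>solid_torus. m (fst q) \<noteq> 0" using m0 by force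
    then show ?thesis unfolding f_def F_def by (intro continuous_intros cm) auto
  qed
  have i: "inj_on f solid_torus"
  proof (rule inj_onI)
    fix q q' assume q: "q \<in> solid_torus" "q' \<in> solid_torus" "f q = f q'"
    obtain z r s z' r' s' where [simp]: "q = (z, r, s)" "q' = (z', r', s')" by (metis prod.collapse)
    have z: "cmod z = 1" "cmod z' = 1" "-1 \<le> r" "-1 \<le> r'" using q by auto
    define t t' where "t = (3 + r) / m z" and "t' = (3 + r') / m z'"
    have mz: "0 < m z" "0 < m z'" using m0 z by auto
    have t: "0 < t" "0 < t'" using mz z by (auto simp: t_def t'_def)
    have Fe: "F (t * Re z) = F (t' * Re z')" and Ie: "t * Im z = t' * Im z'" and "s = s'"
      using q(3) by (auto simp: f_def t_def t'_def)
    have "t * Re z = t' * Re z'" using arg_cong[OF Fe, of G] by (simp only: GF)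
    then have e: "of_real t * z = of_real t' * z'" using Ie by (simp add: complex_eq_iff)
    then have "cmod (of_real t * z) = cmod (of_real t' * z')" by simp
    then have tt: "t = t'" using t z by (simp add: norm_mult)
    then have zz: "z = z'" using e t by simp
    then have "r = r'" using tt mz by (simp add: t_def t'_def)
    then show "q = q'" using zz \<open>s = s'\<close> by simp
  qed
  have im: "frame_set y0 e = f ` (sphere 0 1 \<times> {-e..e} \<times> {0})" if e: "0 \<le> e" "e \<le> 1" for e
  proof (intro equalityI subsetI)
    fix p assume "p \<in> frame_set y0 e"
    then obtain x y where p: "p = (x, y, 0)" and l: "\<bar>max (\<bar>x\<bar> - 3) \<bar>y - y0\<bar> - 3\<bar> \<le> e"
      by (cases p) (auto simp: mem_frame_set)
    define w where "w = Complex (G x) (y - y0)"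
    have "\<bar>max (\<bar>F (G x)\<bar> - 3) \<bar>y - y0\<bar> - 3\<bar> \<le> e" using l by (simp add: FG)
    then have lw: "\<bar>m w - 3\<bar> \<le> e" using lev[OF e(2)] by (simp add: m_def w_def)
    then have mw: "0 < m w" using e by linarith
    then have w0: "w \<noteq> 0" by (auto simp: m_def)
    define z where "z = w / of_real (cmod w)"
    have z: "cmod z = 1" using w0 by (simp add: z_def norm_divide)
    have "m z = m w / cmod w"
      using mscale[of "1 / cmod w" w] by (simp add: m_def z_def)
    then have "(3 + (m w - 3)) / m z = cmod w" using mw w0 by simp
    then have "f (z, m w - 3, 0) = (F (cmod w * Re z), y0 + cmod w * Im z, 0)" by (simp add: f_def)
    also have "cmod w * Re z = G x" using w0 by (simp add: z_def w_def)
    also have "cmod w * Im z = y - y0" using w0 by (simp add: z_def w_def)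
    finally have "f (z, m w - 3, 0) = p" by (simp add: FG p)
    then show "p \<in> f ` (sphere 0 1 \<times> {-e..e} \<times> {0})"
      using z lw by (intro image_eqI[of _ _ "(z, m w - 3, 0)"]) (auto simp: abs_le_iff)
  next
    fix p assume "p \<in> f ` (sphere 0 1 \<times> {-e..e} \<times> {0})"
    then obtain z r where p: "p = f (z, r, 0)" and z: "z \<in> sphere 0 1" and r: "\<bar>r\<bar> \<le> e" by (auto simp: abs_le_iff)
    define t where "t = (3 + r) / m z"
    have t: "0 \<le> t" using m0[OF z] r e by (simp add: t_def)
    have "max \<bar>t * Re z\<bar> \<bar>t * Im z\<bar> = 3 + r" using mscale[OF t] m0[OF z] by (simp add: t_def)
    then have "\<bar>max (\<bar>F (t * Re z)\<bar> - 3) \<bar>t * Im z\<bar> - 3\<bar> \<le> e"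
      unfolding lev[OF e(2)] using r by simp
    then show "p \<in> frame_set y0 e" by (simp add: p f_def mem_frame_set flip: t_def)
  qed
  show ?thesis unfolding tame_knot_def
    by (rule exI[of _ f]) (use c i im[of 0] im[of 1] in \<open>simp add: band_of_def\<close>)
qed

lemma tame_frame: "tame (band_of (frame_set y0))"
  unfolding tame_link_def
  by (rule exI[of _ "{band_of (frame_set y0)}"]) (simp add: tame_knot_frame)

lemma tame_two_frames: "tame (band_of (\<lambda>e. frame_set 0 e \<union> frame_set 10 e))"
  unfolding tame_link_def
proof (rule exI[of _ "{band_of (frame_set 0), band_of (frame_set 10)}"], intro conjI)
  have "disjnt (frame_set 0 1) (frame_set 10 1)"
    unfolding disjnt_def by (auto simp: mem_frame_set max_def abs_if split: if_splits)
  then show "pairwise (\<lambda>K K'. disjnt (snd K) (snd K')) {band_of (frame_set 0), band_of (frame_set 10)}"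
    by (auto simp: pairwise_insert band_of_def disjnt_sym)
qed (use tame_knot_frame in \<open>auto simp: band_of_def\<close>)

lemma t_power_1: "t_power 1 = skein_class (band_of (frame_set 0))"
  by (simp add: t_power_def trivial_link_def skein_class_def frame_eq band_of_def lessThan_Suc)

lemma t_power_2: "t_power 2 = skein_class (band_of (\<lambda>e. frame_set 0 e \<union> frame_set 10 e))"
  by (simp add: t_power_def trivial_link_def skein_class_def frame_eq band_of_def lessThan_Suc numeral_2_eq_2 Un_commute)

lemma closed_twist_0_isotopic:
  "band_of (\<lambda>e. frame_set 0 e \<union> frame_set 10 e) \<simeq> band_of (closed_twist 4 (half_turns 0))"
proof -
  let ?h = "\<lambda>p :: R3. (fst p, fst (snd p) - 5, snd (snd p))"
  have bh: "bounded_homeo ?h"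
    by (rule bounded_homeo_fiber_y[where f = "\<lambda>x y z. y - 5" and B = 5]) (auto intro!: continuous_intros)
  show ?thesis
  proof (rule isotopic_band_ofI[OF bh], rule bounded_homeo_image_eqI[OF bh])
    fix e :: real and p :: R3 assume e: "0 \<le> e" "e \<le> 1"
    obtain x y z where p: "p = (x, y, z)" by (metis prod.collapse)
    have tw: "(x, y - 5, z) \<in> twist (half_turns 0) {-4..4} e \<longleftrightarrow> \<bar>x\<bar> \<le> 4 \<and> z = 0 \<and> (\<bar>y - 5 - 2\<bar> \<le> e \<or> \<bar>y - 5 + 2\<bar> \<le> e)"
      unfolding mem_twist by (auto simp: abs_le_iff)
    show "?h p \<in> closed_twist 4 (half_turns 0) e \<longleftrightarrow> p \<in> frame_set 0 e \<union> frame_set 10 e"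
      unfolding p closed_twist_def Un_iff fst_conv snd_conv tw mem_outer mem_frame_set
      using e by (auto simp: max_def abs_if split: if_splits)
  qed
qed

section \<open>Sliding twists around a cap\<close>

text \<open>The U-shaped curve \<open>max (x - x0) \<bar>y\<bar> = 2\<close> consists of two legs and a cap. The map below rotates
  the normal discs of this curve by an angle that is constant on the cap and, on the legs, depends
  only on the first coordinate. In the coordinates \<open>(max (x - x0) \<bar>y\<bar> - 2, z)\<close> of the normal disc it
  is a swirl.\<close>

definition u_level :: "real \<Rightarrow> R3 \<Rightarrow> real" where
  "u_level x0 p = max (fst p - x0) \<bar>fst (snd p)\<bar>"

definition u_disc :: "real \<Rightarrow> R3 \<Rightarrow> complex" where
  "u_disc x0 p = Complex (u_level x0 p - 2) (snd (snd p))"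

text \<open>For \<open>l > 0\<close> the level is multiplied by \<open>l\<close>: radially from
  \<open>(x0, 0)\<close> beyond \<open>x0\<close>, in the second coordinate alone before it. The
  value \<open>min x x0\<close>, which determines the rotation angle, is not changed.\<close>

definition u_scale :: "real \<Rightarrow> real \<Rightarrow> R3 \<Rightarrow> R3" where
  "u_scale x0 l p = (x0 + l * max (fst p - x0) 0 + min (fst p - x0) 0, l * fst (snd p), snd (snd p))"

definition u_image :: "real \<Rightarrow> (real \<Rightarrow> real) \<Rightarrow> R3 \<Rightarrow> complex" where
  "u_image x0 A p = swirl (5/4) (3/2) (A (min (fst p) x0)) (u_disc x0 p)"

text \<open>The scaling factor is the new level \<open>2 + Re w\<close> divided by the old one.
  Writing it with \<open>max (u_level x0 p) (1/2)\<close> avoids a division by zero; at levels up to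
  \<open>1/2\<close> the swirl is trivial and the factor is 1.\<close>

definition u_rotate :: "real \<Rightarrow> (real \<Rightarrow> real) \<Rightarrow> R3 \<Rightarrow> R3" where
  "u_rotate x0 A p = (let w = u_image x0 A p;
       q = u_scale x0 (1 + (Re w - Re (u_disc x0 p)) / max (u_level x0 p) (1/2)) p
     in (fst q, fst (snd q), Im w))"

lemma u_image_far:
  assumes "3/2 \<le> cmod (u_disc x0 p)"
  shows "u_image x0 A p = u_disc x0 p"
  using assms by (simp add: u_image_def swirl_outer)

lemma u_far_low: "u_level x0 p \<le> 1/2 \<Longrightarrow> 3/2 \<le> cmod (u_disc x0 p)"
  using abs_Re_le_cmod[of "u_disc x0 p"] by (simp add: u_disc_def)

lemma u_image_Re_pos: "1/2 \<le> u_level x0 p \<Longrightarrow> 1/2 \<le> 2 + Re (u_image x0 A p)"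
proof (cases "3/2 \<le> cmod (u_disc x0 p)")
  case False
  then show ?thesis using abs_Re_le_cmod[of "u_image x0 A p"] by (simp add: u_image_def)
qed (simp add: u_image_far u_disc_def)

lemma u_rotate_eq:
  "u_rotate x0 A p = (let w = u_image x0 A p; l = (if u_level x0 p \<le> 1/2 then 1 else (2 + Re w) / u_level x0 p)
     in (x0 + l * max (fst p - x0) 0 + min (fst p - x0) 0, l * fst (snd p), Im w))"
proof (cases "u_level x0 p \<le> 1/2")
  case True
  then show ?thesis
    using u_image_far[OF u_far_low[OF True], of A] by (simp add: u_rotate_def u_scale_def)
next
  case False
  then have "1 + (Re (u_image x0 A p) - Re (u_disc x0 p)) / max (u_level x0 p) (1/2) = (2 + Re (u_image x0 A p)) / u_level x0 p"
    by (simp add: u_disc_def divide_simps)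
  then show ?thesis using False by (simp add: u_rotate_def u_scale_def)
qed

lemma u_rotate_far:
  assumes "3/2 \<le> cmod (u_disc x0 p)"
  shows "u_rotate x0 A p = p"
  using u_image_far[OF assms, of A]
  by (cases p) (auto simp: u_rotate_def u_scale_def u_disc_def max_def min_def)

lemma u_rotate_zero:
  assumes "A (min (fst p) x0) = 0"
  shows "u_rotate x0 A p = p"
proof -
  have "u_image x0 A p = u_disc x0 p" using assms by (simp add: u_image_def)
  then show ?thesis by (cases p) (auto simp: u_rotate_def u_scale_def u_disc_def max_def min_def)
qed

text \<open>These two quantities conjugate the map to a swirl with a parameter; injectivity and the
  image of the cap are read off from them.\<close>

lemma u_rotate_invariants:
  shows "min (fst (u_rotate x0 A p)) x0 = min (fst p) x0"
    and "u_disc x0 (u_rotate x0 A p) = u_image x0 A p"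
proof -
  define w where "w = u_image x0 A p"
  define l where "l = (if u_level x0 p \<le> 1/2 then 1 else (2 + Re w) / u_level x0 p)"
  have l: "0 < l" using u_image_Re_pos[of x0 p A] by (auto simp: l_def w_def)
  have q: "u_rotate x0 A p = (x0 + l * max (fst p - x0) 0 + min (fst p - x0) 0, l * fst (snd p), Im w)"
    unfolding u_rotate_eq Let_def l_def w_def by (rule refl)
  show "min (fst (u_rotate x0 A p)) x0 = min (fst p) x0"
  proof (cases "fst p \<le> x0")
    case False
    then have "0 < l * (fst p - x0)" using l by simp
    then show ?thesis using False by (simp add: q)
  qed (simp add: q)
  have lev: "u_level x0 (u_rotate x0 A p) = l * u_level x0 p"
  proof (cases "x0 \<le> fst p")
    case True
    then show ?thesis using l by (simp add: q u_level_def max_mult_distrib_left abs_mult)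
  next
    case False
    then have *: "fst p - x0 \<le> \<bar>v\<bar>" for v :: real using abs_ge_zero[of v] by linarith
    from *[of "l * fst (snd p)"] *[of "fst (snd p)"] show ?thesis
      using l False by (simp add: q u_level_def abs_mult max_absorb2)
  qed
  have "l * u_level x0 p - 2 = Re w"
  proof (cases "u_level x0 p \<le> 1/2")
    case True
    then show ?thesis using u_image_far[OF u_far_low[OF True], of A] by (simp add: l_def w_def u_disc_def)
  next
    case False
    then have "u_level x0 p \<noteq> 0" by auto
    then show ?thesis using False by (simp add: l_def)
  qed
  then show "u_disc x0 (u_rotate x0 A p) = u_image x0 A p"
    unfolding u_disc_def lev by (simp add: q w_def complex_eq_iff)
qed

lemma bounded_homeo_u_rotate:
  assumes A: "continuous_on UNIV A"
  shows "bounded_homeo (u_rotate x0 A)"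
proof (rule bounded_homeoI)
  have cl: "continuous_on UNIV (u_level x0)"
    unfolding u_level_def by (intro continuous_intros)
  have cd: "continuous_on UNIV (u_disc x0)"
    unfolding u_disc_def Complex_eq by (intro continuous_intros cl)
  have "continuous_on UNIV (\<lambda>p :: R3. A (min (fst p) x0))"
    by (rule continuous_on_compose2[OF A]) (intro continuous_intros, simp)
  then have ci: "continuous_on UNIV (u_image x0 A)"
    unfolding u_image_def by (intro continuous_intros cd)
  have "max (u_level x0 p) (1/2) \<noteq> 0" for p by (simp add: max_def)
  then show "continuous_on UNIV (u_rotate x0 A)"
    unfolding u_rotate_def u_scale_def Let_def fst_conv snd_conv
    by (intro continuous_intros cl cd ci) auto
next
  fix p q assume e: "u_rotate x0 A p = u_rotate x0 A q"
  have m: "min (fst p) x0 = min (fst q) x0" using e u_rotate_invariants(1) by metis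
  have i: "u_image x0 A p = u_image x0 A q" using e u_rotate_invariants(2) by metis
  then have d: "u_disc x0 p = u_disc x0 q"
    using m swirl_inj unfolding u_image_def by metis
  then have lev: "u_level x0 p = u_level x0 q" and z: "snd (snd p) = snd (snd q)"
    by (simp_all add: u_disc_def)
  define l where "l = (if u_level x0 p \<le> 1/2 then 1 else (2 + Re (u_image x0 A p)) / u_level x0 p)"
  have l: "l \<noteq> 0" using u_image_Re_pos[of x0 p A] by (auto simp: l_def)
  have "l * max (fst p - x0) 0 + min (fst p - x0) 0 = l * max (fst q - x0) 0 + min (fst q - x0) 0"
    and y: "fst (snd p) = fst (snd q)"
    using e l unfolding u_rotate_eq Let_def lev[symmetric] i[symmetric] l_def[symmetric] by auto
  moreover have mm: "min (fst p - x0) 0 = min (fst q - x0) 0" using m by (auto simp: min_def split: if_splits)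
  ultimately have "max (fst p - x0) 0 = max (fst q - x0) 0" using l by simp
  then have "fst p = fst q" using mm by (auto simp: min_def max_def split: if_splits)
  then show "p = q" using y z by (simp add: prod_eq_iff)
next
  fix p
  define w where "w = u_image x0 A p"
  define d where "d = (Re w - Re (u_disc x0 p)) / max (u_level x0 p) (1/2)"
  have q: "u_rotate x0 A p = (fst p + d * max (fst p - x0) 0, fst (snd p) + d * fst (snd p), Im w)"
    unfolding u_rotate_def u_scale_def Let_def d_def w_def
    by (auto simp: max_def min_def algebra_simps)
  have wd: "dist w (u_disc x0 p) \<le> 3"
    using swirl_bound[of "5/4" "3/2"] by (simp add: w_def u_image_def)
  \<comment> \<open>The displacements in \<open>x\<close> and \<open>y\<close> are \<open>d\<close>
    times quantities bounded by the level, and \<open>d\<close> times the level is bounded by the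
    change of the disc coordinate, which is at most \<open>2 * (3/2)\<close>.\<close>
  have dl: "\<bar>d\<bar> * u_level x0 p \<le> 3"
  proof -
    have "\<bar>d\<bar> * u_level x0 p \<le> \<bar>d\<bar> * max (u_level x0 p) (1/2)"
      by (intro mult_left_mono) auto
    also have "\<dots> = \<bar>Re (w - u_disc x0 p)\<bar>" by (simp add: d_def abs_mult max_def)
    also have "\<dots> \<le> cmod (w - u_disc x0 p)" by (rule abs_Re_le_cmod)
    finally show ?thesis using wd by (simp add: dist_norm)
  qed
  have "\<bar>d * max (fst p - x0) 0\<bar> \<le> \<bar>d\<bar> * u_level x0 p" "\<bar>d * fst (snd p)\<bar> \<le> \<bar>d\<bar> * u_level x0 p"
    unfolding abs_mult by (intro mult_left_mono; simp add: u_level_def)+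
  moreover have "\<bar>Im w - snd (snd p)\<bar> \<le> 3"
    using abs_Im_le_cmod[of "w - u_disc x0 p"] wd by (simp add: dist_norm u_disc_def)
  ultimately show "dist (u_rotate x0 A p) p \<le> 9"
    using dl dist_triple_le[of "fst p + d * max (fst p - x0) 0" "fst (snd p) + d * fst (snd p)" "Im w" "fst p" "fst (snd p)" "snd (snd p)"]
    unfolding q by (simp add: dist_real_def)
qed

definition twisted_legs :: "(real \<Rightarrow> real) \<Rightarrow> (real \<Rightarrow> real) \<Rightarrow> real set \<Rightarrow> real \<Rightarrow> R3 set" where
  "twisted_legs \<phi> \<psi> I e = {(x, 2 + r * cos (\<phi> x), r * sin (\<phi> x)) | x r. x \<in> I \<and> \<bar>r\<bar> \<le> e}
     \<union> {(x, - 2 + r * cos (\<psi> x), r * sin (\<psi> x)) | x r. x \<in> I \<and> \<bar>r\<bar> \<le> e}"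

text \<open>The outward normal of the curve is \<open>+y\<close> on the upper leg and
  \<open>-y\<close> on the lower one, so one and the same rotation of the normal discs adds
  \<open>A\<close> to the angle of the upper ribbon and subtracts it from that of the lower. This is
  how a twist passes around the cap.\<close>

lemma u_rotate_legs:
  assumes e: "e \<le> 1" and I: "\<And>x. x \<in> I \<Longrightarrow> x \<le> x0"
  shows "u_rotate x0 A ` twisted_legs \<phi> \<psi> I e = twisted_legs (\<lambda>x. \<phi> x + A x) (\<lambda>x. \<psi> x - A x) I e"
proof -
  have up: "u_rotate x0 A (x, 2 + r * cos (\<phi> x), r * sin (\<phi> x)) =
      (x, 2 + r * cos (\<phi> x + A x), r * sin (\<phi> x + A x))" if r: "x \<in> I \<and> \<bar>r\<bar> \<le> e" for x r
  proof -
    let ?p = "(x, 2 + r * cos (\<phi> x), r * sin (\<phi> x))"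
    have x: "x \<le> x0" using r I by blast
    have b: "\<bar>r * cos t\<bar> \<le> 1" for t
      using r e mult_mono[of "\<bar>r\<bar>" 1 "\<bar>cos t\<bar>" 1] by (simp add: abs_mult)
    have lev: "u_level x0 ?p = 2 + r * cos (\<phi> x)" using x b[of "\<phi> x"] by (simp add: u_level_def)
    have "u_disc x0 ?p = r * cis (\<phi> x)" unfolding u_disc_def lev by (simp add: complex_eq_iff)
    moreover have "cmod (r * cis (\<phi> x)) \<le> 5/4" using r e by (simp add: norm_mult)
    ultimately have im: "u_image x0 A ?p = r * cis (\<phi> x + A x)"
      using x by (simp add: u_image_def swirl_inner mult.assoc cis_mult min_absorb1)
    have "\<not> 2 + r * cos (\<phi> x) \<le> 1/2" "2 + r * cos (\<phi> x) \<noteq> 0" using b[of "\<phi> x"] by auto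
    then show ?thesis using x unfolding u_rotate_eq Let_def im lev by (simp add: min_def max_def)
  qed
  have dn: "u_rotate x0 A (x, - 2 + r * cos (\<psi> x), r * sin (\<psi> x)) =
      (x, - 2 + r * cos (\<psi> x - A x), r * sin (\<psi> x - A x))" if r: "x \<in> I \<and> \<bar>r\<bar> \<le> e" for x r
  proof -
    let ?p = "(x, - 2 + r * cos (\<psi> x), r * sin (\<psi> x))"
    have x: "x \<le> x0" using r I by blast
    have b: "\<bar>r * cos t\<bar> \<le> 1" for t
      using r e mult_mono[of "\<bar>r\<bar>" 1 "\<bar>cos t\<bar>" 1] by (simp add: abs_mult)
    have lev: "u_level x0 ?p = 2 - r * cos (\<psi> x)" using x b[of "\<psi> x"] by (simp add: u_level_def)
    have "u_disc x0 ?p = - r * cis (- \<psi> x)" unfolding u_disc_def lev by (simp add: complex_eq_iff)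
    moreover have "cmod (- r * cis (- \<psi> x)) \<le> 5/4" using r e by (simp add: norm_mult)
    ultimately have im: "u_image x0 A ?p = - r * cis (A x - \<psi> x)"
      using x by (simp add: u_image_def swirl_inner mult.assoc cis_mult min_absorb1)
    have n: "\<not> 2 - r * cos (\<psi> x) \<le> 1/2" "2 - r * cos (\<psi> x) \<noteq> 0" using b[of "\<psi> x"] by auto
    have c: "cos (A x - \<psi> x) = cos (\<psi> x - A x)" "sin (A x - \<psi> x) = - sin (\<psi> x - A x)"
      using cos_minus[of "\<psi> x - A x"] sin_minus[of "\<psi> x - A x"] by simp_all
    have "(2 + Re (- r * cis (A x - \<psi> x))) / (2 - r * cos (\<psi> x)) * (- 2 + r * cos (\<psi> x)) = - 2 + r * cos (\<psi> x - A x)"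
      using n(2) by (simp add: c divide_simps) (simp add: algebra_simps)
    then show ?thesis using x n(1) unfolding u_rotate_eq Let_def im lev by (simp add: min_def max_def c)
  qed
  show ?thesis unfolding twisted_legs_def image_Un
    by (intro arg_cong2[where f = "(\<union>)"] image_Collect2) (use up dn in blast)+
qed

definition cap :: "real \<Rightarrow> real \<Rightarrow> real \<Rightarrow> R3 set" where
  "cap x0 x1 e = {p. x1 \<le> fst p \<and> snd (snd p) = 0 \<and> \<bar>u_level x0 p - 2\<bar> \<le> e}"

text \<open>On the cap the normal discs turn by a multiple of \<open>pi\<close>, that is, by a sign,
  and the cross section of the flat band is symmetric. Outside radius \<open>5/4\<close> the
  modulus, which is preserved, excludes points of the band.\<close>

lemma u_rotate_cap:
  assumes A: "continuous_on UNIV A" "\<And>x. x1 \<le> x \<Longrightarrow> A x = of_int n * pi" and x: "x1 \<le> x0" and e: "e \<le> 1"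
  shows "u_rotate x0 A ` cap x0 x1 e = cap x0 x1 e"
proof (rule bounded_homeo_image_eqI[OF bounded_homeo_u_rotate[OF A(1)]])
  fix p
  let ?q = "u_rotate x0 A p"
  have c: "q \<in> cap x0 x1 e \<longleftrightarrow> x1 \<le> min (fst q) x0 \<and> Im (u_disc x0 q) = 0 \<and> \<bar>Re (u_disc x0 q)\<bar> \<le> e" for q
    using x by (auto simp: cap_def u_disc_def)
  have "Im (u_image x0 A p) = 0 \<and> \<bar>Re (u_image x0 A p)\<bar> \<le> e \<longleftrightarrow> Im (u_disc x0 p) = 0 \<and> \<bar>Re (u_disc x0 p)\<bar> \<le> e"
    if "x1 \<le> min (fst p) x0"
  proof (cases "cmod (u_disc x0 p) \<le> 5/4")
    case True
    obtain s where s: "s \<in> {-1, 1}" "cos (of_int n * pi) = s" "sin (of_int n * pi) = 0"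
      using cos_sin_add_int_pi[of 0 n] by auto
    have "u_image x0 A p = u_disc x0 p * cis (of_int n * pi)"
      using True A(2)[OF that] by (simp add: u_image_def swirl_inner)
    also have "cis (of_int n * pi) = of_real s" using s by (simp add: complex_eq_iff)
    finally show ?thesis using s(1) by auto
  next
    case False
    have *: "\<not> (Im v = 0 \<and> \<bar>Re v\<bar> \<le> e)" if "cmod v = cmod (u_disc x0 p)" for v
      using False that e cmod_le[of v] by auto
    have "cmod (u_image x0 A p) = cmod (u_disc x0 p)" by (simp add: u_image_def)
    then show ?thesis using *[of "u_disc x0 p"] *[of "u_image x0 A p"] by blast
  qed
  then show "?q \<in> cap x0 x1 e \<longleftrightarrow> p \<in> cap x0 x1 e"
    unfolding c[of ?q] c[of p] u_rotate_invariants by blast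
qed

section \<open>Planar normal forms\<close>

lemma clamp_to_high: "0 \<le> b \<Longrightarrow> b \<le> x \<Longrightarrow> clamp_to b x = b"
  and clamp_to_low: "0 \<le> b \<Longrightarrow> x \<le> - b \<Longrightarrow> clamp_to b x = - b"
  and clamp_to_mid: "\<bar>x\<bar> \<le> b \<Longrightarrow> clamp_to b x = x"
  by (auto simp: clamp_to_def)

lemma clamp_to_abs_le: "0 \<le> b \<Longrightarrow> \<bar>clamp_to b x\<bar> \<le> b"
  by (auto simp: clamp_to_def)

lemma clamp_to_mono: "x \<le> y \<Longrightarrow> clamp_to b x \<le> clamp_to b y"
  by (auto simp: clamp_to_def)

lemma clamp_to_lipschitz: "x \<le> y \<Longrightarrow> clamp_to b y - clamp_to b x \<le> y - x"
  by (auto simp: clamp_to_def)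

lemma clamp_to_minus: "0 \<le> b \<Longrightarrow> clamp_to b (- x) = - clamp_to b x"
  by (auto simp: clamp_to_def)

lemma abs_odd:
  fixes f :: "real \<Rightarrow> real"
  assumes "\<And>x. f (- x) = - f x" "\<And>x. 0 \<le> x \<Longrightarrow> 0 \<le> f x"
  shows "\<bar>f x\<bar> = f \<bar>x\<bar>"
proof (cases "0 \<le> x")
  case True
  then show ?thesis using assms(2)[OF True] by simp
next
  case False
  then have "0 \<le> f (- x)" by (intro assms(2)) simp
  then show ?thesis using False assms(1)[of x] by simp
qed

subsection \<open>Lifting horizontal legs\<close>

text \<open>The legs lie at heights in \<open>{1..3}\<close> and are lifted by \<open>c\<close>; what lies above \<open>7\<close> is lifted by \<open>T\<close> to
  make room.\<close>

definition lift :: "real \<Rightarrow> real \<Rightarrow> real \<Rightarrow> real" where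
  "lift T c y = y + c * clamp_to 1 y + (T - c) * clamp_to 1 ((y - clamp_to 3 y) / 4)"

text \<open>The slope is \<open>1 + c\<close> on \<open>{-1..1}\<close>,
  \<open>1 + (T - c) / 4\<close> for \<open>3 \<le> |y| \<le> 7\<close> and 1 elsewhere;
  \<open>c < T + 4\<close> makes it positive.\<close>

lemma lift_strict_mono:
  assumes "0 \<le> c" "c < T + 4" "y < y'"
  shows "lift T c y < lift T c y'"
proof -
  define s s' where "s = y - clamp_to 3 y" and "s' = y' - clamp_to 3 y'"
  define k where "k = clamp_to 1 (s' / 4) - clamp_to 1 (s / 4)"
  have s: "s \<le> s'" using clamp_to_lipschitz[of y y' 3] assms(3) by (simp add: s_def s'_def)
  have k: "0 \<le> k" "k \<le> (s' - s) / 4"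
    using clamp_to_mono[of "s / 4" "s' / 4" 1] clamp_to_lipschitz[of "s / 4" "s' / 4" 1] s
    by (simp_all add: k_def diff_divide_distrib)
  have 1: "c * clamp_to 1 y \<le> c * clamp_to 1 y'"
    using assms by (intro mult_left_mono clamp_to_mono) auto
  have 2: "clamp_to 3 y \<le> clamp_to 3 y'" using assms by (intro clamp_to_mono) auto
  have e: "lift T c y' - lift T c y = (clamp_to 3 y' - clamp_to 3 y) + (c * clamp_to 1 y' - c * clamp_to 1 y) + (s' - s) + (T - c) * k"
    by (simp add: lift_def s_def s'_def k_def algebra_simps)
  show ?thesis
  proof (cases "s = s'")
    case True
    then have "k = 0" by (simp add: k_def)
    moreover have "clamp_to 3 y < clamp_to 3 y'" using True assms(3) by (simp add: s_def s'_def)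
    ultimately show ?thesis using e 1 True by simp
  next
    case False
    have "0 < (s' - s) + (T - c) * k"
    proof (cases "0 \<le> T - c")
      case True
      then have "0 \<le> (T - c) * k" using k by simp
      then show ?thesis using False s by simp
    next
      case neg: False
      then have "(T - c) * ((s' - s) / 4) \<le> (T - c) * k" using k(2) by (intro mult_left_mono_neg) auto
      moreover have "(s' - s) + (T - c) * ((s' - s) / 4) = (s' - s) * ((T + 4 - c) / 4)" by (simp add: field_simps)
      moreover have "0 < (s' - s) * ((T + 4 - c) / 4)" using False s assms by (intro mult_pos_pos) auto
      ultimately show ?thesis by linarith
    qed
    then show ?thesis using e 1 2 by linarith
  qed
qed

lemma lift_abs:
  assumes "0 \<le> c" "c < T + 4"
  shows "\<bar>lift T c y\<bar> = lift T c \<bar>y\<bar>"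
proof (rule abs_odd)
  show "lift T c (- y) = - lift T c y" for y
  proof -
    have "(- y - clamp_to 3 (- y)) / 4 = - ((y - clamp_to 3 y) / 4)"
    proof -
      have "- y - clamp_to 3 (- y) = - (y - clamp_to 3 y)" by (simp add: clamp_to_minus)
      then show ?thesis by (simp only: minus_divide_left)
    qed
    then have "clamp_to 1 ((- y - clamp_to 3 (- y)) / 4) = - clamp_to 1 ((y - clamp_to 3 y) / 4)"
      by (simp only: clamp_to_minus[OF zero_le_one])
    then show ?thesis by (simp add: lift_def clamp_to_minus)
  qed
  have "lift T c 0 = 0" by (simp add: lift_def clamp_to_mid)
  then show "0 \<le> lift T c y" if "0 \<le> y" for y
    using lift_strict_mono[OF assms, of 0 y] that by (cases "y = 0") auto
qed

lemma lift_values: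
  assumes "0 \<le> c" "c < T + 4" "0 \<le> y"
  shows "y < 1 \<Longrightarrow> lift T c y < 1 + c" "y \<le> 3 \<Longrightarrow> 1 \<le> y \<Longrightarrow> lift T c y = y + c"
    "3 < y \<Longrightarrow> y < 7 \<Longrightarrow> 3 + c < lift T c y \<and> lift T c y < 7 + T" "7 \<le> y \<Longrightarrow> lift T c y = y + T"
    "0 \<le> lift T c y" "c = 0 \<Longrightarrow> y \<le> 3 \<Longrightarrow> lift T c y = y"
proof -
  have eq: "lift T c y = y + c" if "y \<le> 3" "1 \<le> y" for y
    using that by (simp add: lift_def clamp_to_mid clamp_to_high)
  have eq7: "lift T c y = y + T" if "7 \<le> y" for y
    using that by (simp add: lift_def clamp_to_high)
  show "y < 1 \<Longrightarrow> lift T c y < 1 + c" using lift_strict_mono[OF assms(1,2), of y 1] eq[of 1] by simp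
  show "3 < y \<Longrightarrow> y < 7 \<Longrightarrow> 3 + c < lift T c y \<and> lift T c y < 7 + T"
    using lift_strict_mono[OF assms(1,2), of 3 y] lift_strict_mono[OF assms(1,2), of y 7] eq[of 3] eq7[of 7] by simp
  show "0 \<le> lift T c y" using lift_abs[OF assms(1,2), of y] assms(3) by (metis abs_ge_zero abs_of_nonneg)
  show "c = 0 \<Longrightarrow> y \<le> 3 \<Longrightarrow> lift T c y = y" using assms(3) by (simp add: lift_def clamp_to_mid)
qed (use assms in \<open>simp_all add: lift_def clamp_to_mid clamp_to_high\<close>)

text \<open>Lifting by an amount that grows with \<open>|x|\<close> makes a horizontal leg slanted,
  hence a graph over the second coordinate, which \<open>shrink_map\<close> can straighten.\<close>

definition lift_map :: "real \<Rightarrow> (real \<Rightarrow> real) \<Rightarrow> R3 \<Rightarrow> R3" where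
  "lift_map T c p = (fst p, lift T (c (fst p)) (fst (snd p)), snd (snd p))"

lemma bounded_homeo_lift_map:
  assumes c: "continuous_on UNIV c" "\<And>x. 0 \<le> c x" "\<And>x. c x \<le> T + 3" and T: "0 \<le> T"
  shows "bounded_homeo (lift_map T c)"
  unfolding lift_map_def
proof (rule bounded_homeo_fiber_y[where f = "\<lambda>x y z. lift T (c x) y" and B = "3 * T + 6"])
  have "continuous_on UNIV (\<lambda>p :: R3. c (fst p))"
    by (rule continuous_on_compose2[OF c(1)]) (auto intro: continuous_intros)
  then show "continuous_on UNIV (\<lambda>p :: R3. lift T (c (fst p)) (fst (snd p)))"
    unfolding lift_def by (intro continuous_intros) auto
  show "y = y'" if "lift T (c x) y = lift T (c x) y'" for x y y' z
    using lift_strict_mono[OF c(2), of x T y y'] lift_strict_mono[OF c(2), of x T y' y] c(3)[of x] that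
    by (cases y y' rule: linorder_cases) auto
  show "\<bar>lift T (c x) y - y\<bar> \<le> 3 * T + 6" for x y z
  proof -
    have "\<bar>c x * clamp_to 1 y\<bar> \<le> (T + 3) * 1"
      unfolding abs_mult using c(2,3)[of x] T clamp_to_abs_le[of 1 y] by (intro mult_mono) auto
    moreover have "\<bar>(T - c x) * clamp_to 1 ((y - clamp_to 3 y) / 4)\<bar> \<le> (T + 3) * 1"
      unfolding abs_mult using c(2,3)[of x] T clamp_to_abs_le[of 1 "(y - clamp_to 3 y) / 4"] by (intro mult_mono) auto
    moreover have "lift T (c x) y - y = c x * clamp_to 1 y + (T - c x) * clamp_to 1 ((y - clamp_to 3 y) / 4)"
      by (simp add: lift_def)
    ultimately show ?thesis
      using T abs_triangle_ineq[of "c x * clamp_to 1 y" "(T - c x) * clamp_to 1 ((y - clamp_to 3 y) / 4)"] by simp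
  qed
qed

subsection \<open>Straightening curves that are graphs over the second coordinate\<close>

text \<open>For \<open>c \<ge> 0\<close> this compresses \<open>{-1 - c..1 + c}\<close> linearly to
  \<open>{-1..1}\<close> and translates by \<open>c\<close> towards 0 beyond.\<close>

definition shrink :: "real \<Rightarrow> real \<Rightarrow> real" where
  "shrink c x = x - clamp_to c (c * x / (1 + c))"

lemma shrink_high: "0 \<le> c \<Longrightarrow> 1 + c \<le> x \<Longrightarrow> shrink c x = x - c"
  using mult_left_mono[of "1 + c" x c] by (simp add: shrink_def clamp_to_high pos_le_divide_eq mult.commute)

lemma shrink_low: "0 \<le> c \<Longrightarrow> \<bar>x\<bar> \<le> 1 + c \<Longrightarrow> shrink c x = x / (1 + c)"
proof -
  assume c: "0 \<le> c" "\<bar>x\<bar> \<le> 1 + c"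
  have "\<bar>c * x / (1 + c)\<bar> = c * (\<bar>x\<bar> / (1 + c))" using c by (simp add: abs_mult)
  also have "\<dots> \<le> c * 1" using c by (intro mult_left_mono) auto
  finally have "clamp_to c (c * x / (1 + c)) = c * x / (1 + c)" by (intro clamp_to_mid) simp
  then show ?thesis using c by (simp add: shrink_def field_simps)
qed

lemma shrink_abs: "0 \<le> c \<Longrightarrow> \<bar>shrink c x\<bar> = shrink c \<bar>x\<bar>"
proof (rule abs_odd)
  assume c: "0 \<le> c"
  show "shrink c (- x) = - shrink c x" for x
    using clamp_to_minus[OF c, of "c * x / (1 + c)"] by (simp add: shrink_def)
  show "0 \<le> shrink c x" if "0 \<le> x" for x
    using that c by (cases "x \<le> 1 + c") (simp_all add: shrink_low shrink_high)
qed

lemma shrink_strict_mono: "0 \<le> c \<Longrightarrow> x < y \<Longrightarrow> shrink c x < shrink c y"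
proof -
  assume c: "0 \<le> c" and xy: "x < y"
  have "clamp_to c (c * y / (1 + c)) - clamp_to c (c * x / (1 + c)) \<le> c * y / (1 + c) - c * x / (1 + c)"
    using c xy by (intro clamp_to_lipschitz divide_right_mono mult_left_mono) auto
  also have "\<dots> = c / (1 + c) * (y - x)" unfolding diff_divide_distrib[symmetric] right_diff_distrib[symmetric] by simp
  also have "\<dots> < 1 * (y - x)" using c xy by (intro mult_strict_right_mono) auto
  finally show ?thesis by (simp add: shrink_def)
qed

lemma shrink_values:
  assumes "0 \<le> c" "0 \<le> x"
  shows "1 + c \<le> x \<Longrightarrow> shrink c x = x - c" "x < 1 + c \<Longrightarrow> shrink c x < 1"
  using assms by (simp_all add: shrink_high shrink_low)

lemma continuous_on_shrink:
  assumes "continuous_on A f" "continuous_on A g" "\<And>x. x \<in> A \<Longrightarrow> 0 \<le> f x"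
  shows "continuous_on A (\<lambda>x. shrink (f x) (g x))"
proof -
  have *: "\<forall>x\<in>A. 1 + f x \<noteq> 0" using assms(3) by (metis add_nonneg_eq_0_iff zero_le_one zero_neq_one)
  show ?thesis unfolding shrink_def clamp_to_def by (intro continuous_intros assms(1,2) *)
qed

definition shrink_map :: "(real \<Rightarrow> real) \<Rightarrow> R3 \<Rightarrow> R3" where
  "shrink_map c p = (shrink (c (fst (snd p))) (fst p), snd p)"

lemma bounded_homeo_shrink_map:
  assumes c: "continuous_on UNIV c" "\<And>x. 0 \<le> c x" "\<And>x. c x \<le> B"
  shows "bounded_homeo (shrink_map c)"
  unfolding shrink_map_def
proof (rule bounded_homeo_fiber_x[where f = "\<lambda>x y z. shrink (c y) x" and B = B])
  show "continuous_on UNIV (\<lambda>p :: R3. shrink (c (fst (snd p))) (fst p))"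
    by (intro continuous_on_shrink continuous_on_compose2[OF c(1)] continuous_intros c(2)) auto
  show "x = x'" if "shrink (c y) x = shrink (c y) x'" for x x' y z
    using shrink_strict_mono[OF c(2), of x x' y] shrink_strict_mono[OF c(2), of x' x y] that
    by (cases x x' rule: linorder_cases) auto
  show "\<bar>shrink (c y) x - x\<bar> \<le> B" for x y z
    using clamp_to_abs_le[OF c(2), of y "c y * x / (1 + c y)"] c(3)[of y] by (simp add: shrink_def)
qed

section \<open>Rectangular frames in standard positions\<close>

definition vertical_frame :: "real \<Rightarrow> real \<Rightarrow> R3 set" where
  "vertical_frame q e = {p. snd (snd p) = 0 \<and> \<bar>max \<bar>fst p\<bar> (\<bar>fst (snd p)\<bar> - q) - 2\<bar> \<le> e}"

definition horizontal_frame :: "real \<Rightarrow> real \<Rightarrow> R3 set" where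
  "horizontal_frame q e = {p. snd (snd p) = 0 \<and> \<bar>max \<bar>fst (snd p)\<bar> (\<bar>fst p\<bar> - q) - 2\<bar> \<le> e}"

text \<open>Swirls act in planes orthogonal to the first axis; \<open>swap_xz\<close> makes this the
  third axis. The rotation is clockwise in pictures and rigid up to radius 40, which contains every
  band it is applied to.\<close>

definition quarter_turn :: "R3 \<Rightarrow> R3" where
  "quarter_turn p = swap_xz (slice (\<lambda>x w. swirl 40 41 (pi / 2) w) (swap_xz p))"

lemma bounded_homeo_quarter_turn: "bounded_homeo quarter_turn"
  unfolding quarter_turn_def
  by (rule bounded_homeo_swap_xz, rule bounded_homeo_slice_swirl) (auto intro: continuous_intros)

lemma quarter_turn_eq: "\<bar>x\<bar> + \<bar>y\<bar> \<le> 40 \<Longrightarrow> quarter_turn (x, y, z) = (y, - x, z)"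
proof -
  assume "\<bar>x\<bar> + \<bar>y\<bar> \<le> 40"
  then have "cmod (Complex y x) \<le> 40" using cmod_le[of "Complex y x"] by simp
  then have "swirl 40 41 (pi / 2) (Complex y x) = Complex y x * cis (pi / 2)" by (simp add: swirl_inner)
  also have "\<dots> = Complex (- x) y" by (simp add: complex_eq_iff)
  finally show ?thesis by (simp add: quarter_turn_def swap_xz_def slice_eq)
qed

lemma quarter_turn_image:
  assumes A: "\<And>x y z. (x, y, z) \<in> A \<Longrightarrow> \<bar>x\<bar> + \<bar>y\<bar> \<le> 40"
  shows "quarter_turn ` A = {p. (- fst (snd p), fst p, snd (snd p)) \<in> A}"
proof (intro equalityI subsetI)
  fix p assume "p \<in> quarter_turn ` A"
  then obtain x y z where p: "p = quarter_turn (x, y, z)" "(x, y, z) \<in> A" by auto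
  then show "p \<in> {p. (- fst (snd p), fst p, snd (snd p)) \<in> A}"
    using quarter_turn_eq[OF A[OF p(2)]] by simp
next
  fix p assume p: "p \<in> {p. (- fst (snd p), fst p, snd (snd p)) \<in> A}"
  obtain x y z where [simp]: "p = (x, y, z)" by (metis prod.collapse)
  have "(- y, x, z) \<in> A" using p by simp
  from quarter_turn_eq[OF A[OF this]] this show "p \<in> quarter_turn ` A"
    by (intro image_eqI[of _ _ "(- y, x, z)"]) auto
qed

lemma vertical_frame_isotopic_horizontal:
  assumes "0 \<le> q" "q \<le> 30"
  shows "band_of (vertical_frame q) \<simeq> band_of (horizontal_frame q)"
proof (rule isotopic_band_ofI[OF bounded_homeo_quarter_turn])
  fix e :: real assume e: "0 \<le> e" "e \<le> 1"
  have "\<bar>x\<bar> + \<bar>y\<bar> \<le> 40" if "(x, y, z) \<in> vertical_frame q e" for x y z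
  proof -
    have "\<bar>max \<bar>x\<bar> (\<bar>y\<bar> - q) - 2\<bar> \<le> e" using that by (simp add: vertical_frame_def)
    then have "max \<bar>x\<bar> (\<bar>y\<bar> - q) \<le> 3" using abs_le_D1 e(2) by fastforce
    then have "\<bar>x\<bar> \<le> 3" "\<bar>y\<bar> - q \<le> 3" by simp_all
    then show ?thesis using assms by linarith
  qed
  then show "quarter_turn ` vertical_frame q e = horizontal_frame q e"
    by (subst quarter_turn_image) (auto simp: vertical_frame_def horizontal_frame_def)
qed

lemma frame_arith:
  fixes a b a' b' e :: real
  assumes e: "0 \<le> e" "e \<le> 1" and "1 \<le> a \<Longrightarrow> a' = a + 1" "a < 1 \<Longrightarrow> a' < 2" "1 \<le> b \<Longrightarrow> b' = b + 1" "b < 1 \<Longrightarrow> b' < 2"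
  shows "\<bar>max b' a' - 3\<bar> \<le> e \<longleftrightarrow> \<bar>max a b - 2\<bar> \<le> e"
  using assms by (cases "1 \<le> a"; cases "1 \<le> b") (auto simp: max_def abs_le_iff)

text \<open>The edges at \<open>|x| = q + 2\<close> are moved to 6 and those at
  \<open>|y| = 2\<close> to 3. Across the band the two maps are translations, beyond
  \<open>q + 1\<close> and beyond 1 respectively; further inside only their monotonicity
  counts.\<close>

lemma horizontal_frame_isotopic:
  assumes q: "4 \<le> q"
  shows "band_of (horizontal_frame q) \<simeq> band_of (frame_set 0)"
proof -
  let ?f = "\<lambda>x. x - clamp_to (q - 4) ((q - 4) * x / (q + 1))"
  let ?h = "\<lambda>p :: R3. (?f (fst p), snd p)" and ?k = "\<lambda>p :: R3. (fst p, fst (snd p) + clamp_to 1 (fst (snd p)), snd (snd p))"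
  have mono: "?f x < ?f y" if "x < y" for x y
  proof -
    have "clamp_to (q - 4) ((q - 4) * y / (q + 1)) - clamp_to (q - 4) ((q - 4) * x / (q + 1)) \<le> (q - 4) * y / (q + 1) - (q - 4) * x / (q + 1)"
      using q that by (intro clamp_to_lipschitz divide_right_mono mult_left_mono) auto
    also have "\<dots> = (q - 4) / (q + 1) * (y - x)" unfolding diff_divide_distrib[symmetric] right_diff_distrib[symmetric] by simp
    also have "\<dots> < 1 * (y - x)" using q that by (intro mult_strict_right_mono) auto
    finally show ?thesis by simp
  qed
  have bh: "bounded_homeo ?h"
  proof (rule bounded_homeo_fiber_x[where f = "\<lambda>x y z. ?f x" and B = "q - 4"])
    show "continuous_on UNIV (\<lambda>p :: R3. ?f (fst p))" unfolding clamp_to_def by (intro continuous_intros) (use q in auto)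
    show "x = x'" if "?f x = ?f x'" for x x' and y z :: real
      using mono[of x x'] mono[of x' x] that by (cases x x' rule: linorder_cases) auto
  qed (use clamp_to_abs_le[of "q - 4"] q in auto)
  have bk: "bounded_homeo ?k"
  proof (rule bounded_homeo_fiber_y[where f = "\<lambda>x y z. y + clamp_to 1 y" and B = 1])
    show "continuous_on UNIV (\<lambda>p :: R3. fst (snd p) + clamp_to 1 (fst (snd p)))" by (intro continuous_intros)
  qed (auto simp: clamp_to_def max_def min_def split: if_splits)
  show ?thesis
  proof (rule isotopic_band_ofI[OF bounded_homeo_compose[OF bh bk]], rule bounded_homeo_image_eqI[OF bounded_homeo_compose[OF bh bk]])
    fix e :: real and p :: R3 assume e: "0 \<le> e" "e \<le> 1"
    obtain x y z where p: "p = (x, y, z)" by (metis prod.collapse)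
    define x' y' where "x' = ?f x" and "y' = y + clamp_to 1 y"
    have y1: "1 \<le> \<bar>y\<bar> \<Longrightarrow> \<bar>y'\<bar> = \<bar>y\<bar> + 1" "\<bar>y\<bar> < 1 \<Longrightarrow> \<bar>y'\<bar> < 2"
      by (auto simp: y'_def clamp_to_def)
    have "?f (- x) = - ?f x" for x using q clamp_to_minus[of "q - 4" "(q - 4) * x / (q + 1)"] by simp
    moreover have "?f 0 = 0" using q by (simp add: clamp_to_mid)
    moreover from this have "0 \<le> ?f x" if "0 \<le> x" for x using mono[of 0 x] that by (cases "x = 0") auto
    ultimately have ax: "\<bar>x'\<bar> = ?f \<bar>x\<bar>" unfolding x'_def by (intro abs_odd[of ?f])
    have hi: "?f t = t - (q - 4)" if "q + 1 \<le> t" for t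
    proof -
      have "q - 4 \<le> (q - 4) * t / (q + 1)" using that q mult_left_mono[of "q + 1" t "q - 4"] by (simp add: pos_le_divide_eq)
      then show ?thesis using q by (simp add: clamp_to_high)
    qed
    have x1: "q + 1 \<le> \<bar>x\<bar> \<Longrightarrow> \<bar>x'\<bar> = \<bar>x\<bar> - (q - 4)" using hi[of "\<bar>x\<bar>"] ax by simp
    have x2: "\<bar>x\<bar> < q + 1 \<Longrightarrow> \<bar>x'\<bar> < 5" using mono[of "\<bar>x\<bar>" "q + 1"] hi[of "q + 1"] ax by simp
    have "\<bar>max (\<bar>x'\<bar> - 3) \<bar>y'\<bar> - 3\<bar> \<le> e \<longleftrightarrow> \<bar>max \<bar>y\<bar> (\<bar>x\<bar> - q) - 2\<bar> \<le> e"
      by (rule frame_arith[OF e]) (use x1 x2 y1 in auto)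
    then show "?k (?h p) \<in> frame_set 0 e \<longleftrightarrow> p \<in> horizontal_frame q e"
      by (simp add: p x'_def y'_def mem_frame_set horizontal_frame_def)
  qed
qed

subsection \<open>The H-shaped unknot\<close>

text \<open>Level 2 of this function bounds the part \<open>|x| < 2\<close> or
  \<open>|y| > 2\<close> of the rectangle \<open>|x| < 14\<close>, \<open>|y| < 8\<close>: two
  horizontal bars joined by a vertical neck, an H on its side. It is the stretched numerator closure
  of \<open>tangle_D_inf\<close>.\<close>

definition H_shape :: "real \<Rightarrow> R3 set" where
  "H_shape e = {p. snd (snd p) = 0 \<and>
     \<bar>max (min \<bar>fst p\<bar> (4 - \<bar>fst (snd p)\<bar>)) (max (\<bar>fst p\<bar> - 12) (\<bar>fst (snd p)\<bar> - 6)) - 2\<bar> \<le> e}"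

text \<open>The cases are the breakpoints 1, 3, 7 of \<open>lift\<close> and 1, 15 of
  \<open>c\<close>. The legs \<open>Y = 2\<close> go to \<open>Z = X + 1\<close> and the edges
  \<open>Y = 8\<close> to \<open>Z = 20\<close>, where the level function on the left takes the
  value 2 again.\<close>

lemma H_lift_arith:
  fixes X Y Z c e :: real
  assumes e: "0 \<le> e" "e \<le> 1" and X: "0 \<le> X" and Y: "0 \<le> Y" and c: "c = max 0 (min 14 (X - 1))"
    and Z: "Z = lift 12 c Y"
  shows "\<bar>max (X - max 0 (min 12 (Z - 3))) (Z - 18) - 2\<bar> \<le> e \<longleftrightarrow>
    \<bar>max (min X (4 - Y)) (max (X - 12) (Y - 6)) - 2\<bar> \<le> e"
proof -
  have c0: "0 \<le> c" "c < 12 + 4" using c by auto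
  note lv = lift_values[OF c0 Y, folded Z]
  consider "X \<le> 1" "c = 0" | "1 < X" "X \<le> 15" "c = X - 1" | "15 < X" "c = 14"
    using c by fastforce
  then show ?thesis
  proof cases
    case 1
    consider "Y \<le> 3" | "3 < Y" "Y < 7" | "7 \<le> Y" by linarith
    then show ?thesis
      by cases (use lv 1 e X Y in \<open>auto simp: max_def min_def abs_le_iff\<close>)
  next
    case 2
    consider "Y < 1" | "1 \<le> Y" "Y \<le> 3" | "3 < Y" "Y < 7" | "7 \<le> Y" by linarith
    then show ?thesis
      by cases (use lv 2 e X Y in \<open>auto simp: max_def min_def abs_le_iff\<close>)
  next
    case 3
    consider "Y < 1" | "1 \<le> Y" "Y \<le> 3" | "3 < Y" "Y < 7" | "7 \<le> Y" by linarith
    then show ?thesis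
      by cases (use lv 3 e X Y in \<open>auto simp: max_def min_def abs_le_iff\<close>)
  qed
qed

lemma shrink_arith:
  fixes X Y c e q :: real
  assumes e: "0 \<le> e" "e \<le> 1" and X: "0 \<le> X" and c: "0 \<le> c"
  shows "\<bar>max (shrink c X) (Y - q) - 2\<bar> \<le> e \<longleftrightarrow> \<bar>max (X - c) (Y - q) - 2\<bar> \<le> e"
proof (cases "1 + c \<le> X")
  case False
  then show ?thesis using shrink_values(2)[OF c X] e by (auto simp: max_def abs_le_iff)
qed (simp add: shrink_high c)

text \<open>Lifting the legs by \<open>|x| - 1\<close> opens the two notches beside the neck until
  each side of the curve is a graph over the second coordinate; moving the sides horizontally to
  \<open>|x| = 2\<close> then leaves a tall rectangle.\<close>

lemma H_shape_isotopic: "band_of H_shape \<simeq> band_of (frame_set 0)"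
proof -
  let ?c = "\<lambda>x :: real. max 0 (min 14 (\<bar>x\<bar> - 1))" and ?d = "\<lambda>y :: real. max 0 (min 12 (\<bar>y\<bar> - 3))"
  have b1: "bounded_homeo (lift_map 12 ?c)"
    by (rule bounded_homeo_lift_map) (auto intro!: continuous_intros)
  have b2: "bounded_homeo (shrink_map ?d)"
    by (rule bounded_homeo_shrink_map[where B = 12]) (auto intro!: continuous_intros)
  have "band_of H_shape \<simeq> band_of (vertical_frame 18)"
  proof (rule isotopic_band_ofI[OF bounded_homeo_compose[OF b1 b2]], rule bounded_homeo_image_eqI[OF bounded_homeo_compose[OF b1 b2]])
    fix e :: real and p :: R3 assume e: "0 \<le> e" "e \<le> 1"
    obtain x y z where p: "p = (x, y, z)" by (metis prod.collapse)
    define y' where "y' = lift 12 (?c x) y"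
    have ay: "\<bar>y'\<bar> = lift 12 (?c x) \<bar>y\<bar>" unfolding y'_def by (rule lift_abs) auto
    have "\<bar>max \<bar>shrink (?d y') x\<bar> (\<bar>y'\<bar> - 18) - 2\<bar> \<le> e \<longleftrightarrow> \<bar>max (\<bar>x\<bar> - ?d y') (\<bar>y'\<bar> - 18) - 2\<bar> \<le> e"
    proof -
      have d: "0 \<le> ?d y'" by simp
      show ?thesis unfolding shrink_abs[OF d] by (rule shrink_arith[OF e _ d]) simp
    qed
    also have "\<dots> \<longleftrightarrow> \<bar>max (min \<bar>x\<bar> (4 - \<bar>y\<bar>)) (max (\<bar>x\<bar> - 12) (\<bar>y\<bar> - 6)) - 2\<bar> \<le> e"
      by (rule H_lift_arith[OF e _ _ refl ay]) auto
    finally show "shrink_map ?d (lift_map 12 ?c p) \<in> vertical_frame 18 e \<longleftrightarrow> p \<in> H_shape e"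
      unfolding p lift_map_def shrink_map_def vertical_frame_def H_shape_def mem_Collect_eq fst_conv snd_conv
        y'_def[symmetric] by blast
  qed
  also have "\<dots> \<simeq> band_of (horizontal_frame 18)" by (rule vertical_frame_isotopic_horizontal) auto
  also have "\<dots> \<simeq> band_of (frame_set 0)" by (rule horizontal_frame_isotopic) auto
  finally show ?thesis .
qed

section \<open>Twisted legs\<close>

text \<open>A box around the upper leg, made symmetric only by \<open>leg_to_box\<close>: the bound
  \<open>-1/2\<close> keeps clear of the lower leg, whose band reaches up to \<open>-1\<close>, and
  the slope 2 of that map on \<open>{-1..1}\<close> stretches the box down to
  \<open>-4\<close>.\<close>

definition leg_box :: "real \<Rightarrow> R3 set" where
  "leg_box s = {p. \<bar>fst p + s\<bar> \<le> 4 \<and> - 1/2 \<le> fst (snd p) \<and> fst (snd p) \<le> 6 \<and> \<bar>snd (snd p)\<bar> \<le> 4}"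

definition upper_leg :: "real \<Rightarrow> (real \<Rightarrow> real) \<Rightarrow> real \<Rightarrow> R3 set" where
  "upper_leg s \<psi> e = {(x, 2 + r * cos (\<psi> (x + s)), r * sin (\<psi> (x + s))) | x r. \<bar>x + s\<bar> \<le> 4 \<and> \<bar>r\<bar> \<le> e}"

definition leg_to_box :: "real \<Rightarrow> R3 \<Rightarrow> R3" where
  "leg_to_box s p = (fst p + s, fst (snd p) - 2 + max (- 2) (min 0 (fst (snd p) - 1)), snd (snd p))"

lemma bounded_homeo_leg_to_box: "bounded_homeo (leg_to_box s)"
proof -
  have 1: "bounded_homeo (\<lambda>p :: R3. (fst p + s, snd p))"
    by (rule bounded_homeo_fiber_x[where f = "\<lambda>x y z. x + s" and B = "\<bar>s\<bar>"]) (auto intro!: continuous_intros)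
  have 2: "bounded_homeo (\<lambda>p :: R3. (fst p, fst (snd p) - 2 + max (- 2) (min 0 (fst (snd p) - 1)), snd (snd p)))"
  proof (rule bounded_homeo_fiber_y[where f = "\<lambda>x y z. y - 2 + max (- 2) (min 0 (y - 1))" and B = 4])
    show "continuous_on UNIV (\<lambda>p :: R3. fst (snd p) - 2 + max (- 2) (min 0 (fst (snd p) - 1)))"
      by (intro continuous_intros)
  qed (auto simp: max_def min_def split: if_splits)
  show ?thesis using bounded_homeo_compose[OF 1 2] by (simp add: leg_to_box_def[abs_def])
qed

lemma leg_to_box_mem: "leg_to_box s p \<in> tangle_box \<longleftrightarrow> p \<in> leg_box s"
proof -
  have "- 4 \<le> y - 2 + max (- 2) (min 0 (y - 1)) \<and> y - 2 + max (- 2) (min 0 (y - 1)) \<le> 4 \<longleftrightarrow> - 1/2 \<le> y \<and> y \<le> 6" for y :: real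
    by (auto simp: max_def min_def)
  then show ?thesis by (cases p) (auto simp: leg_to_box_def leg_box_def tangle_box_def abs_le_iff)
qed

lemma leg_to_box_upper_leg:
  assumes "e \<le> 1"
  shows "leg_to_box s ` upper_leg s \<psi> e = strip_set \<psi> {-4..4} e"
proof -
  have "leg_to_box s ` upper_leg s \<psi> e =
      {(x + s, r * cos (\<psi> (x + s)), r * sin (\<psi> (x + s))) | x r. \<bar>x + s\<bar> \<le> 4 \<and> \<bar>r\<bar> \<le> e}"
    unfolding upper_leg_def
  proof (rule image_Collect2)
    fix x r :: real assume r: "\<bar>x + s\<bar> \<le> 4 \<and> \<bar>r\<bar> \<le> e"
    have "\<bar>r * cos t\<bar> \<le> 1" for t
      using r assms mult_mono[of "\<bar>r\<bar>" 1 "\<bar>cos t\<bar>" 1] by (simp add: abs_mult)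
    from this[of "\<psi> (x + s)"]
    show "leg_to_box s (x, 2 + r * cos (\<psi> (x + s)), r * sin (\<psi> (x + s))) = (x + s, r * cos (\<psi> (x + s)), r * sin (\<psi> (x + s)))"
      by (simp add: leg_to_box_def max_def min_def)
  qed
  also have "\<dots> = strip_set \<psi> {-4..4} e"
  proof (intro equalityI subsetI)
    fix p assume "p \<in> strip_set \<psi> {-4..4} e"
    then obtain x r where "p = (x, r * cos (\<psi> x), r * sin (\<psi> x))" "x \<in> {-4..4}" "\<bar>r\<bar> \<le> e"
      unfolding strip_set_def by blast
    moreover from this have "\<bar>x\<bar> \<le> 4" by auto
    ultimately show "p \<in> {(x + s, r * cos (\<psi> (x + s)), r * sin (\<psi> (x + s))) | x r. \<bar>x + s\<bar> \<le> 4 \<and> \<bar>r\<bar> \<le> e}"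
      by (intro CollectI exI[of _ "x - s"] exI[of _ r]) simp
  next
    fix p assume "p \<in> {(x + s, r * cos (\<psi> (x + s)), r * sin (\<psi> (x + s))) | x r. \<bar>x + s\<bar> \<le> 4 \<and> \<bar>r\<bar> \<le> e}"
    then obtain x r where "p = (x + s, r * cos (\<psi> (x + s)), r * sin (\<psi> (x + s)))" "\<bar>x + s\<bar> \<le> 4" "\<bar>r\<bar> \<le> e" by blast
    then show "p \<in> strip_set \<psi> {-4..4} e"
      unfolding strip_set_def by (intro CollectI exI[of _ "x + s"] exI[of _ r]) auto
  qed
  finally show ?thesis .
qed

text \<open>In the coordinates of \<open>leg_to_box\<close> the upper leg is the strand of a
  \<open>strip_link\<close> and the rest of the band is its \<open>Y\<close>. Tameness passes from
  the flat band \<open>S\<close> to the twisted band \<open>K\<close>.\<close>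

lemma skein_class_twisted_leg:
  assumes S: "\<And>e. 0 \<le> e \<Longrightarrow> e \<le> 1 \<Longrightarrow> S e \<inter> leg_box s = {p. \<bar>fst p + s\<bar> \<le> 4 \<and> \<bar>fst (snd p) - 2\<bar> \<le> e \<and> snd (snd p) = 0}"
    and \<psi>: "continuous_on UNIV \<psi>" "\<And>x. 4 \<le> \<bar>x\<bar> \<Longrightarrow> \<psi> x = full_turns k x"
    and t: "tame (band_of S)"
    and K: "\<And>e. 0 \<le> e \<Longrightarrow> e \<le> 1 \<Longrightarrow> K e = upper_leg s \<psi> e \<union> (S e - leg_box s)"
  shows "tame (band_of K)" "skein_class (band_of K) = a_pow k \<odot> skein_class (band_of S)"
proof -
  define Y where "Y e = leg_to_box s ` (S e - leg_box s)" for e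
  have Yb: "Y e \<inter> tangle_box = {}" for e unfolding Y_def using leg_to_box_mem by blast
  have "band_of S \<simeq> band_of (strip_link Y (\<lambda>x. 0))"
  proof (rule isotopic_band_ofI[OF bounded_homeo_leg_to_box])
    fix e :: real assume e: "0 \<le> e" "e \<le> 1"
    have "upper_leg s (\<lambda>x. 0) e = S e \<inter> leg_box s"
      unfolding S[OF e]
    proof (intro equalityI subsetI)
      fix p :: R3 assume "p \<in> {p. \<bar>fst p + s\<bar> \<le> 4 \<and> \<bar>fst (snd p) - 2\<bar> \<le> e \<and> snd (snd p) = 0}"
      then show "p \<in> upper_leg s (\<lambda>x. 0) e" unfolding upper_leg_def
        by (intro CollectI exI[of _ "fst p"] exI[of _ "fst (snd p) - 2"]) (auto simp: prod_eq_iff)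
    qed (auto simp: upper_leg_def)
    then have "S e = upper_leg s (\<lambda>x. 0) e \<union> (S e - leg_box s)" by blast
    then have "leg_to_box s ` S e = leg_to_box s ` upper_leg s (\<lambda>x. 0) e \<union> Y e"
      unfolding Y_def image_Un[symmetric] by (rule arg_cong)
    then show "leg_to_box s ` S e = strip_link Y (\<lambda>x. 0) e"
      unfolding leg_to_box_upper_leg[OF e(2)] strip_link_def .
  qed
  note S0 = this
  have t0: "tame (band_of (strip_link Y (\<lambda>x. 0)))" by (rule isotopic_bands_tame[OF S0 t])
  have "band_of K \<simeq> band_of (strip_link Y \<psi>)"
    by (rule isotopic_band_ofI[OF bounded_homeo_leg_to_box[of s]])
      (simp add: K image_Un leg_to_box_upper_leg strip_link_def Y_def)
  also have "\<dots> \<simeq> band_of (strip_link Y (full_turns k))"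
    by (rule strip_link_isotopic[OF \<psi>(1) _ \<psi>(2) Yb]) (auto intro!: continuous_intros)
  finally have KY: "band_of K \<simeq> band_of (strip_link Y (full_turns k))" .
  note tk = strip_link_full_turns[OF Yb t0, of k]
  show "tame (band_of K)" by (rule isotopic_bands_tame[OF isotopic_bands_sym[OF KY] tk(1)])
  then show "skein_class (band_of K) = a_pow k \<odot> skein_class (band_of S)"
    using isotopic_bands_skein_class[OF KY] tk(2) isotopic_bands_skein_class[OF S0 t] by simp
qed

text \<open>An adapter for legs that are given over an interval \<open>I\<close> shorter than the
  box. On the remainder of the box the angle is a multiple of \<open>2 * pi\<close>, so the ribbon
  is flat there and is supplied by \<open>R\<close>.\<close>

lemma skein_class_twisted_legs:
  assumes I: "\<And>x. x \<in> I \<Longrightarrow> \<bar>x + s\<bar> \<le> 4"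
    and \<psi>: "continuous_on UNIV \<psi>" "\<And>x. 4 \<le> \<bar>x\<bar> \<Longrightarrow> \<psi> x = full_turns k x"
    and flat: "\<And>x. \<bar>x + s\<bar> \<le> 4 \<Longrightarrow> x \<notin> I \<Longrightarrow> cis (\<psi> (x + s)) = 1"
    and t: "tame (band_of S)"
    and S: "\<And>e x y z. 0 \<le> e \<Longrightarrow> e \<le> 1 \<Longrightarrow> (x, y, z) \<in> S e \<longleftrightarrow> (x, y, z) \<in> R e \<or> (z = 0 \<and> x \<in> I \<and> \<bar>\<bar>y\<bar> - 2\<bar> \<le> e)"
    and R: "\<And>e x y z. 0 \<le> e \<Longrightarrow> e \<le> 1 \<Longrightarrow> (x, y, z) \<in> R e \<Longrightarrow> (x, y, z) \<in> leg_box s \<Longrightarrow>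
      z = 0 \<and> \<bar>y - 2\<bar> \<le> e \<and> cis (\<psi> (x + s)) = 1"
    and RI: "\<And>e x y. 0 \<le> e \<Longrightarrow> e \<le> 1 \<Longrightarrow> \<bar>x + s\<bar> \<le> 4 \<Longrightarrow> x \<notin> I \<Longrightarrow> \<bar>y - 2\<bar> \<le> e \<Longrightarrow> (x, y, 0) \<in> R e"
  shows "tame (band_of (\<lambda>e. twisted_legs (\<lambda>x. \<psi> (x + s)) (\<lambda>x. 0) I e \<union> R e)) \<and>
    skein_class (band_of (\<lambda>e. twisted_legs (\<lambda>x. \<psi> (x + s)) (\<lambda>x. 0) I e \<union> R e)) = a_pow k \<odot> skein_class (band_of S)"
proof -
  have ab: "\<bar>\<bar>y\<bar> - 2\<bar> \<le> e \<longleftrightarrow> \<bar>y - 2\<bar> \<le> e \<or> \<bar>y + 2\<bar> \<le> e" if "e \<le> 1" for y e :: real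
    using that by (auto simp: abs_if)
  have box: "\<bar>y - 2\<bar> \<le> e \<Longrightarrow> (x, y, 0) \<in> leg_box s \<longleftrightarrow> \<bar>x + s\<bar> \<le> 4" "\<bar>y + 2\<bar> \<le> e \<Longrightarrow> (x, y, z) \<notin> leg_box s"
    if "e \<le> 1" for x y z e
    using that by (auto simp: leg_box_def)
  have in_box: "S e \<inter> leg_box s = {p. \<bar>fst p + s\<bar> \<le> 4 \<and> \<bar>fst (snd p) - 2\<bar> \<le> e \<and> snd (snd p) = 0}"
    if e: "0 \<le> e" "e \<le> 1" for e
  proof (rule set_eqI)
    fix p :: R3
    obtain x y z where p: "p = (x, y, z)" by (metis prod.collapse)
    have x: "p \<in> leg_box s \<Longrightarrow> \<bar>x + s\<bar> \<le> 4" by (simp add: p leg_box_def)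
    show "p \<in> S e \<inter> leg_box s \<longleftrightarrow> p \<in> {p. \<bar>fst p + s\<bar> \<le> 4 \<and> \<bar>fst (snd p) - 2\<bar> \<le> e \<and> snd (snd p) = 0}"
      using R[OF e, of x y z] RI[OF e, of x y] box[OF e(2)] x
      unfolding p Int_iff S[OF e] ab[OF e(2)] mem_Collect_eq fst_conv snd_conv by blast
  qed
  have K: "twisted_legs (\<lambda>x. \<psi> (x + s)) (\<lambda>x. 0) I e \<union> R e = upper_leg s \<psi> e \<union> (S e - leg_box s)"
    if e: "0 \<le> e" "e \<le> 1" for e
  proof -
    let ?f = "\<lambda>x r. (x, 2 + r * cos (\<psi> (x + s)), r * sin (\<psi> (x + s)))"
    define up where "up = {?f x r | x r. x \<in> I \<and> \<bar>r\<bar> \<le> e}"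
    define low where "low = {(x, - 2 + r * cos 0, r * sin 0) | x r. (x :: real) \<in> I \<and> \<bar>r\<bar> \<le> e}"
    define fl :: "R3 set" where "fl = {(x, y, z). \<bar>x + s\<bar> \<le> 4 \<and> cis (\<psi> (x + s)) = 1 \<and> z = 0 \<and> \<bar>y - 2\<bar> \<le> e}"
    have low: "(x, y, z) \<in> low \<longleftrightarrow> z = 0 \<and> x \<in> I \<and> \<bar>y + 2\<bar> \<le> e" for x y z
    proof
      assume "z = 0 \<and> x \<in> I \<and> \<bar>y + 2\<bar> \<le> e"
      then show "(x, y, z) \<in> low" unfolding low_def by (intro CollectI exI[of _ x] exI[of _ "y + 2"]) auto
    qed (auto simp: low_def)
    have leg: "upper_leg s \<psi> e = up \<union> fl"
    proof (intro equalityI subsetI)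
      fix p assume "p \<in> upper_leg s \<psi> e"
      then obtain x r where p: "p = ?f x r" "\<bar>x + s\<bar> \<le> 4" "\<bar>r\<bar> \<le> e" unfolding upper_leg_def by blast
      show "p \<in> up \<union> fl"
      proof (cases "x \<in> I")
        case True
        then show ?thesis using p unfolding up_def by blast
      next
        case False
        then show ?thesis using flat[OF p(2)] p unfolding fl_def by (auto simp: complex_eq_iff)
      qed
    next
      fix p assume "p \<in> up \<union> fl"
      then consider x r where "p = ?f x r" "x \<in> I" "\<bar>r\<bar> \<le> e"
        | x y where "p = (x, y, 0)" "\<bar>x + s\<bar> \<le> 4" "cis (\<psi> (x + s)) = 1" "\<bar>y - 2\<bar> \<le> e"
        unfolding up_def fl_def by auto
      then show "p \<in> upper_leg s \<psi> e"
      proof cases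
        case 1
        then show ?thesis using I unfolding upper_leg_def by blast
      next
        case 2
        then show ?thesis unfolding upper_leg_def
          by (intro CollectI exI[of _ x] exI[of _ "y - 2"]) (auto simp: complex_eq_iff)
      qed
    qed
    have "p \<in> low \<union> R e \<union> fl \<longleftrightarrow> p \<in> fl \<union> (S e - leg_box s)" for p
    proof -
      obtain x y z where p: "p = (x, y, z)" by (metis prod.collapse)
      have x: "p \<in> leg_box s \<Longrightarrow> \<bar>x + s\<bar> \<le> 4" by (simp add: p leg_box_def)
      have fl: "p \<in> fl \<longleftrightarrow> \<bar>x + s\<bar> \<le> 4 \<and> cis (\<psi> (x + s)) = 1 \<and> z = 0 \<and> \<bar>y - 2\<bar> \<le> e" by (simp add: p fl_def)
      show ?thesis
        using R[OF e, of x y z] box[OF e(2)] x I[of x]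
        unfolding Un_iff Diff_iff fl unfolding p low S[OF e] ab[OF e(2)] by blast
    qed
    moreover have "fl \<subseteq> up \<union> R e"
    proof
      fix p assume "p \<in> fl"
      then obtain x y where p: "p = (x, y, 0)" "\<bar>x + s\<bar> \<le> 4" "cis (\<psi> (x + s)) = 1" "\<bar>y - 2\<bar> \<le> e"
        unfolding fl_def by auto
      show "p \<in> up \<union> R e"
      proof (cases "x \<in> I")
        case True
        have "p = ?f x (y - 2)" using p by (auto simp: complex_eq_iff)
        then show ?thesis using True p(4) unfolding up_def by blast
      next
        case False
        then show ?thesis using RI[OF e p(2) False p(4)] p(1) by simp
      qed
    qed
    moreover have "twisted_legs (\<lambda>x. \<psi> (x + s)) (\<lambda>x. 0) I e = up \<union> low"
      unfolding twisted_legs_def up_def low_def ..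
    ultimately show ?thesis unfolding leg by blast
  qed
  show ?thesis
    by (intro conjI; rule skein_class_twisted_leg[OF in_box \<psi> t K]; assumption)
qed

text \<open>In \<open>twist\<close> the ribbons stay parallel to the second axis while the strands
  revolve. Turning the slices back straightens the strands and makes the ribbons revolve by
  \<open>- \<beta>\<close>: crossings are traded for twists of the framing. The radius
  \<open>r1 \<ge> 3\<close> covers \<open>2 + e\<close>.\<close>

lemma untwist_legs:
  assumes e: "e \<le> 1" and r: "3 \<le> r1" "r1 < r2" and \<alpha>: "\<And>x. x \<in> I \<Longrightarrow> \<alpha> x = - \<beta> x"
  shows "slice (\<lambda>x w. swirl r1 r2 (\<alpha> x) w) ` twist \<beta> I e = twisted_legs (\<lambda>x. - \<beta> x) (\<lambda>x. - \<beta> x) I e"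
proof -
  let ?h = "slice (\<lambda>x w. swirl r1 r2 (\<alpha> x) w)"
  have 1: "?h (x, 2 * c * cos (\<beta> x) + t, 2 * c * sin (\<beta> x)) = (x, 2 * c + t * cos (- \<beta> x), t * sin (- \<beta> x))"
    if "x \<in> I" "\<bar>t\<bar> \<le> e" "c \<in> {-1, 1}" for x t and c :: real
  proof -
    have E: "Complex (2 * c * cos (\<beta> x) + t) (2 * c * sin (\<beta> x)) = 2 * of_real c * cis (\<beta> x) + of_real t"
      by (simp add: complex_eq_iff)
    have "cmod (of_real c) = 1" using that by auto
    then have "cmod (2 * of_real c * cis (\<beta> x) + of_real t) \<le> r1"
      using norm_triangle_ineq[of "2 * of_real c * cis (\<beta> x)" "of_real t"] that e r by (simp add: norm_mult)
    then have "swirl r1 r2 (\<alpha> x) (2 * of_real c * cis (\<beta> x) + of_real t) = 2 * of_real c + of_real t * cis (- \<beta> x)"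
      using r \<alpha>[OF that(1)] by (simp add: swirl_inner distrib_right mult.assoc cis_mult)
    then show ?thesis unfolding slice_eq E by simp
  qed
  have 2: "twist \<beta> I e = {(x, 2 * 1 * cos (\<beta> x) + r, 2 * 1 * sin (\<beta> x)) | x r. x \<in> I \<and> \<bar>r\<bar> \<le> e}
      \<union> {(x, 2 * (- 1) * cos (\<beta> x) + r, 2 * (- 1) * sin (\<beta> x)) | x r. x \<in> I \<and> \<bar>r\<bar> \<le> e}"
    unfolding twist_def by blast
  have 3: "?h ` {(x, 2 * 1 * cos (\<beta> x) + r, 2 * 1 * sin (\<beta> x)) | x r. x \<in> I \<and> \<bar>r\<bar> \<le> e}
      = {(x, 2 + r * cos (- \<beta> x), r * sin (- \<beta> x)) | x r. x \<in> I \<and> \<bar>r\<bar> \<le> e}"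
    by (rule image_Collect2) (subst 1, auto)
  have 4: "?h ` {(x, 2 * (- 1) * cos (\<beta> x) + r, 2 * (- 1) * sin (\<beta> x)) | x r. x \<in> I \<and> \<bar>r\<bar> \<le> e}
      = {(x, - 2 + r * cos (- \<beta> x), r * sin (- \<beta> x)) | x r. x \<in> I \<and> \<bar>r\<bar> \<le> e}"
    by (rule image_Collect2) (subst 1, auto)
  show ?thesis unfolding 2 image_Un 3 4 twisted_legs_def ..
qed

section \<open>The closure of the vertical tangle\<close>

definition vertical_arcs :: "real \<Rightarrow> R3 set" where
  "vertical_arcs e = vertical_points {2-e..2+e}"

lemma mem_vertical_arcs: "(x, y, z) \<in> vertical_arcs e \<longleftrightarrow> z = 0 \<and> \<bar>x\<bar> \<le> 4 \<and> \<bar>max (4 - \<bar>x\<bar>) \<bar>y\<bar> - 2\<bar> \<le> e"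
proof -
  have "a \<in> {2-e..2+e} \<longleftrightarrow> \<bar>a - 2\<bar> \<le> e" for a by auto
  then show ?thesis unfolding vertical_arcs_def vertical_points_def by blast
qed

lemma tangle_D_inf_eq: "tangle_D_inf = band_of vertical_arcs"
  by (simp add: tangle_D_inf_def vertical_arcs_def band_of_def)

lemma outer_abs:
  assumes "0 \<le> e" "e \<le> 1"
  shows "(x, y, z) \<in> outer a e \<longleftrightarrow> z = 0 \<and> (a < \<bar>x\<bar> \<or> 4 < \<bar>y\<bar>) \<and> \<bar>max (\<bar>x\<bar> - (a - 1)) \<bar>\<bar>y\<bar> - 5\<bar> - 3\<bar> \<le> e"
proof -
  have *: "\<not> \<bar>max u v - 3\<bar> \<le> e" if "5 \<le> v" for u v :: real using that assms by (auto simp: max_def)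
  show ?thesis
  proof (cases "0 \<le> y")
    case True
    then have "\<not> \<bar>max (\<bar>x\<bar> - (a - 1)) \<bar>y + 5\<bar> - 3\<bar> \<le> e" by (intro *) auto
    then show ?thesis using True by (simp add: mem_outer)
  next
    case False
    then have "\<not> \<bar>max (\<bar>x\<bar> - (a - 1)) \<bar>y - 5\<bar> - 3\<bar> \<le> e" by (intro *) auto
    moreover have "\<bar>\<bar>y\<bar> - 5\<bar> = \<bar>y + 5\<bar>" using False by auto
    ultimately show ?thesis unfolding mem_outer by metis
  qed
qed

lemma H_decomposition:
  fixes X Y e :: real
  assumes "0 \<le> e" "e \<le> 1" "0 \<le> X" "0 \<le> Y"
  shows "\<bar>max (min X (4 - Y)) (max (X - 12) (Y - 6)) - 2\<bar> \<le> e \<longleftrightarrow>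
    ((12 < X \<or> 4 < Y) \<and> \<bar>max (X - 11) \<bar>Y - 5\<bar> - 3\<bar> \<le> e) \<or> (4 < X \<and> X \<le> 12 \<and> \<bar>Y - 2\<bar> \<le> e)
    \<or> (X \<le> 4 \<and> \<bar>max (4 - X) Y - 2\<bar> \<le> e)"
proof -
  consider "X \<le> 4" "Y \<le> 4" | "4 < X" "X \<le> 12" "Y \<le> 4" | "12 < X" "Y \<le> 4" | "4 < Y" "Y \<le> 5" | "5 < Y" by linarith
  then show ?thesis
    by cases (use assms in \<open>auto simp: max_def min_def abs_le_iff abs_of_nonpos abs_of_nonneg\<close>)
qed

definition cap_closure :: "int \<Rightarrow> real \<Rightarrow> R3 set" where
  "cap_closure m e = cubic_outside m e \<union> vertical_arcs e"

definition cap_rest :: "real \<Rightarrow> R3 set" where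
  "cap_rest e = twist (\<lambda>x. 0) {4<..12} e \<union> vertical_arcs e \<union> outer 12 e"

lemma cubic_outside_tangle_D_inf:
  "band_union (band_of (cubic_outside m)) tangle_D_inf = band_of (cap_closure m)"
  by (simp add: tangle_D_inf_eq band_union_def band_of_def cap_closure_def)

text \<open>Turning the cap by \<open>- m * pi\<close> about the first axis undoes the crossings and leaves
  \<open>- m\<close> half twists in the ribbon of each leg.\<close>

lemma cap_closure_isotopic_legs:
  "band_of (cap_closure m) \<simeq> band_of (\<lambda>e. twisted_legs (\<lambda>x. half_turns (- m) (x + 8)) (\<lambda>x. half_turns (- m) (x + 8)) {-12..<-4} e \<union> cap_rest e)"
proof -
  \<comment> \<open>The turning is taken back over \<open>{-1..1}\<close>, where the vertical tangle
    has no interior crossing points with the slices, so only its left arc is turned.\<close>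
  let ?\<alpha> = "\<lambda>x. - (of_int m * pi * (turn (x + 8) - max 0 (min 1 ((x + 1) / 2))))"
  let ?h = "slice (\<lambda>x w. swirl (7/2) (39/10) (?\<alpha> x) w)"
  have bh: "bounded_homeo ?h"
    by (rule bounded_homeo_slice_swirl) (auto intro!: continuous_intros)
  have far: "?h (x, y, z) = (x, y, z)" if "?\<alpha> x = 0 \<or> 4 < \<bar>y\<bar>" for x y z
    using that abs_Re_le_cmod[of "Complex y z"] by (auto simp: slice_eq swirl_outer)
  have \<alpha>0: "?\<alpha> x = 0" if "1 \<le> x \<or> x < -12" for x
    using that turn_left[of "x + 8"] turn_right[of "x + 8"] by (auto simp: max_def min_def)
  show ?thesis
  proof (rule isotopic_band_ofI[OF bh])
    fix e :: real assume e: "0 \<le> e" "e \<le> 1"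
    have 1: "?h ` twist (\<lambda>x. half_turns m (x + 8)) {-12..<-4} e =
        twisted_legs (\<lambda>x. half_turns (- m) (x + 8)) (\<lambda>x. half_turns (- m) (x + 8)) {-12..<-4} e"
    proof -
      have "?h ` twist (\<lambda>x. half_turns m (x + 8)) {-12..<-4} e =
        twisted_legs (\<lambda>x. - half_turns m (x + 8)) (\<lambda>x. - half_turns m (x + 8)) {-12..<-4} e"
        by (rule untwist_legs) (use e in \<open>auto simp: max_def min_def\<close>)
      then show ?thesis by simp
    qed
    have 2: "twist (\<lambda>x. half_turns m (x + 8)) {4<..12} e = twist (\<lambda>x. 0) {4<..12} e"
    proof (rule twist_cong)
      fix x :: real assume "x \<in> {4<..12}"
      then show "\<exists>s\<in>{-1, 1}. cos (half_turns m (x + 8)) = s * cos 0 \<and> sin (half_turns m (x + 8)) = s * sin 0"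
        using cos_sin_add_int_pi[of 0 m] turn_right[of "x + 8"] by auto
    qed
    have 3: "?h ` twist (\<lambda>x. 0) {4<..12} e = twist (\<lambda>x. 0) {4<..12} e"
    proof (rule image_eq_self)
      fix p assume "p \<in> twist (\<lambda>x. 0) {4<..12} e"
      then obtain x y z where p: "p = (x, y, z)" "4 < x" unfolding twist_def by auto
      show "?h p = p" unfolding p(1) by (intro far disjI1 \<alpha>0) (use p(2) in auto)
    qed
    have 4: "?h ` outer 12 e = outer 12 e"
    proof (rule image_eq_self)
      fix p assume "p \<in> outer 12 e"
      then obtain x y z where p: "p = (x, y, z)" "12 < \<bar>x\<bar> \<or> 4 < \<bar>y\<bar>" unfolding outer_def by auto
      then have "1 \<le> x \<or> x < -12 \<or> 4 < \<bar>y\<bar>" by linarith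
      then show "?h p = p" using far[of x y z] \<alpha>0[of x] p(1) by blast
    qed
    have 5: "?h ` vertical_arcs e = vertical_arcs e"
    proof (rule bounded_homeo_image_eqI[OF bh])
      fix p :: R3
      obtain x y z where p: "p = (x, y, z)" by (metis prod.collapse)
      consider "1 \<le> x" | "\<bar>x\<bar> < 1 \<or> 4 < \<bar>x\<bar>" | "-4 \<le> x" "x \<le> -1" by linarith
      then show "?h p \<in> vertical_arcs e \<longleftrightarrow> p \<in> vertical_arcs e"
      proof cases
        case 1
        have "?h p = p" unfolding p by (intro far disjI1 \<alpha>0) (use 1 in auto)
        then show ?thesis by (simp only:)
      next
        case 2
        have "(x, y', z') \<notin> vertical_arcs e" for y' z' using 2 e by (auto simp: mem_vertical_arcs max_def)
        then show ?thesis unfolding p slice_eq by blast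
      next
        case 3
        then have \<alpha>: "?\<alpha> x = of_int (- m) * pi" using turn_right[of "x + 8"] by simp
        obtain s where s: "s \<in> {-1, 1}" "cos (of_int (- m) * pi) = s" "sin (of_int (- m) * pi) = 0"
          using cos_sin_add_int_pi[of 0 "- m"] by auto
        show ?thesis
        proof (cases "cmod (Complex y z) \<le> 7/2")
          case True
          have "swirl (7/2) (39/10) (?\<alpha> x) (Complex y z) = Complex y z * cis (of_int (- m) * pi)"
            using True unfolding \<alpha> by (simp add: swirl_inner)
          also have "cis (of_int (- m) * pi) = of_real s" using s by (simp add: complex_eq_iff)
          finally have "?h p = (x, s * y, s * z)" by (simp add: p slice_eq mult.commute)
          then show ?thesis using s(1) by (auto simp: p mem_vertical_arcs)
        next
          case False
          have *: "(x, Re w, Im w) \<notin> vertical_arcs e" if w: "cmod w = cmod (Complex y z)" for w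
          proof
            assume v: "(x, Re w, Im w) \<in> vertical_arcs e"
            then have "\<bar>Re w\<bar> \<le> 3" "Im w = 0" using e by (auto simp: mem_vertical_arcs max_def split: if_splits)
            then show False using False w cmod_le[of w] by simp
          qed
          show ?thesis using *[of "Complex y z"] *[of "swirl (7/2) (39/10) (?\<alpha> x) (Complex y z)"]
            by (simp add: p slice_eq)
        qed
      qed
    qed
    have I: "{-12..12} - {-4..4} = {-12..<-4} \<union> {4<..12 :: real}" by auto
    show "?h ` cap_closure m e = twisted_legs (\<lambda>x. half_turns (- m) (x + 8)) (\<lambda>x. half_turns (- m) (x + 8)) {-12..<-4} e \<union> cap_rest e"
      unfolding cap_closure_def cubic_outside_def I twist_Un image_Un 1 2 3 4 5 cap_rest_def by blast
  qed
qed

text \<open>The half twists of the lower leg slide around the cap and join those of the upper one.\<close>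

lemma cap_legs_isotopic_leg:
  "band_of (\<lambda>e. twisted_legs (\<lambda>x. half_turns (- m) (x + 8)) (\<lambda>x. half_turns (- m) (x + 8)) {-12..<-4} e \<union> cap_rest e)
   \<simeq> band_of (\<lambda>e. twisted_legs (\<lambda>x. full_turns (- m) (x + 8)) (\<lambda>x. 0) {-12..<-4} e \<union> cap_rest e)"
proof -
  let ?A = "\<lambda>x. half_turns (- m) (x + 8)"
  have cA: "continuous_on UNIV ?A" by (intro continuous_intros)
  show ?thesis
  \<comment> \<open>For \<open>x0 = -4\<close> and \<open>x < 0\<close> the level
    \<open>max (x + 4) |y|\<close> is the function that defines the left vertical arc; its cap is at
    \<open>x = -2\<close>.\<close>
  proof (rule isotopic_band_ofI[OF bounded_homeo_u_rotate[OF cA, of "-4"]])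
    fix e :: real assume e: "0 \<le> e" "e \<le> 1"
    have 1: "u_rotate (-4) ?A ` twisted_legs ?A ?A {-12..<-4} e = twisted_legs (\<lambda>x. full_turns (- m) (x + 8)) (\<lambda>x. 0) {-12..<-4} e"
      by (subst u_rotate_legs) (use e in \<open>auto simp: algebra_simps\<close>)
    have far: "u_rotate (-4) ?A (x, y, z) = (x, y, z)" if "4 < \<bar>y\<bar> \<or> 0 \<le> x" for x y z
    proof (rule u_rotate_far)
      have "4 \<le> u_level (-4) (x, y, z)" using that by (auto simp: u_level_def)
      then show "3/2 \<le> cmod (u_disc (-4) (x, y, z))"
        using abs_Re_le_cmod[of "u_disc (-4) (x, y, z)"] by (simp add: u_disc_def)
    qed
    have 2: "u_rotate (-4) ?A ` twist (\<lambda>x. 0) {4<..12} e = twist (\<lambda>x. 0) {4<..12} e"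
    proof (rule image_eq_self)
      fix p assume "p \<in> twist (\<lambda>x. 0) {4<..12} e"
      then obtain x y z where p: "p = (x, y, z)" "4 < x" unfolding twist_def by auto
      then show "u_rotate (-4) ?A p = p" using far[of y x z] by simp
    qed
    have 3: "u_rotate (-4) ?A ` outer 12 e = outer 12 e"
    proof (rule image_eq_self)
      fix p assume "p \<in> outer 12 e"
      then obtain x y z where p: "p = (x, y, z)" "12 < \<bar>x\<bar> \<or> 4 < \<bar>y\<bar>" unfolding outer_def by auto
      show "u_rotate (-4) ?A p = p"
      proof (cases "x < -12")
        case True
        then show ?thesis by (intro u_rotate_zero) (simp add: p turn_left)
      next
        case False
        then have "4 < \<bar>y\<bar> \<or> 0 \<le> x" using p(2) by linarith
        then show ?thesis unfolding p(1) by (rule far)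
      qed
    qed
    have v: "vertical_arcs e = cap (-4) (-4) e \<union> {p \<in> vertical_arcs e. 0 \<le> fst p}"
    proof (rule set_eqI)
      fix p :: R3
      obtain x y z where p: "p = (x, y, z)" by (metis prod.collapse)
      show "p \<in> vertical_arcs e \<longleftrightarrow> p \<in> cap (-4) (-4) e \<union> {p \<in> vertical_arcs e. 0 \<le> fst p}"
        using e by (cases "0 \<le> x") (auto simp: p mem_vertical_arcs cap_def u_level_def max_def split: if_splits)
    qed
    have 4: "u_rotate (-4) ?A ` cap (-4) (-4) e = cap (-4) (-4) e"
    proof (rule u_rotate_cap[OF cA _ _ e(2)])
      show "half_turns (- m) (x + 8) = of_int (- m) * pi" if "-4 \<le> x" for x
        using that turn_right[of "x + 8"] by simp
    qed simp
    have 5: "u_rotate (-4) ?A ` {p \<in> vertical_arcs e. 0 \<le> fst p} = {p \<in> vertical_arcs e. 0 \<le> fst p}"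
    proof (rule image_eq_self)
      fix p assume "p \<in> {p \<in> vertical_arcs e. 0 \<le> fst p}"
      then show "u_rotate (-4) ?A p = p" using far[of "fst (snd p)" "fst p" "snd (snd p)"] by simp
    qed
    have 6: "u_rotate (-4) ?A ` vertical_arcs e = vertical_arcs e"
      by (subst (1 2) v) (simp only: image_Un 4 5)
    show "u_rotate (-4) ?A ` (twisted_legs ?A ?A {-12..<-4} e \<union> cap_rest e) =
        twisted_legs (\<lambda>x. full_turns (- m) (x + 8)) (\<lambda>x. 0) {-12..<-4} e \<union> cap_rest e"
      unfolding image_Un cap_rest_def 1 2 3 6 ..
  qed
qed

lemma mem_cap_rest:
  assumes "0 \<le> e" "e \<le> 1"
  shows "(x, y, z) \<in> cap_rest e \<longleftrightarrow> z = 0 \<and>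
    ((4 < x \<and> x \<le> 12 \<and> \<bar>\<bar>y\<bar> - 2\<bar> \<le> e) \<or> (\<bar>x\<bar> \<le> 4 \<and> \<bar>max (4 - \<bar>x\<bar>) \<bar>y\<bar> - 2\<bar> \<le> e)
     \<or> ((12 < \<bar>x\<bar> \<or> 4 < \<bar>y\<bar>) \<and> \<bar>max (\<bar>x\<bar> - 11) \<bar>\<bar>y\<bar> - 5\<bar> - 3\<bar> \<le> e))"
proof -
  have "(\<exists>c\<in>{-1, 1}. z = 2 * c * sin 0 \<and> \<bar>y - 2 * c * cos 0\<bar> \<le> e) \<longleftrightarrow> z = 0 \<and> \<bar>\<bar>y\<bar> - 2\<bar> \<le> e"
    using assms by (auto simp: abs_le_iff abs_if)
  then show ?thesis
    unfolding cap_rest_def Un_iff mem_twist mem_vertical_arcs outer_abs[OF assms] by auto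
qed

text \<open>Tameness is obtained from the far end of the chain: the planar \<open>H_shape\<close> is
  tame, twisting its upper leg preserves this, and the isotopies are then followed
  backwards.\<close>

lemma skein_class_cap_closure:
  "tame (band_of (cap_closure m))" "skein_class (band_of (cap_closure m)) = a_pow (- m) \<odot> t_power 1"
proof -
  let ?K = "\<lambda>e. twisted_legs (\<lambda>x. full_turns (- m) (x + 8)) (\<lambda>x. 0) {-12..<-4} e \<union> cap_rest e"
  have HK: "(x, y, z) \<in> H_shape e \<longleftrightarrow> (x, y, z) \<in> cap_rest e \<or> (z = 0 \<and> -12 \<le> x \<and> x < -4 \<and> \<bar>\<bar>y\<bar> - 2\<bar> \<le> e)"
    if e: "0 \<le> e" "e \<le> 1" for x y z e
  proof -
    have "(x, y, z) \<in> H_shape e \<longleftrightarrow> z = 0 \<and> (((12 < \<bar>x\<bar> \<or> 4 < \<bar>y\<bar>) \<and> \<bar>max (\<bar>x\<bar> - 11) \<bar>\<bar>y\<bar> - 5\<bar> - 3\<bar> \<le> e)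
       \<or> (4 < \<bar>x\<bar> \<and> \<bar>x\<bar> \<le> 12 \<and> \<bar>\<bar>y\<bar> - 2\<bar> \<le> e) \<or> (\<bar>x\<bar> \<le> 4 \<and> \<bar>max (4 - \<bar>x\<bar>) \<bar>y\<bar> - 2\<bar> \<le> e))"
      using H_decomposition[OF e, of "\<bar>x\<bar>" "\<bar>y\<bar>"] by (simp add: H_shape_def)
    moreover have "4 < \<bar>x\<bar> \<and> \<bar>x\<bar> \<le> 12 \<longleftrightarrow> (4 < x \<and> x \<le> 12) \<or> (-12 \<le> x \<and> x < -4)" by auto
    ultimately show ?thesis unfolding mem_cap_rest[OF e] by blast
  qed
  have rest_leg: "x = -4 \<and> \<bar>y - 2\<bar> \<le> e \<and> z = 0"
    if e: "0 \<le> e" "e \<le> 1" and p: "(x, y, z) \<in> cap_rest e" "\<bar>x + 8\<bar> \<le> 4" "- 1/2 \<le> y" "y \<le> 6" for x y z e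
  proof -
    have x: "-12 \<le> x" "x \<le> -4" using p(2) by auto
    have z: "z = 0" using p(1) unfolding mem_cap_rest[OF e] by blast
    have "\<not> ((12 < \<bar>x\<bar> \<or> 4 < \<bar>y\<bar>) \<and> \<bar>max (\<bar>x\<bar> - 11) \<bar>\<bar>y\<bar> - 5\<bar> - 3\<bar> \<le> e)"
    proof
      assume *: "(12 < \<bar>x\<bar> \<or> 4 < \<bar>y\<bar>) \<and> \<bar>max (\<bar>x\<bar> - 11) \<bar>\<bar>y\<bar> - 5\<bar> - 3\<bar> \<le> e"
      then have y: "4 < y" using x p(3) by auto
      then have "\<bar>\<bar>y\<bar> - 5\<bar> \<le> 1" using p(4) by (simp add: abs_le_iff)
      then have "max (\<bar>x\<bar> - 11) \<bar>\<bar>y\<bar> - 5\<bar> \<le> 1" using x by simp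
      then have "2 \<le> \<bar>max (\<bar>x\<bar> - 11) \<bar>\<bar>y\<bar> - 5\<bar> - 3\<bar>" by linarith
      then show False using * e by linarith
    qed
    then have "\<bar>x\<bar> \<le> 4 \<and> \<bar>max (4 - \<bar>x\<bar>) \<bar>y\<bar> - 2\<bar> \<le> e"
      using p(1) x unfolding mem_cap_rest[OF e] by auto
    then have "x = -4" "\<bar>\<bar>y\<bar> - 2\<bar> \<le> e" using x by auto
    then show ?thesis using z p(3) e by (auto simp: abs_if split: if_splits)
  qed
  have tH: "tame (band_of H_shape)"
    by (rule isotopic_bands_tame[OF isotopic_bands_sym[OF H_shape_isotopic] tame_frame])
  have iso: "band_of (cap_closure m) \<simeq> band_of ?K"
    by (rule isotopic_bands_trans[OF cap_closure_isotopic_legs cap_legs_isotopic_leg])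
  \<comment> \<open>The box is closed at \<open>x = -4\<close> while the legs end just before it; at
    this end point the ribbon has completed whole turns.\<close>
  have c4: "cis (full_turns (- m) 4) = 1"
    using cos_int_2pin[of m] sin_int_2pin[of m] by (simp add: complex_eq_iff turn_right)
  have K': "tame (band_of ?K) \<and> skein_class (band_of ?K) = a_pow (- m) \<odot> skein_class (band_of H_shape)"
  proof (rule skein_class_twisted_legs[where \<psi> = "full_turns (- m)" and s = 8 and I = "{-12..<-4}" and R = cap_rest, OF _ _ refl _ tH])
    fix e x y z :: real assume e: "0 \<le> e" "e \<le> 1"
    show "(x, y, z) \<in> H_shape e \<longleftrightarrow> (x, y, z) \<in> cap_rest e \<or> (z = 0 \<and> x \<in> {-12..<-4} \<and> \<bar>\<bar>y\<bar> - 2\<bar> \<le> e)"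
      using HK[OF e] by simp
    show "z = 0 \<and> \<bar>y - 2\<bar> \<le> e \<and> cis (full_turns (- m) (x + 8)) = 1"
      if r: "(x, y, z) \<in> cap_rest e" and b: "(x, y, z) \<in> leg_box 8"
    proof -
      have "\<bar>x + 8\<bar> \<le> 4" "- 1/2 \<le> y" "y \<le> 6" using b by (auto simp: leg_box_def)
      from rest_leg[OF e r this] c4 show ?thesis by auto
    qed
    show "(x, y, 0) \<in> cap_rest e" if "\<bar>x + 8\<bar> \<le> 4" "x \<notin> {-12..<-4}" "\<bar>y - 2\<bar> \<le> e"
    proof -
      have "x = -4" "1 \<le> y" "y \<le> 3" using that e by auto
      then show ?thesis using that unfolding mem_cap_rest[OF e] by simp
    qed
  next
    fix x :: real assume "\<bar>x + 8\<bar> \<le> 4" "x \<notin> {-12..<-4}"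
    then have "x = -4" by auto
    then show "cis (full_turns (- m) (x + 8)) = 1" using c4 by simp
  qed (auto intro!: continuous_intros)
  show t: "tame (band_of (cap_closure m))" by (rule isotopic_bands_tame[OF isotopic_bands_sym[OF iso] conjunct1[OF K']])
  show "skein_class (band_of (cap_closure m)) = a_pow (- m) \<odot> t_power 1"
    using isotopic_bands_skein_class[OF iso t] conjunct2[OF K'] isotopic_bands_skein_class[OF H_shape_isotopic tH]
    unfolding t_power_1 by (simp only:)
qed

section \<open>The closure of a single crossing\<close>

text \<open>The rotation angle for which the two strands of the crossing project to straight lines.\<close>

definition diag_angle :: "real \<Rightarrow> real" where
  "diag_angle x = arccos (clamp_to 1 (- x / 2))"

definition diag_height :: "real \<Rightarrow> real" where
  "diag_height x = 2 * sin (diag_angle x)"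

lemma clamp_to_1_range: "- 1 \<le> clamp_to 1 x" "clamp_to 1 x \<le> 1"
  by (auto simp: clamp_to_def)

lemma continuous_diag_angle: "continuous_on UNIV diag_angle"
  unfolding diag_angle_def
  by (rule continuous_on_arccos) (auto intro!: continuous_intros clamp_to_1_range)

lemma cos_diag_angle: "cos (diag_angle x) = clamp_to 1 (- x / 2)"
  unfolding diag_angle_def by (rule cos_arccos) (rule clamp_to_1_range)+

lemma diag_angle_left: "x \<le> -2 \<Longrightarrow> diag_angle x = 0"
  by (simp add: diag_angle_def clamp_to_high)

lemma diag_angle_right: "2 \<le> x \<Longrightarrow> diag_angle x = pi"
  by (simp add: diag_angle_def clamp_to_low)

lemma diag_height_0: "2 \<le> \<bar>x\<bar> \<Longrightarrow> diag_height x = 0"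
  using diag_angle_left[of x] diag_angle_right[of x] by (auto simp: diag_height_def abs_if split: if_splits)

lemma diag_height_nonneg: "0 \<le> diag_height x"
  unfolding diag_height_def diag_angle_def
  using arccos_lbound[OF clamp_to_1_range] arccos_ubound[OF clamp_to_1_range]
  by (simp add: sin_ge_zero)

lemma diag_height_le: "diag_height x \<le> 2"
  by (simp add: diag_height_def)

lemma diag_height_pos: "\<bar>x\<bar> < 2 \<Longrightarrow> 0 < diag_height x"
proof -
  assume x: "\<bar>x\<bar> < 2"
  then have c: "clamp_to 1 (- x / 2) = - x / 2" by (intro clamp_to_mid) auto
  have "0 < diag_angle x" "diag_angle x < pi"
    unfolding diag_angle_def c using x arccos_lt_bounded[of "- x / 2"] by auto
  then show ?thesis unfolding diag_height_def by (simp add: sin_gt_zero)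
qed

lemma continuous_diag_height [continuous_intros]:
  fixes f :: "'a::t2_space \<Rightarrow> real"
  shows "continuous_on A f \<Longrightarrow> continuous_on A (\<lambda>x. diag_height (f x))"
  unfolding diag_height_def
  by (intro continuous_intros continuous_on_sin continuous_on_compose2[OF continuous_diag_angle]) auto

definition crossing :: "(real \<Rightarrow> real \<Rightarrow> real) \<Rightarrow> real \<Rightarrow> R3 set" where
  "crossing k e = {(x, y, k x y) | x y. \<bar>y\<bar> \<le> 5 \<and> \<bar>x + y\<bar> \<le> e} \<union> {(x, y, - k x y) | x y. \<bar>y\<bar> \<le> 5 \<and> \<bar>x - y\<bar> \<le> e}"

text \<open>The planar part of a figure eight: from the crossing the sides follow
  \<open>|x| = |y|\<close> up to 6, then run vertically to the edges at \<open>|y| = 12\<close>. The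
  parameter \<open>b\<close> says where the crossing is cut out.\<close>

definition loops :: "real \<Rightarrow> real \<Rightarrow> R3 set" where
  "loops b e = {p. snd (snd p) = 0 \<and> b \<le> \<bar>fst (snd p)\<bar> \<and> \<bar>max (\<bar>fst p\<bar> - min \<bar>fst (snd p)\<bar> 6) (\<bar>fst (snd p)\<bar> - 12)\<bar> \<le> e}"

lemma mem_crossing: "(x, y, z) \<in> crossing k e \<longleftrightarrow> \<bar>y\<bar> \<le> 5 \<and> ((\<bar>x + y\<bar> \<le> e \<and> z = k x y) \<or> (\<bar>x - y\<bar> \<le> e \<and> z = - k x y))"
  unfolding crossing_def by auto

lemma mem_twist_diag:
  "(x, y, z) \<in> twist diag_angle {-4..4} e \<longleftrightarrow> \<bar>x\<bar> \<le> 4 \<and>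
    ((\<bar>y + clamp_to 2 x\<bar> \<le> e \<and> z = diag_height x) \<or> (\<bar>y - clamp_to 2 x\<bar> \<le> e \<and> z = - diag_height x))"
proof -
  have "2 * clamp_to 1 (- x / 2) = - clamp_to 2 x" by (auto simp: clamp_to_def max_def min_def)
  then show ?thesis
    unfolding mem_twist cos_diag_angle diag_height_def by (auto simp: mult.assoc)
qed

lemma outer_4_decomposition:
  fixes X Y e :: real
  assumes "0 \<le> e" "e \<le> 1" "2 < X" "0 \<le> Y"
  shows "((4 < X \<or> 4 < Y) \<and> \<bar>max (X - 3) \<bar>Y - 5\<bar> - 3\<bar> \<le> e) \<or> (X \<le> 4 \<and> \<bar>Y - 2\<bar> \<le> e)
    \<longleftrightarrow> \<bar>max (4 - Y) (max (X - 4) (Y - 6)) - 2\<bar> \<le> e"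
proof -
  consider "X \<le> 4" "Y \<le> 4" | "4 < X" "Y \<le> 4" | "4 < Y" "Y \<le> 5" | "5 < Y" by linarith
  then show ?thesis
    by cases (use assms in \<open>auto simp: max_def abs_le_iff abs_of_nonpos abs_of_nonneg\<close>)
qed

lemma loop_lift_arith:
  fixes X Y Z c e :: real
  assumes e: "0 \<le> e" "e \<le> 1" and X: "2 < X" and Y: "0 \<le> Y" and c: "c = max 0 (min 5 (X - 2))"
    and Z: "Z = lift 4 c Y"
  shows "\<bar>max (X - min Z 6) (Z - 12)\<bar> \<le> e \<longleftrightarrow> \<bar>max (4 - Y) (max (X - 4) (Y - 6)) - 2\<bar> \<le> e"
proof -
  have c0: "0 \<le> c" "c < 4 + 4" using c by auto
  note lv = lift_values[OF c0 Y, folded Z]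
  consider "X \<le> 7" "c = X - 2" | "7 < X" "c = 5" using c X by fastforce
  then show ?thesis
  proof cases
    case 1
    consider "Y < 1" | "1 \<le> Y" "Y \<le> 3" | "3 < Y" "Y < 7" | "7 \<le> Y" by linarith
    then show ?thesis
      by cases (use lv 1 e X Y in \<open>auto simp: max_def min_def abs_le_iff\<close>)
  next
    case 2
    consider "Y < 1" | "1 \<le> Y" "Y \<le> 3" | "3 < Y" "Y < 7" | "7 \<le> Y" by linarith
    then show ?thesis
      by cases (use lv 2 e X Y in \<open>auto simp: max_def min_def abs_le_iff\<close>)
  qed
qed

text \<open>By the choice of \<open>diag_angle\<close> the strands are diagonal for
  \<open>|x| \<le> 2\<close>. Lifting the legs by \<open>|x| - 2\<close> continues the diagonals,
  and \<open>T = 4\<close> takes the edges from 8 to 12, so that the projection becomes a figure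
  eight.\<close>

lemma crossing_lift:
  "band_of (closed_twist 4 diag_angle) \<simeq> band_of (\<lambda>e. crossing (\<lambda>x y. diag_height x) e \<union> loops 5 e)"
proof -
  let ?c = "\<lambda>x :: real. max 0 (min 5 (\<bar>x\<bar> - 2))"
  have bh: "bounded_homeo (lift_map 4 ?c)"
    by (rule bounded_homeo_lift_map) (auto intro!: continuous_intros)
  show ?thesis
  proof (rule isotopic_band_ofI[OF bh], rule bounded_homeo_image_eqI[OF bh])
    fix e :: real and p :: R3 assume e: "0 \<le> e" "e \<le> 1"
    obtain x y z where p: "p = (x, y, z)" by (metis prod.collapse)
    define y' where "y' = lift 4 (?c x) y"
    have ay: "\<bar>y'\<bar> = lift 4 (?c x) \<bar>y\<bar>" unfolding y'_def by (rule lift_abs) auto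
    have lhs: "(x, y', z) \<in> crossing (\<lambda>x y. diag_height x) e \<union> loops 5 e \<longleftrightarrow>
        (\<bar>y'\<bar> \<le> 5 \<and> ((\<bar>x + y'\<bar> \<le> e \<and> z = diag_height x) \<or> (\<bar>x - y'\<bar> \<le> e \<and> z = - diag_height x)))
        \<or> (z = 0 \<and> 5 \<le> \<bar>y'\<bar> \<and> \<bar>max (\<bar>x\<bar> - min \<bar>y'\<bar> 6) (\<bar>y'\<bar> - 12)\<bar> \<le> e)"
      by (simp add: mem_crossing loops_def)
    have "(x, y', z) \<in> crossing (\<lambda>x y. diag_height x) e \<union> loops 5 e \<longleftrightarrow> (x, y, z) \<in> closed_twist 4 diag_angle e"
    proof (cases "\<bar>x\<bar> \<le> 2")
      case True
      then have c: "?c x = 0" and cl: "clamp_to 2 x = x" by (auto simp: clamp_to_mid)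
      have out: "(x, y, z) \<in> outer 4 e \<longleftrightarrow> z = 0 \<and> \<bar>\<bar>y\<bar> - 8\<bar> \<le> e"
        using True e unfolding outer_abs[OF e] by (auto simp: max_def abs_if split: if_splits)
      have Y: "0 \<le> \<bar>y\<bar>" by simp
      note lv = lift_values[of "?c x" 4, OF _ _ Y, folded ay, unfolded c]
      consider "\<bar>y\<bar> \<le> 3" | "3 < \<bar>y\<bar>" "\<bar>y\<bar> < 7" | "7 \<le> \<bar>y\<bar>" by linarith
      then show ?thesis
      proof cases
        case 1
        then have "y' = y" unfolding y'_def c by (simp add: lift_def clamp_to_mid)
        then show ?thesis
          unfolding lhs unfolding closed_twist_def Un_iff mem_twist_diag out cl using True e 1 by (auto simp: add.commute abs_minus_commute)
      next
        case 2
        then have "3 < \<bar>y'\<bar>" "\<bar>y'\<bar> < 11" using lv(3) by auto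
        then have "\<not> \<bar>x + y'\<bar> \<le> e" "\<not> \<bar>x - y'\<bar> \<le> e" "\<not> (5 \<le> \<bar>y'\<bar> \<and> \<bar>max (\<bar>x\<bar> - min \<bar>y'\<bar> 6) (\<bar>y'\<bar> - 12)\<bar> \<le> e)"
          using True e by (auto simp: abs_le_iff max_def min_def abs_if split: if_splits)
        moreover have "\<not> \<bar>y + x\<bar> \<le> e" "\<not> \<bar>y - x\<bar> \<le> e" "\<not> \<bar>\<bar>y\<bar> - 8\<bar> \<le> e"
          using 2 True e by (auto simp: abs_le_iff abs_if split: if_splits)
        ultimately show ?thesis unfolding lhs unfolding closed_twist_def Un_iff mem_twist_diag out cl by blast
      next
        case 3
        then have y': "\<bar>y'\<bar> = \<bar>y\<bar> + 4" using lv(4) by auto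
        have "\<not> \<bar>y + x\<bar> \<le> e" "\<not> \<bar>y - x\<bar> \<le> e" using 3 True e by (auto simp: abs_le_iff abs_if split: if_splits)
        moreover have "\<bar>max (\<bar>x\<bar> - min (\<bar>y\<bar> + 4) 6) (\<bar>y\<bar> + 4 - 12)\<bar> \<le> e \<longleftrightarrow> \<bar>\<bar>y\<bar> - 8\<bar> \<le> e"
          using 3 True e by (simp add: max_absorb2)
        ultimately show ?thesis unfolding lhs unfolding closed_twist_def Un_iff mem_twist_diag out cl y' using 3 by auto
      qed
    next
      case False
      then have x: "2 < \<bar>x\<bar>" and k: "diag_height x = 0" by (auto simp: diag_height_0)
      have "(\<bar>x + y'\<bar> \<le> e \<or> \<bar>x - y'\<bar> \<le> e) \<longleftrightarrow> \<bar>\<bar>x\<bar> - \<bar>y'\<bar>\<bar> \<le> e"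
        using x e by (auto simp: abs_if split: if_splits)
      moreover have "\<bar>max (\<bar>x\<bar> - min \<bar>y'\<bar> 6) (\<bar>y'\<bar> - 12)\<bar> \<le> e \<longleftrightarrow> \<bar>\<bar>x\<bar> - \<bar>y'\<bar>\<bar> \<le> e" if "\<bar>y'\<bar> \<le> 5"
        using that x e by (auto simp: max_def)
      ultimately have "(x, y', z) \<in> crossing (\<lambda>x y. diag_height x) e \<union> loops 5 e \<longleftrightarrow>
         z = 0 \<and> \<bar>max (\<bar>x\<bar> - min \<bar>y'\<bar> 6) (\<bar>y'\<bar> - 12)\<bar> \<le> e"
        unfolding lhs k by (cases "\<bar>y'\<bar> \<le> 5") auto
      also have "\<dots> \<longleftrightarrow> z = 0 \<and> \<bar>max (4 - \<bar>y\<bar>) (max (\<bar>x\<bar> - 4) (\<bar>y\<bar> - 6)) - 2\<bar> \<le> e"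
        using loop_lift_arith[OF e x _ refl ay] by simp
      also have "\<dots> \<longleftrightarrow> z = 0 \<and> (((4 < \<bar>x\<bar> \<or> 4 < \<bar>y\<bar>) \<and> \<bar>max (\<bar>x\<bar> - 3) \<bar>\<bar>y\<bar> - 5\<bar> - 3\<bar> \<le> e) \<or> (\<bar>x\<bar> \<le> 4 \<and> \<bar>\<bar>y\<bar> - 2\<bar> \<le> e))"
        using outer_4_decomposition[OF e x, of "\<bar>y\<bar>"] by simp
      also have "\<dots> \<longleftrightarrow> (x, y, z) \<in> closed_twist 4 diag_angle e"
      proof -
        have "clamp_to 2 x = 2 \<or> clamp_to 2 x = -2" using x by (auto simp: clamp_to_def abs_if split: if_splits)
        then have "(\<bar>y + clamp_to 2 x\<bar> \<le> e \<or> \<bar>y - clamp_to 2 x\<bar> \<le> e) \<longleftrightarrow> \<bar>\<bar>y\<bar> - 2\<bar> \<le> e"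
          using e by (auto simp: abs_if split: if_splits)
        then show ?thesis unfolding closed_twist_def Un_iff mem_twist_diag outer_abs[OF e] k by auto
      qed
      finally show ?thesis .
    qed
    then show "lift_map 4 ?c p \<in> crossing (\<lambda>x y. diag_height x) e \<union> loops 5 e \<longleftrightarrow> p \<in> closed_twist 4 diag_angle e"
      by (simp only: p lift_map_def fst_conv snd_conv y'_def)
  qed
qed

subsection \<open>Moving two sheets\<close>

text \<open>Carries the graphs of \<open>A\<close> and \<open>B\<close> to those of \<open>A'\<close> and \<open>B'\<close>, interpolating linearly in between.\<close>

definition sheet_map :: "(real \<Rightarrow> real \<Rightarrow> real) \<Rightarrow> (real \<Rightarrow> real \<Rightarrow> real) \<Rightarrow> (real \<Rightarrow> real \<Rightarrow> real) \<Rightarrow> (real \<Rightarrow> real \<Rightarrow> real) \<Rightarrow> real \<Rightarrow> real \<Rightarrow> real \<Rightarrow> real" where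
  "sheet_map A B A' B' x y z = (let m = max (B x y) (min (A x y) z) in
     (z - m) + (B' x y + (m - B x y) * ((A' x y - B' x y) / (A x y - B x y))))"

lemma sheet_map_values:
  assumes "B x y < A x y"
  shows "sheet_map A B A' B' x y (A x y) = A' x y" "sheet_map A B A' B' x y (B x y) = B' x y"
    "A' x y = A x y \<Longrightarrow> B' x y = B x y \<Longrightarrow> sheet_map A B A' B' x y z = z"
  using assms by (auto simp: sheet_map_def Let_def max_def min_def)

lemma bounded_homeo_sheet_map:
  assumes c: "continuous_on UNIV (\<lambda>p. A (fst p) (snd p))" "continuous_on UNIV (\<lambda>p. B (fst p) (snd p))"
      "continuous_on UNIV (\<lambda>p. A' (fst p) (snd p))" "continuous_on UNIV (\<lambda>p. B' (fst p) (snd p))"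
    and AB: "\<And>x y. B x y < A x y" "\<And>x y. B' x y < A' x y"
    and b: "\<And>x y. \<bar>A' x y - A x y\<bar> \<le> b" "\<And>x y. \<bar>B' x y - B x y\<bar> \<le> b"
  shows "bounded_homeo (\<lambda>p. (fst p, fst (snd p), sheet_map A B A' B' (fst p) (fst (snd p)) (snd (snd p))))"
proof (rule bounded_homeo_fiber_z[where B = b])
  have s: "continuous_on UNIV (\<lambda>p :: R3. F (fst p) (fst (snd p)))" if "continuous_on UNIV (\<lambda>p. F (fst p) (snd p))" for F :: "real \<Rightarrow> real \<Rightarrow> real"
  proof -
    have "continuous_on UNIV (\<lambda>p :: R3. (fst p, fst (snd p)))" by (intro continuous_intros)
    from continuous_on_compose2[OF that this] show ?thesis by simp
  qed
  have "A x y - B x y \<noteq> 0" for x y using AB(1)[of x y] by simp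
  then show "continuous_on UNIV (\<lambda>p :: R3. sheet_map A B A' B' (fst p) (fst (snd p)) (snd (snd p)))"
    unfolding sheet_map_def Let_def by (intro continuous_intros s c) auto
  have mono: "sheet_map A B A' B' x y z < sheet_map A B A' B' x y z'" if z: "z < z'" for x y z z'
  proof -
    define m m' where "m = max (B x y) (min (A x y) z)" and "m' = max (B x y) (min (A x y) z')"
    define q where "q = (A' x y - B' x y) / (A x y - B x y)"
    have q: "0 < q" using AB[of x y] AB(2)[of x y] by (simp add: q_def)
    have m: "m \<le> m'" "z - m \<le> z' - m'" "m < m' \<or> z - m < z' - m'"
      using z AB(1)[of x y] by (auto simp: m_def m'_def max_def min_def)
    have "(m - B x y) * q \<le> (m' - B x y) * q" using m q by (intro mult_right_mono) auto
    moreover have "m < m' \<Longrightarrow> (m - B x y) * q < (m' - B x y) * q" using q by (intro mult_strict_right_mono) auto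
    ultimately show ?thesis using m(2,3) unfolding sheet_map_def Let_def m_def[symmetric] m'_def[symmetric] q_def[symmetric] by linarith
  qed
  show "z = z'" if "sheet_map A B A' B' x y z = sheet_map A B A' B' x y z'" for x y z z'
    using mono[of z z' x y] mono[of z' z x y] that by (cases z z' rule: linorder_cases) auto
  show "\<bar>sheet_map A B A' B' x y z - z\<bar> \<le> b" for x y z
  proof -
    define m where "m = max (B x y) (min (A x y) z)"
    define t where "t = (m - B x y) / (A x y - B x y)"
    have d: "0 < A x y - B x y" using AB(1)[of x y] by simp
    have t: "0 \<le> t" "t \<le> 1" using d by (auto simp: t_def m_def)
    have m: "m = B x y + t * (A x y - B x y)" using d by (simp add: t_def)
    have "sheet_map A B A' B' x y z - z = (B' x y + t * (A' x y - B' x y)) - m"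
      unfolding sheet_map_def Let_def m_def[symmetric] by (simp add: t_def)
    also have "\<dots> = (1 - t) * (B' x y - B x y) + t * (A' x y - A x y)" unfolding m by (simp add: algebra_simps)
    finally have "\<bar>sheet_map A B A' B' x y z - z\<bar> \<le> \<bar>(1 - t) * (B' x y - B x y)\<bar> + \<bar>t * (A' x y - A x y)\<bar>"
      by (simp only: abs_triangle_ineq)
    also have "\<dots> \<le> (1 - t) * b + t * b"
      unfolding abs_mult using t b[of x y] by (intro add_mono mult_mono) auto
    finally show ?thesis by (simp add: algebra_simps)
  qed
qed

text \<open>A twist about the first axis has heights depending on \<open>x\<close>, one about the
  second axis has heights depending on \<open>y\<close>. Both are graphs over the same two crossing
  bands with the same strand on top, so a vertical motion of two sheets carries one to the
  other.\<close>

lemma crossing_heights: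
  "band_of (\<lambda>e. crossing (\<lambda>x y. diag_height x) e \<union> loops 5 e) \<simeq> band_of (\<lambda>e. crossing (\<lambda>x y. diag_height y) e \<union> loops 5 e)"
proof -
  \<comment> \<open>Equal to 1 wherever a strand has nonzero height, and 0 for
    \<open>|y| \<ge> 4\<close>, so that the old and the new sheets agree over the loops.\<close>
  define w :: "real \<Rightarrow> real" where "w y = max 0 (min 1 (4 - \<bar>y\<bar>))" for y
  have w: "0 \<le> w y" "w y \<le> 1" for y by (auto simp: w_def)
  have w1: "\<bar>y\<bar> \<le> 3 \<Longrightarrow> w y = 1" and w0: "4 \<le> \<bar>y\<bar> \<Longrightarrow> w y = 0" for y by (auto simp: w_def)
  have cw: "continuous_on S (\<lambda>x. w (f x))" if "continuous_on S f" for S :: "'a::topological_space set" and f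
    unfolding w_def by (intro continuous_intros that)
  \<comment> \<open>The last term of each sheet vanishes on its strand and separates the sheets
    elsewhere; where both such terms vanish, \<open>|x|\<close> and \<open>|y|\<close> are at most 1
    and the heights are positive.\<close>
  let ?A = "\<lambda>x y. diag_height x * w y + max 0 (\<bar>x + y\<bar> - 1)" and ?B = "\<lambda>x y. - (diag_height x * w y) - max 0 (\<bar>x - y\<bar> - 1)"
  let ?A' = "\<lambda>x y. diag_height y * w x + max 0 (\<bar>x + y\<bar> - 1)" and ?B' = "\<lambda>x y. - (diag_height y * w x) - max 0 (\<bar>x - y\<bar> - 1)"
  let ?h = "\<lambda>p :: R3. (fst p, fst (snd p), sheet_map ?A ?B ?A' ?B' (fst p) (fst (snd p)) (snd (snd p)))"
  have hw: "0 \<le> diag_height x * w y" "diag_height x * w y \<le> 2" for x y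
    using diag_height_nonneg[of x] diag_height_le[of x] w[of y] mult_mono[of "diag_height x" 2 "w y" 1] by auto
  have pos: "0 < diag_height x * w y" if "\<bar>x\<bar> \<le> 1" "\<bar>y\<bar> \<le> 1" for x y
    using diag_height_pos[of x] w1[of y] that by simp
  have near: "\<bar>x\<bar> \<le> 1 \<and> \<bar>y\<bar> \<le> 1" if "\<bar>x + y\<bar> \<le> 1" "\<bar>x - y\<bar> \<le> 1" for x y :: real
    using that by (auto simp: abs_le_iff)
  have AB: "?B x y < ?A x y" for x y
    using hw(1)[of x y] pos[of x y] near[of x y] by (cases "\<bar>x + y\<bar> \<le> 1"; cases "\<bar>x - y\<bar> \<le> 1") (auto simp: max_def)
  have AB': "?B' x y < ?A' x y" for x y
    using hw(1)[of y x] pos[of y x] near[of x y] by (cases "\<bar>x + y\<bar> \<le> 1"; cases "\<bar>x - y\<bar> \<le> 1") (auto simp: max_def)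
  have bh: "bounded_homeo ?h"
  proof (rule bounded_homeo_sheet_map[where b = 2, OF _ _ _ _ AB AB'])
    show "\<bar>?A' x y - ?A x y\<bar> \<le> 2" "\<bar>?B' x y - ?B x y\<bar> \<le> 2" for x y
      using hw[of x y] hw[of y x] by auto
  qed (intro continuous_intros cw)+
  have kw: "diag_height x * w y = diag_height x" if "\<bar>x + y\<bar> \<le> 1 \<or> \<bar>x - y\<bar> \<le> 1" for x y
  proof (cases "2 \<le> \<bar>x\<bar>")
    case False
    then have "\<bar>y\<bar> \<le> 3" using that by (auto simp: abs_le_iff)
    then show ?thesis by (simp add: w1)
  qed (simp add: diag_height_0)
  show ?thesis
  proof (rule isotopic_band_ofI[OF bh])
    fix e :: real assume e: "0 \<le> e" "e \<le> 1"
    have over: "?h (x, y, diag_height x) = (x, y, diag_height y)" if "\<bar>x + y\<bar> \<le> e" for x y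
    proof -
      have "\<bar>x + y\<bar> \<le> 1" using that e by simp
      then have "?A x y = diag_height x" "?A' x y = diag_height y"
        using kw[of x y] kw[of y x] by (simp_all add: add.commute)
      then show ?thesis using sheet_map_values(1)[where A = ?A and B = ?B and x = x and y = y, OF AB, of ?A' ?B'] by simp
    qed
    have under: "?h (x, y, - diag_height x) = (x, y, - diag_height y)" if "\<bar>x - y\<bar> \<le> e" for x y
    proof -
      have "\<bar>x - y\<bar> \<le> 1" using that e by simp
      then have "?B x y = - diag_height x" "?B' x y = - diag_height y"
        using kw[of x y] kw[of y x] by (simp_all add: abs_minus_commute)
      then show ?thesis using sheet_map_values(2)[where A = ?A and B = ?B and x = x and y = y, OF AB, of ?A' ?B'] by simp
    qed
    have 1: "?h ` crossing (\<lambda>x y. diag_height x) e = crossing (\<lambda>x y. diag_height y) e"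
      unfolding crossing_def image_Un
      by (intro arg_cong2[where f = "(\<union>)"] image_Collect2) (use over under in blast)+
    have 2: "?h ` loops 5 e = loops 5 e"
    proof (rule image_eq_self)
      fix p assume p: "p \<in> loops 5 e"
      obtain x y z where q: "p = (x, y, z)" by (metis prod.collapse)
      have y: "5 \<le> \<bar>y\<bar>" using p by (simp add: q loops_def)
      then have "?A' x y = ?A x y" "?B' x y = ?B x y" by (simp_all add: w0 diag_height_0)
      then show "?h p = p"
        using sheet_map_values(3)[where A = ?A and B = ?B and x = x and y = y and A' = ?A' and B' = ?B' and z = z, OF AB] by (simp add: q)
    qed
    show "?h ` (crossing (\<lambda>x y. diag_height x) e \<union> loops 5 e) = crossing (\<lambda>x y. diag_height y) e \<union> loops 5 e"
      unfolding image_Un 1 2 ..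
  qed
qed

subsection \<open>Untwisting the crossing\<close>

text \<open>The crossing is also a half twist about the second axis, of the opposite handedness. Turning the
  upper loop about this axis undoes it.\<close>

definition turn_upper :: "R3 \<Rightarrow> R3" where
  "turn_upper p = swap_xy (slice (\<lambda>u w. swirl 8 9 (- (diag_angle u * max 0 (min 1 (14 - u)))) w) (swap_xy p))"

lemma swap_xy_swap_xy [simp]: "swap_xy (swap_xy p) = p"
  by (simp add: swap_xy_def)

lemma swap_xy_image: "p \<in> swap_xy ` A \<longleftrightarrow> swap_xy p \<in> A"
  by (metis image_iff swap_xy_swap_xy)

text \<open>For \<open>|y| \<le> 2\<close> heights \<open>diag_height y\<close> over the diagonals
  are those of \<open>twist diag_angle\<close> with the first two coordinates interchanged. Beyond,
  the crossing is planar and joins the loops, so the cut moves from 5 to 2.\<close>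

lemma crossing_loops_swap:
  assumes e: "0 \<le> e" "e \<le> 1"
  shows "crossing (\<lambda>x y. diag_height y) e \<union> loops 5 e = swap_xy ` twist diag_angle {-2..2} e \<union> loops 2 e"
proof (rule set_eqI)
  fix p :: R3
  obtain x y z where p: "p = (x, y, z)" by (metis prod.collapse)
  have t: "p \<in> swap_xy ` twist diag_angle {-2..2} e \<longleftrightarrow>
      \<bar>y\<bar> \<le> 2 \<and> ((\<bar>x + y\<bar> \<le> e \<and> z = diag_height y) \<or> (\<bar>x - y\<bar> \<le> e \<and> z = - diag_height y))"
  proof -
    have "\<bar>y\<bar> \<le> 2 \<Longrightarrow> 2 * clamp_to 1 (- y / 2) = - y" by (simp add: clamp_to_mid)
    then show ?thesis
      unfolding swap_xy_image p swap_xy_def fst_conv snd_conv mem_twist cos_diag_angle diag_height_def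
      by (auto simp: mult.assoc abs_le_iff)
  qed
  have l: "p \<in> loops b e \<longleftrightarrow> z = 0 \<and> b \<le> \<bar>y\<bar> \<and> \<bar>max (\<bar>x\<bar> - min \<bar>y\<bar> 6) (\<bar>y\<bar> - 12)\<bar> \<le> e" for b
    by (simp add: p loops_def)
  show "p \<in> crossing (\<lambda>x y. diag_height y) e \<union> loops 5 e \<longleftrightarrow> p \<in> swap_xy ` twist diag_angle {-2..2} e \<union> loops 2 e"
  proof (cases "\<bar>y\<bar> < 2")
    case True
    then show ?thesis unfolding Un_iff t l unfolding p mem_crossing by auto
  next
    case False
    then have k: "diag_height y = 0" by (simp add: diag_height_0)
    have 1: "\<bar>x + y\<bar> \<le> e \<or> \<bar>x - y\<bar> \<le> e \<longleftrightarrow> \<bar>\<bar>x\<bar> - \<bar>y\<bar>\<bar> \<le> e"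
      using False e by (auto simp: abs_if split: if_splits)
    have 2: "\<bar>max (\<bar>x\<bar> - min \<bar>y\<bar> 6) (\<bar>y\<bar> - 12)\<bar> \<le> e \<longleftrightarrow> \<bar>\<bar>x\<bar> - \<bar>y\<bar>\<bar> \<le> e" if "\<bar>y\<bar> \<le> 5"
      using that False e by (auto simp: max_def)
    have 3: "\<bar>y\<bar> \<le> 5 \<or> 5 \<le> \<bar>y\<bar>" "\<bar>y\<bar> \<le> 2 \<Longrightarrow> \<bar>y\<bar> \<le> 5" "2 \<le> \<bar>y\<bar>" using False by auto
    show ?thesis unfolding Un_iff t l unfolding p mem_crossing k minus_zero using 1 2 3 by blast
  qed
qed

lemma bounded_homeo_turn_upper: "bounded_homeo turn_upper"
  unfolding turn_upper_def
proof (rule bounded_homeo_swap_xy, rule bounded_homeo_slice_swirl)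
  show "continuous_on UNIV (\<lambda>u. - (diag_angle u * max 0 (min 1 (14 - u))))"
    by (intro continuous_intros continuous_diag_angle)
qed auto

text \<open>For \<open>2 \<le> y \<le> 13\<close> the rotation angle is \<open>pi\<close> up to
  sign, which maps the upper loop to itself. The factor with \<open>14 - u\<close> lets the rotation
  fade above \<open>y = 13\<close>, where the band has ended, and the radius 8 contains its extent
  \<open>|x| \<le> 7\<close>.\<close>

lemma turn_upper_image:
  assumes e: "0 \<le> e" "e \<le> 1"
  shows "turn_upper ` (swap_xy ` twist diag_angle {-2..2} e \<union> loops 2 e) =
    swap_xy ` twisted_legs (\<lambda>x. - diag_angle x) (\<lambda>x. - diag_angle x) {-2..2} e \<union> loops 2 e"
proof -
  let ?\<alpha> = "\<lambda>u. - (diag_angle u * max 0 (min 1 (14 - u)))"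
  let ?g = "slice (\<lambda>u w. swirl 8 9 (?\<alpha> u) w)"
  have 1: "?g ` twist diag_angle {-2..2} e = twisted_legs (\<lambda>x. - diag_angle x) (\<lambda>x. - diag_angle x) {-2..2} e"
    by (rule untwist_legs) (use e in auto)
  have 2: "turn_upper ` swap_xy ` A = swap_xy ` ?g ` A" for A
    by (simp add: image_image turn_upper_def)
  have l: "(x, y, z) \<in> loops 2 e \<longleftrightarrow> z = 0 \<and> 2 \<le> \<bar>y\<bar> \<and> \<bar>max (\<bar>x\<bar> - min \<bar>y\<bar> 6) (\<bar>y\<bar> - 12)\<bar> \<le> e" for x y z
    by (simp add: loops_def)
  have bd: "\<bar>x\<bar> \<le> 7 \<and> \<bar>y\<bar> \<le> 13" if "(x, y, z) \<in> loops 2 e" for x y z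
  proof -
    have "max (\<bar>x\<bar> - min \<bar>y\<bar> 6) (\<bar>y\<bar> - 12) \<le> 1" using that e unfolding l abs_le_iff by linarith
    then show ?thesis by (auto simp: min_def split: if_splits)
  qed
  have tu: "turn_upper (x, y, 0) = (if y \<le> -2 then x else - x, y, 0)" if "\<bar>x\<bar> \<le> 7" "\<bar>y\<bar> \<le> 13" "2 \<le> \<bar>y\<bar>" for x y
  proof -
    have "cmod (Complex x 0) \<le> 8" using that by (simp add: complex_norm)
    then have s: "swirl 8 9 (?\<alpha> y) (Complex x 0) = Complex x 0 * cis (- diag_angle y)"
      using that by (simp add: swirl_inner)
    show ?thesis
    proof (cases "y \<le> -2")
      case True
      then show ?thesis using s by (simp add: turn_upper_def swap_xy_def slice_eq diag_angle_left)
    next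
      case False
      then have "2 \<le> y" using that by linarith
      then have d: "diag_angle y = pi" by (rule diag_angle_right)
      show ?thesis using s False unfolding d by (simp add: turn_upper_def swap_xy_def slice_eq d)
    qed
  qed
  have 3: "turn_upper ` loops 2 e = loops 2 e"
  proof (intro equalityI subsetI)
    fix p assume "p \<in> turn_upper ` loops 2 e"
    then obtain x y z where p: "p = turn_upper (x, y, z)" "(x, y, z) \<in> loops 2 e" by auto
    then have "z = 0" "2 \<le> \<bar>y\<bar>" by (simp_all add: l)
    moreover define x' where "x' = (if y \<le> -2 then x else - x)"
    ultimately have "p = (x', y, 0)" using p bd[OF p(2)] tu[of x y] by simp
    moreover have ax: "\<bar>x'\<bar> = \<bar>x\<bar>" by (simp add: x'_def)
    have "(x', y, 0) \<in> loops 2 e" using p(2) unfolding \<open>z = 0\<close> l ax .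
    ultimately show "p \<in> loops 2 e" by simp
  next
    fix p assume p: "p \<in> loops 2 e"
    obtain x y z where q: "p = (x, y, z)" by (metis prod.collapse)
    have z: "z = 0" "2 \<le> \<bar>y\<bar>" using p by (simp_all add: q l)
    define x' where "x' = (if y \<le> -2 then x else - x)"
    have ax: "\<bar>x'\<bar> = \<bar>x\<bar>" by (simp add: x'_def)
    have m: "(x', y, 0) \<in> loops 2 e" using p unfolding q z(1) l ax .
    have "turn_upper (x', y, 0) = p" using tu[of x' y] bd[OF m] z by (simp add: q x'_def)
    then show "p \<in> turn_upper ` loops 2 e" using m by force
  qed
  show ?thesis unfolding image_Un 2 1 3 ..
qed

lemma twisted_legs_mem_bound:
  assumes "0 \<le> e" "e \<le> 1" "(x, y, z) \<in> twisted_legs \<phi> \<psi> I e"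
  shows "x \<in> I" "\<bar>y\<bar> \<le> 3"
proof -
  from assms(3) consider r where "x \<in> I" "\<bar>r\<bar> \<le> e" "y = 2 + r * cos (\<phi> x)"
    | r where "x \<in> I" "\<bar>r\<bar> \<le> e" "y = - 2 + r * cos (\<psi> x)"
    unfolding twisted_legs_def by auto
  then show "x \<in> I" "\<bar>y\<bar> \<le> 3"
  proof (atomize (full), cases)
    case (1 r)
    have "\<bar>r * cos (\<phi> x)\<bar> \<le> 1"
      using 1 assms(2) mult_mono[of "\<bar>r\<bar>" 1 "\<bar>cos (\<phi> x)\<bar>" 1] by (simp add: abs_mult)
    then show "x \<in> I \<and> \<bar>y\<bar> \<le> 3" using 1 by (auto simp: abs_le_iff)
  next
    case (2 r)
    have "\<bar>r * cos (\<psi> x)\<bar> \<le> 1"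
      using 2 assms(2) mult_mono[of "\<bar>r\<bar>" 1 "\<bar>cos (\<psi> x)\<bar>" 1] by (simp add: abs_mult)
    then show "x \<in> I \<and> \<bar>y\<bar> \<le> 3" using 2 by (auto simp: abs_le_iff)
  qed
qed

section \<open>From the figure eight to a frame with a twisted leg\<close>

definition frame_ends :: "real \<Rightarrow> R3 set" where
  "frame_ends e = {p \<in> horizontal_frame 10 e. 2 \<le> \<bar>fst p\<bar>}"

text \<open>On the loops \<open>min |y| 6\<close> is 2 plus the amount of shrinking, so the sides
  become the vertical lines \<open>|x| = 2\<close>. On the neck, \<open>|y| \<le> 2\<close>, this
  amount is 0.\<close>

lemma straighten_neck:
  assumes e: "0 \<le> e" "e \<le> 1"
  shows "shrink_map (\<lambda>y. max 0 (min 4 (\<bar>y\<bar> - 2))) ` (swap_xy ` twisted_legs \<phi> \<psi> {-2..2} e \<union> loops 2 e) =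
    swap_xy ` (twisted_legs \<phi> \<psi> {-2..2} e \<union> frame_ends e)"
proof -
  let ?c = "\<lambda>y :: real. max 0 (min 4 (\<bar>y\<bar> - 2))"
  have bh: "bounded_homeo (shrink_map ?c)"
    by (rule bounded_homeo_shrink_map[where B = 4]) (auto intro!: continuous_intros)
  have 1: "shrink_map ?c ` swap_xy ` twisted_legs \<phi> \<psi> {-2..2} e = swap_xy ` twisted_legs \<phi> \<psi> {-2..2} e"
  proof (rule image_eq_self)
    fix p assume "p \<in> swap_xy ` twisted_legs \<phi> \<psi> {-2..2} e"
    then have "swap_xy p \<in> twisted_legs \<phi> \<psi> {-2..2} e" by (simp add: swap_xy_image)
    then have "fst (snd p) \<in> {-2..2}"
      using twisted_legs_mem_bound(1)[OF e] unfolding swap_xy_def by blast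
    then have "?c (fst (snd p)) = 0" by auto
    moreover have "shrink 0 x = x" for x by (simp add: shrink_def clamp_to_def)
    ultimately show "shrink_map ?c p = p" by (simp add: shrink_map_def)
  qed
  have 2: "shrink_map ?c ` loops 2 e = swap_xy ` frame_ends e"
  proof (rule bounded_homeo_image_eqI[OF bh])
    fix p :: R3
    obtain x y z where p: "p = (x, y, z)" by (metis prod.collapse)
    have s: "shrink_map ?c p \<in> swap_xy ` frame_ends e \<longleftrightarrow> z = 0 \<and> \<bar>max \<bar>shrink (?c y) x\<bar> (\<bar>y\<bar> - 10) - 2\<bar> \<le> e \<and> 2 \<le> \<bar>y\<bar>"
      unfolding swap_xy_image p shrink_map_def swap_xy_def frame_ends_def horizontal_frame_def
        mem_Collect_eq fst_conv snd_conv by blast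
    have d: "0 \<le> ?c y" by simp
    have "\<bar>max \<bar>shrink (?c y) x\<bar> (\<bar>y\<bar> - 10) - 2\<bar> \<le> e \<longleftrightarrow> \<bar>max (\<bar>x\<bar> - ?c y) (\<bar>y\<bar> - 10) - 2\<bar> \<le> e"
      unfolding shrink_abs[OF d] by (rule shrink_arith[OF e _ d]) simp
    moreover have "max (\<bar>x\<bar> - ?c y) (\<bar>y\<bar> - 10) - 2 = max (\<bar>x\<bar> - min \<bar>y\<bar> 6) (\<bar>y\<bar> - 12)" if "2 \<le> \<bar>y\<bar>"
    proof -
      have "?c y = min \<bar>y\<bar> 6 - 2" using that by (simp add: max_def min_def)
      moreover have "max (a - (b - 2)) (c - 10) - 2 = max (a - b) (c - 12)" for a b c :: real by (simp add: max_def)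
      ultimately show ?thesis by (simp only:)
    qed
    moreover have "p \<in> loops 2 e \<longleftrightarrow> z = 0 \<and> 2 \<le> \<bar>y\<bar> \<and> \<bar>max (\<bar>x\<bar> - min \<bar>y\<bar> 6) (\<bar>y\<bar> - 12)\<bar> \<le> e"
      unfolding p loops_def mem_Collect_eq fst_conv snd_conv by (rule refl)
    ultimately show "shrink_map ?c p \<in> swap_xy ` frame_ends e \<longleftrightarrow> p \<in> loops 2 e"
      unfolding s by metis
  qed
  show ?thesis unfolding image_Un 1 2 ..
qed

text \<open>\<open>swap_xy\<close> followed by the clockwise quarter turn is the reflection in the
  second coordinate. It interchanges the legs and reverses the sense in which the ribbons turn,
  hence the sign.\<close>

lemma quarter_turn_neck:
  assumes e: "0 \<le> e" "e \<le> 1"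
  shows "quarter_turn ` swap_xy ` (twisted_legs (\<lambda>x. - \<phi> x) (\<lambda>x. - \<phi> x) {-2..2} e \<union> frame_ends e) =
    twisted_legs \<phi> \<phi> {-2..2} e \<union> frame_ends e"
proof -
  have fe: "\<bar>x\<bar> \<le> 13 \<and> \<bar>y\<bar> \<le> 3" if "(x, y, z) \<in> frame_ends e" for x y z
  proof -
    have "max \<bar>y\<bar> (\<bar>x\<bar> - 10) \<le> 3" using that e by (auto simp: frame_ends_def horizontal_frame_def abs_le_iff)
    then show ?thesis by auto
  qed
  have b: "\<bar>x\<bar> + \<bar>y\<bar> \<le> 40" if m: "(x, y, z) \<in> swap_xy ` (twisted_legs (\<lambda>x. - \<phi> x) (\<lambda>x. - \<phi> x) {-2..2} e \<union> frame_ends e)" for x y z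
  proof -
    have "(y, x, z) \<in> twisted_legs (\<lambda>x. - \<phi> x) (\<lambda>x. - \<phi> x) {-2..2} e \<or> (y, x, z) \<in> frame_ends e"
      using m unfolding swap_xy_image by (simp add: swap_xy_def)
    then show ?thesis
    proof
      assume "(y, x, z) \<in> twisted_legs (\<lambda>x. - \<phi> x) (\<lambda>x. - \<phi> x) {-2..2} e"
      from twisted_legs_mem_bound[OF e this] show ?thesis by auto
    next
      assume "(y, x, z) \<in> frame_ends e"
      from fe[OF this] show ?thesis by auto
    qed
  qed
  have neg: "(x, - y, z) \<in> twisted_legs (\<lambda>x. - \<phi> x) (\<lambda>x. - \<phi> x) I e \<Longrightarrow> (x, y, z) \<in> twisted_legs \<phi> \<phi> I e" for x y z \<phi> I
  proof -
    assume "(x, - y, z) \<in> twisted_legs (\<lambda>x. - \<phi> x) (\<lambda>x. - \<phi> x) I e"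
    then consider r where "x \<in> I" "\<bar>r\<bar> \<le> e" "- y = 2 + r * cos (- \<phi> x)" "z = r * sin (- \<phi> x)"
      | r where "x \<in> I" "\<bar>r\<bar> \<le> e" "- y = - 2 + r * cos (- \<phi> x)" "z = r * sin (- \<phi> x)"
      unfolding twisted_legs_def by auto
    then show "(x, y, z) \<in> twisted_legs \<phi> \<phi> I e"
    proof cases
      case (1 r)
      then show ?thesis unfolding twisted_legs_def
        by (intro UnI2 CollectI exI[of _ x] exI[of _ "- r"]) auto
    next
      case (2 r)
      then show ?thesis unfolding twisted_legs_def
        by (intro UnI1 CollectI exI[of _ x] exI[of _ "- r"]) auto
    qed
  qed
  have neg': "(x, - y, z) \<in> twisted_legs (\<lambda>x. - \<phi> x) (\<lambda>x. - \<phi> x) I e \<longleftrightarrow> (x, y, z) \<in> twisted_legs \<phi> \<phi> I e" for x y z I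
    using neg[of x y z \<phi> I] neg[of x "- y" z "\<lambda>x. - \<phi> x" I] by auto
  let ?L = "twisted_legs (\<lambda>x. - \<phi> x) (\<lambda>x. - \<phi> x) {-2..2} e \<union> frame_ends e"
  have im: "quarter_turn ` swap_xy ` ?L = {p. (- fst (snd p), fst p, snd (snd p)) \<in> swap_xy ` ?L}"
    by (rule quarter_turn_image) (rule b)
  show ?thesis
  proof (rule set_eqI)
    fix p :: R3
    obtain x y z where p: "p = (x, y, z)" by (metis prod.collapse)
    have "(x, - y, z) \<in> frame_ends e \<longleftrightarrow> (x, y, z) \<in> frame_ends e" by (simp add: frame_ends_def horizontal_frame_def)
    then show "p \<in> quarter_turn ` swap_xy ` ?L \<longleftrightarrow> p \<in> twisted_legs \<phi> \<phi> {-2..2} e \<union> frame_ends e"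
      unfolding im mem_Collect_eq swap_xy_image by (simp add: p swap_xy_def neg')
  qed
qed

text \<open>The rotation has the constant angle \<open>pi\<close> at the right end, which is
  symmetric under it, and is trivial at the left end. So the half turn of the lower leg passes
  around the right end and completes a full turn on the upper leg.\<close>

lemma slide_neck:
  assumes e: "0 \<le> e" "e \<le> 1"
  shows "u_rotate 10 diag_angle ` (twisted_legs diag_angle diag_angle {-2..2} e \<union> frame_ends e) =
    twisted_legs (\<lambda>x. 2 * diag_angle x) (\<lambda>x. 0) {-2..2} e \<union> frame_ends e"
proof -
  have 1: "u_rotate 10 diag_angle ` twisted_legs diag_angle diag_angle {-2..2} e = twisted_legs (\<lambda>x. 2 * diag_angle x) (\<lambda>x. 0) {-2..2} e"
    by (subst u_rotate_legs) (use e in \<open>auto simp: algebra_simps\<close>)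
  have split: "frame_ends e = cap 10 2 e \<union> {p \<in> frame_ends e. fst p \<le> -2}"
  proof (rule set_eqI)
    fix p :: R3
    obtain x y z where p: "p = (x, y, z)" by (metis prod.collapse)
    show "p \<in> frame_ends e \<longleftrightarrow> p \<in> cap 10 2 e \<union> {p \<in> frame_ends e. fst p \<le> -2}"
      by (cases "2 \<le> x") (auto simp: p frame_ends_def horizontal_frame_def cap_def u_level_def max.commute abs_if split: if_splits)
  qed
  have 2: "u_rotate 10 diag_angle ` cap 10 2 e = cap 10 2 e"
    by (rule u_rotate_cap[OF continuous_diag_angle, of _ 1]) (use e in \<open>auto simp: diag_angle_right\<close>)
  have 3: "u_rotate 10 diag_angle ` {p \<in> frame_ends e. fst p \<le> -2} = {p \<in> frame_ends e. fst p \<le> -2}"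
    by (rule image_eq_self) (auto intro!: u_rotate_zero diag_angle_left)
  have 4: "u_rotate 10 diag_angle ` frame_ends e = frame_ends e"
    by (subst (1 2) split) (simp only: image_Un 2 3)
  show ?thesis unfolding image_Un 1 4 ..
qed

definition untwisted_crossing :: "real \<Rightarrow> R3 set" where
  "untwisted_crossing e = twisted_legs (\<lambda>x. 2 * diag_angle x) (\<lambda>x. 0) {-2..2} e \<union> frame_ends e"

lemma closed_crossing_isotopic:
  "band_of (closed_twist 4 (half_turns 1)) \<simeq> band_of untwisted_crossing"
proof -
  have "band_of (closed_twist 4 (half_turns 1)) \<simeq> band_of (closed_twist 4 diag_angle)"
  proof (rule closed_twist_isotopic)
    show "half_turns 1 x = diag_angle x" if "4 \<le> \<bar>x\<bar>" for x
      using that diag_angle_left[of x] diag_angle_right[of x] turn_left[of x] turn_right[of x]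
      by (cases "x \<le> -4") auto
  qed (intro continuous_intros continuous_diag_angle)+
  also have "\<dots> \<simeq> band_of (\<lambda>e. crossing (\<lambda>x y. diag_height x) e \<union> loops 5 e)" by (rule crossing_lift)
  also have "\<dots> \<simeq> band_of (\<lambda>e. crossing (\<lambda>x y. diag_height y) e \<union> loops 5 e)" by (rule crossing_heights)
  also have "\<dots> \<simeq> band_of (\<lambda>e. swap_xy ` twisted_legs (\<lambda>x. - diag_angle x) (\<lambda>x. - diag_angle x) {-2..2} e \<union> loops 2 e)"
    by (rule isotopic_band_ofI[OF bounded_homeo_turn_upper]) (simp only: crossing_loops_swap turn_upper_image)
  also have "\<dots> \<simeq> band_of (\<lambda>e. swap_xy ` (twisted_legs (\<lambda>x. - diag_angle x) (\<lambda>x. - diag_angle x) {-2..2} e \<union> frame_ends e))"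
  proof (rule isotopic_band_ofI)
    show "bounded_homeo (shrink_map (\<lambda>y. max 0 (min 4 (\<bar>y\<bar> - 2))))"
      by (rule bounded_homeo_shrink_map[where B = 4]) (auto intro!: continuous_intros)
  qed (rule straighten_neck)
  also have "\<dots> \<simeq> band_of (\<lambda>e. twisted_legs diag_angle diag_angle {-2..2} e \<union> frame_ends e)"
    by (rule isotopic_band_ofI[OF bounded_homeo_quarter_turn]) (rule quarter_turn_neck)
  also have "\<dots> \<simeq> band_of untwisted_crossing"
    unfolding untwisted_crossing_def[abs_def]
    by (rule isotopic_band_ofI[OF bounded_homeo_u_rotate[OF continuous_diag_angle]]) (rule slide_neck)
  finally show ?thesis .
qed

section \<open>Mirror images and the negative crossing\<close>

lemma mirror_z_mirror_z [simp]: "mirror_z (mirror_z p) = p"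
  by (simp add: mirror_z_def)

text \<open>The reflection itself is not of bounded displacement, but conjugating a bounded
  homeomorphism by it gives a bounded homeomorphism between the mirror images.\<close>

lemma isotopic_bands_mirror: "K \<simeq> L \<Longrightarrow> band_image mirror_z K \<simeq> band_image mirror_z L"
proof -
  assume "K \<simeq> L"
  then obtain h where h: "bounded_homeo h" "L = band_image h K" unfolding isotopic_bands_def by blast
  have "band_image (\<lambda>p. mirror_z (h (mirror_z p))) (band_image mirror_z K) = band_image mirror_z L"
    unfolding h(2) band_image_comp by simp
  then show ?thesis using bounded_homeo_mirror_z[OF h(1)] unfolding isotopic_bands_def by blast
qed

lemma mirror_closed_twist: "mirror_z ` closed_twist a \<beta> e = closed_twist a (\<lambda>x. - \<beta> x) e"
proof -
  have 1: "mirror_z ` twist \<beta> I e = twist (\<lambda>x. - \<beta> x) I e" for I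
    unfolding twist_def by (rule image_Collect3) (simp add: mirror_z_def)
  have 2: "mirror_z ` outer a e = outer a e"
    by (rule image_eq_self) (auto simp: outer_def mirror_z_def)
  show ?thesis unfolding closed_twist_def image_Un 1 2 ..
qed

lemma mirror_untwisted_crossing:
  "mirror_z ` untwisted_crossing e = twisted_legs (\<lambda>x. - 2 * diag_angle x) (\<lambda>x. 0) {-2..2} e \<union> frame_ends e"
proof -
  have 1: "mirror_z ` twisted_legs (\<lambda>x. 2 * diag_angle x) (\<lambda>x. 0) {-2..2} e = twisted_legs (\<lambda>x. - 2 * diag_angle x) (\<lambda>x. 0) {-2..2} e"
    unfolding twisted_legs_def image_Un
    by (intro arg_cong2[where f = "(\<union>)"] image_Collect2) (simp_all add: mirror_z_def)
  have 2: "mirror_z ` frame_ends e = frame_ends e"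
    by (rule image_eq_self) (auto simp: frame_ends_def horizontal_frame_def mirror_z_def prod_eq_iff)
  show ?thesis unfolding untwisted_crossing_def image_Un 1 2 ..
qed

lemma skein_class_twisted_frame:
  assumes t: "tame (band_of (horizontal_frame 10))" and \<psi>: "continuous_on UNIV \<psi>"
    and ends: "\<And>x. 2 \<le> \<bar>x\<bar> \<Longrightarrow> \<psi> x = (if x < 0 then 0 else 2 * pi * of_int k)"
  shows "tame (band_of (\<lambda>e. twisted_legs \<psi> (\<lambda>x. 0) {-2..2} e \<union> frame_ends e)) \<and>
    skein_class (band_of (\<lambda>e. twisted_legs \<psi> (\<lambda>x. 0) {-2..2} e \<union> frame_ends e)) = a_pow k \<odot> skein_class (band_of (horizontal_frame 10))"
proof -
  let ?K = "\<lambda>e. twisted_legs (\<lambda>x. \<psi> (x + 0)) (\<lambda>x. 0) {-2..2} e \<union> frame_ends e"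
  have flat: "cis (\<psi> x) = 1" if "2 \<le> \<bar>x\<bar>" for x
    using ends[OF that] cos_int_2pin[of k] sin_int_2pin[of k] by (simp add: complex_eq_iff)
  have "tame (band_of ?K) \<and> skein_class (band_of ?K) = a_pow k \<odot> skein_class (band_of (horizontal_frame 10))"
  proof (rule skein_class_twisted_legs[OF _ \<psi> _ _ t])
    show "\<psi> x = full_turns k x" if "4 \<le> \<bar>x\<bar>" for x
      using that ends[of x] turn_left[of x] turn_right[of x] by (cases "x < 0") auto
    show "cis (\<psi> (x + 0)) = 1" if "\<bar>x + 0\<bar> \<le> 4" "x \<notin> {-2..2}" for x
      using flat[of x] that by auto
    fix e x y z :: real assume e: "0 \<le> e" "e \<le> 1"
    have hf: "(x, y, z) \<in> horizontal_frame 10 e \<longleftrightarrow> z = 0 \<and> \<bar>\<bar>y\<bar> - 2\<bar> \<le> e" if "\<bar>x\<bar> \<le> 4" for x y z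
      using that by (simp add: horizontal_frame_def)
    show "(x, y, z) \<in> horizontal_frame 10 e \<longleftrightarrow> (x, y, z) \<in> frame_ends e \<or> (z = 0 \<and> x \<in> {-2..2} \<and> \<bar>\<bar>y\<bar> - 2\<bar> \<le> e)"
    proof (cases "\<bar>x\<bar> \<le> 4")
      case True
      then show ?thesis unfolding frame_ends_def mem_Collect_eq hf[OF True] by (auto simp: abs_le_iff)
    next
      case False
      then show ?thesis by (auto simp: frame_ends_def)
    qed
    show "z = 0 \<and> \<bar>y - 2\<bar> \<le> e \<and> cis (\<psi> (x + 0)) = 1" if "(x, y, z) \<in> frame_ends e" "(x, y, z) \<in> leg_box 0"
    proof -
      have x: "\<bar>x\<bar> \<le> 4" "2 \<le> \<bar>x\<bar>" "- 1/2 \<le> y" using that by (auto simp: leg_box_def frame_ends_def)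
      have "z = 0" "\<bar>\<bar>y\<bar> - 2\<bar> \<le> e" using that(1) hf[OF x(1), of y z] by (auto simp: frame_ends_def)
      then show ?thesis using x flat[of x] e by (auto simp: abs_if split: if_splits)
    qed
    show "(x, y, 0) \<in> frame_ends e" if "\<bar>x + 0\<bar> \<le> 4" "x \<notin> {-2..2}" "\<bar>y - 2\<bar> \<le> e"
    proof -
      have "\<bar>x\<bar> \<le> 4" "2 \<le> \<bar>x\<bar>" using that by auto
      moreover have "\<bar>\<bar>y\<bar> - 2\<bar> \<le> e" using that(3) e by (auto simp: abs_if split: if_splits)
      ultimately show ?thesis by (simp add: frame_ends_def hf)
    qed
  qed auto
  then show ?thesis by simp
qed

lemma skein_class_crossing:
  "tame (band_of (closed_twist 4 (half_turns 1)))"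
  "skein_class (band_of (closed_twist 4 (half_turns 1))) = a_pow 1 \<odot> t_power 1"
  "tame (band_of (closed_twist 4 (half_turns (- 1))))"
  "skein_class (band_of (closed_twist 4 (half_turns (- 1)))) = a_pow (- 1) \<odot> t_power 1"
proof -
  have hf: "band_of (horizontal_frame 10) \<simeq> band_of (frame_set 0)" by (rule horizontal_frame_isotopic) simp
  have th: "tame (band_of (horizontal_frame 10))"
    by (rule isotopic_bands_tame[OF isotopic_bands_sym[OF hf] tame_frame])
  have t1: "skein_class (band_of (horizontal_frame 10)) = t_power 1"
    unfolding t_power_1 by (rule isotopic_bands_skein_class[OF hf th])
  have c: "continuous_on UNIV (\<lambda>x. 2 * diag_angle x)" "continuous_on UNIV (\<lambda>x. - 2 * diag_angle x)"
    by (intro continuous_intros continuous_diag_angle)+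
  have ends: "2 * diag_angle x = (if x < 0 then 0 else 2 * pi * of_int 1)"
    "- 2 * diag_angle x = (if x < 0 then 0 else 2 * pi * of_int (- 1))" if "2 \<le> \<bar>x\<bar>" for x
    using that diag_angle_left[of x] diag_angle_right[of x] by (auto simp: abs_if split: if_splits)
  note pos = skein_class_twisted_frame[OF th c(1) ends(1), folded untwisted_crossing_def[abs_def]]
  note neg = skein_class_twisted_frame[OF th c(2) ends(2), folded mirror_untwisted_crossing]
  show tp: "tame (band_of (closed_twist 4 (half_turns 1)))"
    by (rule isotopic_bands_tame[OF isotopic_bands_sym[OF closed_crossing_isotopic] conjunct1[OF pos]])
  show "skein_class (band_of (closed_twist 4 (half_turns 1))) = a_pow 1 \<odot> t_power 1"
    using isotopic_bands_skein_class[OF closed_crossing_isotopic tp] conjunct2[OF pos] t1 by simp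
  have "band_image mirror_z (band_of (closed_twist 4 (half_turns 1))) = band_of (closed_twist 4 (half_turns (- 1)))"
    by (simp add: band_image_def band_of_def mirror_closed_twist)
  moreover have "band_image mirror_z (band_of untwisted_crossing) = band_of (\<lambda>e. mirror_z ` untwisted_crossing e)"
    by (simp add: band_image_def band_of_def)
  ultimately have iso: "band_of (closed_twist 4 (half_turns (- 1))) \<simeq> band_of (\<lambda>e. mirror_z ` untwisted_crossing e)"
    using isotopic_bands_mirror[OF closed_crossing_isotopic] by simp
  show tn: "tame (band_of (closed_twist 4 (half_turns (- 1))))"
    by (rule isotopic_bands_tame[OF isotopic_bands_sym[OF iso] conjunct1[OF neg]])
  show "skein_class (band_of (closed_twist 4 (half_turns (- 1)))) = a_pow (- 1) \<odot> t_power 1"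
    using isotopic_bands_skein_class[OF iso tn] conjunct2[OF neg] t1 by simp
qed

section \<open>The recursion for torus links\<close>

lemma skein_of_torus_link: "skein_of (torus_link n) = skein_class (band_of (closed_twist 4 (half_turns (int n))))"
  by (simp only: torus_link_def numerator_closure_tangle_D skein_class_def)

text \<open>Full twists reduce everything to the parity of \<open>n\<close>: even closures come from
  two planar frames, odd ones from the single crossing.\<close>

lemma tame_closed_twist: "tame (band_of (closed_twist 4 (half_turns n)))"
proof -
  have "tame (band_of (closed_twist 4 (half_turns 0)))"
    by (rule isotopic_bands_tame[OF closed_twist_0_isotopic tame_two_frames])
  from tame_closed_twist_step[OF this, of "n div 2"] tame_closed_twist_step[OF skein_class_crossing(1), of "n div 2"]
  have *: "tame (band_of (closed_twist 4 (half_turns (0 + 2 * (n div 2)))))"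
    "tame (band_of (closed_twist 4 (half_turns (1 + 2 * (n div 2)))))" .
  have "n = 0 + 2 * (n div 2) \<or> n = 1 + 2 * (n div 2)" by presburger
  then show ?thesis using * by metis
qed

definition torus_class :: "int \<Rightarrow> skein_module" where
  "torus_class n = skein_class (band_of (closed_twist 4 (half_turns n)))"

lemma torus_class_0: "torus_class 0 = t_power 2"
  unfolding torus_class_def t_power_2
  by (rule isotopic_bands_skein_class[OF closed_twist_0_isotopic tame_two_frames, symmetric])

lemma torus_class_1: "torus_class 1 = a_pow 1 \<odot> t_power 1"
  and torus_class_minus_1: "torus_class (- 1) = a_pow (- 1) \<odot> t_power 1"
  unfolding torus_class_def by (rule skein_class_crossing)+

text \<open>The exponent \<open>- m\<close> comes from the half turns outside the cube, which the
  cap converts into full twists of its ribbon. Negative \<open>m\<close> is included;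
  \<open>m = -1\<close> is needed to start the recursion.\<close>

lemma torus_class_recursion:
  "torus_class (m + 3) = b2 \<odot> torus_class (m + 2) + b1 \<odot> torus_class (m + 1) + b0 \<odot> torus_class m
    + (b_inf * a_pow (- m)) \<odot> t_power 1"
proof -
  note iso = cubic_outside_tangle_D_isotopic[of m]
  have t: "tame (band_union (band_of (cubic_outside m)) (tangle_D k))" for k
    by (rule isotopic_bands_tame[OF iso tame_closed_twist])
  have c: "skein_class (band_union (band_of (cubic_outside m)) (tangle_D k)) = torus_class (m + k)" for k
    unfolding torus_class_def by (rule isotopic_bands_skein_class[OF iso tame_closed_twist, symmetric])
  have "torus_class (m + 3) = b2 \<odot> torus_class (m + 2) + b1 \<odot> torus_class (m + 1) + b0 \<odot> torus_class (m + 0)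
      + b_inf \<odot> skein_class (band_of (cap_closure m))"
    using skein_class_cubic[OF outside_box_cubic_outside t] skein_class_cap_closure(1)[of m]
    by (simp only: c cubic_outside_tangle_D_inf)
  then show ?thesis by (simp only: skein_class_cap_closure(2) skein_scale_scale add_0_right)
qed

section \<open>Recursions of the coefficients\<close>

lemma P_shift_recursion:
  "i = k + 3 \<Longrightarrow> j = k + 2 \<Longrightarrow> l = k + 1 \<Longrightarrow> P_shift i = b2 * P_shift j + b1 * P_shift l + b0 * P_shift k"
  by (simp add: numeral_3_eq_3 numeral_2_eq_2)

text \<open>The recursion of \<open>P\<close> is applied to every summand but the first, whose
  factor \<open>P 0 = 1\<close> is an initial value and yields the extra power of \<open>a\<close>.
  In the shifted sums the leading terms vanish because \<open>P (-2) = P (-1) = 0\<close>, which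
  adjusts the lengths.\<close>

lemma U_recursion:
  "U (n + 4) (n + 3) = b2 * U (n + 3) (n + 2) + b1 * U (n + 2) (n + 1) + b0 * U (n + 1) n + a_pow (- 1 - int n)"
proof -
  let ?p = P_shift
  have U: "U k j = (\<Sum>i<j. a_pow (3 - int k + int i) * ?p (i + 2))" for k j
    by (simp add: U_def P_def nat_add_distrib)
  have s: "(\<Sum>i<Suc k. f i) = f 0 + (\<Sum>i<k. f (Suc i))" for f :: "nat \<Rightarrow> ground_ring" and k
    by (rule sum.lessThan_Suc_shift)
  let ?a = "\<lambda>j. a_pow (int j - int n)"
  have 4: "U (n + 4) (n + 3) = a_pow (- 1 - int n) + (\<Sum>j<n + 2. ?a j * ?p (j + 3))"
    unfolding U by (simp add: numeral_3_eq_3 s numeral_2_eq_2 algebra_simps del: sum.lessThan_Suc P_shift.simps(4))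
  have p: "?p (j + 3) = b2 * ?p (j + 2) + b1 * ?p (j + 1) + b0 * ?p j" for j
    by (rule P_shift_recursion) simp_all
  have "(\<Sum>j<n + 2. ?a j * ?p (j + 3)) = b2 * (\<Sum>j<n + 2. ?a j * ?p (j + 2)) + b1 * (\<Sum>j<n + 2. ?a j * ?p (j + 1)) + b0 * (\<Sum>j<n + 2. ?a j * ?p j)"
    unfolding p by (simp only: sum_distrib_left sum.distrib[symmetric]) (simp only: algebra_simps)
  moreover have "(\<Sum>j<n + 2. ?a j * ?p (j + 2)) = U (n + 3) (n + 2)"
    unfolding U by (simp add: algebra_simps)
  moreover have "(\<Sum>j<n + 2. ?a j * ?p (j + 1)) = U (n + 2) (n + 1)"
  proof -
    have "(\<Sum>j<n + 2. ?a j * ?p (j + 1)) = (\<Sum>j<n + 1. ?a (Suc j) * ?p (Suc j + 1))"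
      using s[of "\<lambda>j. ?a j * ?p (j + 1)" "n + 1"] by simp
    then show ?thesis unfolding U by (simp add: algebra_simps)
  qed
  moreover have "(\<Sum>j<n + 2. ?a j * ?p j) = U (n + 1) n"
  proof -
    have "(\<Sum>j<n + 2. ?a j * ?p j) = (\<Sum>j<n. ?a (Suc (Suc j)) * ?p (Suc (Suc j)))"
      using s[of "\<lambda>j. ?a j * ?p j" "n + 1"] s[of "\<lambda>j. ?a (Suc j) * ?p (Suc j)" n] by simp
    then show ?thesis unfolding U by (simp add: algebra_simps)
  qed
  ultimately show ?thesis unfolding 4 by (simp only: add.commute add.left_commute)
qed

definition coeff_1 :: "nat \<Rightarrow> ground_ring" where
  "coeff_1 n = a_pow 1 * P_shift (n + 1) + a_pow (- 1) * b0 * P_shift n + U n (n - 1) * b_inf"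

text \<open>\<open>P_shift n\<close> stands for \<open>P (int n - 2)\<close>. The truncated
  \<open>n - 1\<close> is exact for \<open>n \<ge> 1\<close>, the range in which the coefficients
  are used.\<close>

definition coeff_2 :: "nat \<Rightarrow> ground_ring" where
  "coeff_2 n = b1 * P_shift n + b0 * P_shift (n - 1)"

lemma coeff_1_recursion:
  "coeff_1 (n + 4) = b2 * coeff_1 (n + 3) + b1 * coeff_1 (n + 2) + b0 * coeff_1 (n + 1) + b_inf * a_pow (- 1 - int n)"
proof -
  have "P_shift (n + 4 + 1) = b2 * P_shift (n + 3 + 1) + b1 * P_shift (n + 2 + 1) + b0 * P_shift (n + 1 + 1)"
    "P_shift (n + 4) = b2 * P_shift (n + 3) + b1 * P_shift (n + 2) + b0 * P_shift (n + 1)"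
    by (rule P_shift_recursion; simp)+
  moreover have "n + 4 - 1 = n + 3" "n + 3 - 1 = n + 2" "n + 2 - 1 = n + 1" "n + 1 - 1 = n" by simp_all
  ultimately show ?thesis unfolding coeff_1_def by (simp only: U_recursion) (simp only: algebra_simps)
qed

lemma coeff_2_recursion:
  "coeff_2 (n + 4) = b2 * coeff_2 (n + 3) + b1 * coeff_2 (n + 2) + b0 * coeff_2 (n + 1)"
proof -
  have "P_shift (n + 4) = b2 * P_shift (n + 3) + b1 * P_shift (n + 2) + b0 * P_shift (n + 1)"
    by (rule P_shift_recursion; simp)
  moreover have "P_shift (n + 3) = b2 * P_shift (n + 2) + b1 * P_shift (n + 1) + b0 * P_shift n"
    by (rule P_shift_recursion; simp)
  moreover have "n + 4 - 1 = n + 3" "n + 3 - 1 = n + 2" "n + 2 - 1 = n + 1" "n + 1 - 1 = n" by simp_all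
  ultimately show ?thesis unfolding coeff_2_def by (simp only:) (simp only: algebra_simps)
qed

lemma skein_combination:
  "b2 \<odot> (x2 \<odot> t + y2 \<odot> s) + b1 \<odot> (x1 \<odot> t + y1 \<odot> s) + b0 \<odot> (x0 \<odot> t + y0 \<odot> s) + c \<odot> t =
    (b2 * x2 + b1 * x1 + b0 * x0 + c) \<odot> t + (b2 * y2 + b1 * y1 + b0 * y0) \<odot> s"
  by (simp only: skein_scale_add skein_scale_scale skein_scale_plus add.commute add.left_commute)

text \<open>The formula is claimed from \<open>n = 1\<close> on, while the recursion for
  \<open>n = 2\<close> and \<open>n = 3\<close> reaches back to the classes of index -1 and 0; these
  cases are therefore computed separately, and strong induction takes over at 4.\<close>

lemma torus_class_eq:
  assumes "1 \<le> n"
  shows "torus_class (int n) = coeff_1 n \<odot> t_power 1 + coeff_2 n \<odot> t_power 2"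
  using assms
proof (induction n rule: less_induct)
  case (less n)
  have 0: "t_power 2 = 0 \<odot> t_power 1 + 1 \<odot> t_power 2" "x \<odot> t_power 1 = x \<odot> t_power 1 + 0 \<odot> t_power 2" for x
    by (simp_all add: skein_scale_zero skein_scale_one)
  have U1: "U 1 0 = 0" "U 2 1 = a_pow 1" "U 3 2 = a_pow 0 + a_pow 1 * b2"
    by (simp_all add: U_def P_def numeral_2_eq_2 numeral_3_eq_3)
  have p: "P_shift 1 = 0" "P_shift 2 = 1" "P_shift 3 = b2" "P_shift 4 = b2 * b2 + b1"
    by (simp_all add: eval_nat_numeral)
  have c1: "coeff_1 1 = a_pow 1" "coeff_2 1 = 0"
    using p U1 by (simp_all add: coeff_1_def coeff_2_def numeral_2_eq_2[symmetric])
  \<comment> \<open>The trivial products with 0 and 1 are kept so that the right-hand sides match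
    \<open>skein_combination\<close> literally.\<close>
  have c2: "coeff_1 2 = b2 * a_pow 1 + b1 * 0 + b0 * a_pow (- 1) + b_inf * a_pow 1" "coeff_2 2 = b2 * 0 + b1 * 1 + b0 * 0"
    using p U1 by (simp_all add: coeff_1_def coeff_2_def algebra_simps)
  have c3: "coeff_1 3 = b2 * coeff_1 2 + b1 * a_pow 1 + b0 * 0 + b_inf * a_pow 0" "coeff_2 3 = b2 * coeff_2 2 + b1 * 0 + b0 * 1"
    using p U1 by (simp_all add: coeff_1_def coeff_2_def algebra_simps)
  have T1: "torus_class 1 = a_pow 1 \<odot> t_power 1 + 0 \<odot> t_power 2"
    and T0: "torus_class 0 = 0 \<odot> t_power 1 + 1 \<odot> t_power 2"
    and Tm: "torus_class (- 1) = a_pow (- 1) \<odot> t_power 1 + 0 \<odot> t_power 2"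
    unfolding torus_class_0 torus_class_1 torus_class_minus_1 using 0 by blast+
  have "torus_class 2 = b2 \<odot> torus_class 1 + b1 \<odot> torus_class 0 + b0 \<odot> torus_class (- 1) + (b_inf * a_pow 1) \<odot> t_power 1"
    using torus_class_recursion[of "- 1"] by simp
  then have T2: "torus_class 2 = coeff_1 2 \<odot> t_power 1 + coeff_2 2 \<odot> t_power 2"
    unfolding T1 T0 Tm skein_combination c2 .
  have "n = 1 \<or> n = 2 \<or> n = 3 \<or> 4 \<le> n" using less.prems by linarith
  then consider "n = 1" | "n = 2" | "n = 3" | m where "n = m + 4"
    by (metis add.commute le_Suc_ex)
  then show ?case
  proof cases
    case 1
    then show ?thesis using T1 c1 by simp
  next
    case 2
    then show ?thesis using T2 by simp
  next
    case 3
    have "torus_class 3 = b2 \<odot> torus_class 2 + b1 \<odot> torus_class 1 + b0 \<odot> torus_class 0 + (b_inf * a_pow 0) \<odot> t_power 1"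
      using torus_class_recursion[of 0] by simp
    then show ?thesis unfolding T2 T1 T0 skein_combination c3[symmetric] using 3 by simp
  next
    case (4 m)
    have "torus_class (int m + 1 + 3) = b2 \<odot> torus_class (int (m + 3)) + b1 \<odot> torus_class (int (m + 2)) + b0 \<odot> torus_class (int (m + 1))
        + (b_inf * a_pow (- 1 - int m)) \<odot> t_power 1"
      using torus_class_recursion[of "int m + 1"] by (simp add: algebra_simps)
    moreover have "int m + 1 + 3 = int n" using 4 by simp
    moreover have IH: "torus_class (int (m + k)) = coeff_1 (m + k) \<odot> t_power 1 + coeff_2 (m + k) \<odot> t_power 2"
      if "k \<in> {1, 2, 3}" for k
      using that 4 by (intro less.IH) auto
    have "torus_class (int (m + 1)) = coeff_1 (m + 1) \<odot> t_power 1 + coeff_2 (m + 1) \<odot> t_power 2"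
      "torus_class (int (m + 2)) = coeff_1 (m + 2) \<odot> t_power 1 + coeff_2 (m + 2) \<odot> t_power 2"
      "torus_class (int (m + 3)) = coeff_1 (m + 3) \<odot> t_power 1 + coeff_2 (m + 3) \<odot> t_power 2"
      by (intro IH; simp)+
    ultimately show ?thesis
      by (simp only: 4 skein_combination coeff_1_recursion coeff_2_recursion)
  qed
qed

theorem corollary4p4:
  fixes n :: nat
  assumes "n \<ge> 2"
  shows "skein_of (torus_link n) =
    (a_pow 1 * P (int n - 1) + a_pow (-1) * b0 * P (int n - 2) + U n (n - 1) * b_inf) \<odot> t_power 1
    + (b1 * P (int n - 2) + b0 * P (int n - 3)) \<odot> t_power 2"
proof -
  have "nat (int n - 1 + 2) = n + 1" "nat (int n - 2 + 2) = n" "nat (int n - 3 + 2) = n - 1" using assms by auto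
  then show ?thesis
    using torus_class_eq[of n] assms
    by (simp only: skein_of_torus_link torus_class_def coeff_1_def coeff_2_def P_def)
qed

end
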